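(* Let $X$ and $U$ be Banach lattices, let $\mathbb T=(T(t))_{t\ge0}$ be a positive $C_0$-semigroup on $X$ with generator $A$, and let $p\ge1$ be a real number. Let $\Phi=(\Phi_\tau)_{\tau\ge0}$ be a family of maps $\Phi_\tau:L^p_+(\mathbb R_+;U)\to X_+$ such that $$\Phi_\tau(u+v)=\Phi_\tau u+\Phi_\tau v,\qquad \Phi_{\tau+t}u=T(\tau)\Phi_t\mathcal P_tu+\Phi_\tau\mathcal S_tu$$ for any $u,v\in L^p_+(\mathbb R_+;U)$ and any $\tau,t\ge0$. Then $(T,\Phi)$ is an abstract positive linear control system on $L^p(\mathbb R_+;U)$ and $X$. In addition, there exists a unique positive control operator $B\in\mathcal L(U,X_{-1,A})$ such that $$\Phi_tu=\int_0^tT_{-1}(t-s)Bu_+(s)\,ds-\int_0^tT_{-1}(t-s)Bu_-(s)\,ds$$ for all $u\in L^p(\mathbb R_+;U)$ and $t\ge0$.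
   Context: For $\tau\ge0$, the truncation operator is $(\mathcal P_\tau u)(t)=u(t)$ for $t\in[0,\tau)$ and $0$ for $t\ge\tau$; the left shift operator is $(\mathcal S_\tau u)(t)=u(t+\tau)$ for $t\ge0$. $X_+$ and $U_+$ are the positive cones. $L^p_+(\mathbb R_+;U)$ is the set of $u\in L^p(\mathbb R_+;U)$ with $u(t)\in U_+$ for a.e. $t$; $u_+=u\vee0$ and $u_-=(-u)\vee0$. The semigroup $\mathbb T$ is positive if $T(t)X_+\subset X_+$ for all $t\ge0$. "$(T,\Phi)$ is an abstract positive linear control system on $L^p(\mathbb R_+;U)$ and $X$" means: each $\Phi_\tau$ extends uniquely to a positive linear operator from $L^p(\mathbb R_+;U)$ to $X$, again denoted $\Phi_\tau$ (so $\Phi_\tau u=\Phi_\tau u_+-\Phi_\tau u_-$); the extensions are bounded, $\Phi_\tau\in\mathcal L(L^p(\mathbb R_+;U),X)$; and $\Phi_{\tau+t}u=T(\tau)\Phi_t\mathcal P_tu+\Phi_\tau\mathcal S_tu$ for all $u\in L^p(\mathbb R_+;U)$ and $\tau,t\ge0$. In the last displayed formula of the claim, $\Phi_t$ is this extension. $X_{-1,A}$ is the completion of $X$ in the norm $\|x\|_{-1}=\|(\lambda I-A)^{-1}x\|$ for some $\lambda$ in the resolvent set $\rho(A)$; $T_{-1}(t)$ is the extension of $T(t)$ to $X_{-1,A}$, and the integrals are taken in $X_{-1,A}$. The positive cone $(X_{-1,A})_+$ is the closure of $X_+$ in $X_{-1,A}$; $B$ is positive if $BU_+\subset(X_{-1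,A})_+$.
   Formalization: The existence and uniqueness of B is stated under the extra condition Φ_0 = 0, which the formula at t = 0 forces; without it the claim fails, e.g. X = U = ℝ, T(t) = I, Φ_t u = ∫_0^∞ e^{-s}u(s+t) ds. *)

theory Defs
  imports "HOL-Analysis.Analysis" "HOL-Library.Lattice_Algebras"
begin

section \<open>Banach lattices\<close>

text \<open>A real Banach lattice; \<open>\<bar>x\<bar> = sup x (- x)\<close> holds by
  \<open>lattice_ab_group_add_abs\<close>.\<close>

class banach_lattice = banach + ordered_real_vector + lattice_ab_group_add_abs +
  assumes norm_mono_abs: "\<bar>x\<bar> \<le> \<bar>y\<bar> \<Longrightarrow> norm x \<le> norm y"


section \<open>Bochner integral and \<open>L\<^sup>p\<close> without separability\<close>

text \<open>The library's \<open>has_bochner_integral\<close> requires a second countable codomain.  The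
  following is the same definition with Borel measurability replaced by strong measurability,
  which is the right notion for a general Banach space.\<close>

definition strongly_measurable :: "'a measure \<Rightarrow> ('a \<Rightarrow> 'b::real_normed_vector) \<Rightarrow> bool" where
  "strongly_measurable M f \<longleftrightarrow>
     (\<exists>s. (\<forall>n::nat. simple_function M (s n)) \<and> (AE x in M. (\<lambda>n. s n x) \<longlonglongrightarrow> f x))"

definition has_strong_integral ::
    "'a measure \<Rightarrow> ('a \<Rightarrow> 'b::real_normed_vector) \<Rightarrow> 'b \<Rightarrow> bool" where
  "has_strong_integral M f I \<longleftrightarrow> strongly_measurable M f \<and>
     (\<exists>s. (\<forall>n::nat. Bochner_Integration.simple_bochner_integrable M (s n)) \<and>
          (\<lambda>n. \<integral>\<^sup>+x. ennreal (norm (f x - s n x)) \<partial>M) \<longlonglongrightarrow> 0 \<and>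
          (\<lambda>n. Bochner_Integration.simple_bochner_integral M (s n)) \<longlonglongrightarrow> I)"

definition strongly_integrable :: "'a measure \<Rightarrow> ('a \<Rightarrow> 'b::real_normed_vector) \<Rightarrow> bool" where
  "strongly_integrable M f \<longleftrightarrow> (\<exists>I. has_strong_integral M f I)"

definition strong_integral :: "'a measure \<Rightarrow> ('a \<Rightarrow> 'b::real_normed_vector) \<Rightarrow> 'b" where
  "strong_integral M f = (THE I. has_strong_integral M f I)"

text \<open>Elements of \<open>L\<^sup>p(\<real>\<^sub>+;U)\<close> are represented by functions on \<open>real\<close>, whose values at
  negative arguments are irrelevant; maps on \<open>L\<^sup>p\<close> are maps on representatives that respect
  almost everywhere equality \<open>ae_eq\<close>.\<close>

abbreviation halfline :: "real measure" where
  "halfline \<equiv> lebesgue_on {0..}"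

definition ae_eq :: "(real \<Rightarrow> 'u) \<Rightarrow> (real \<Rightarrow> 'u) \<Rightarrow> bool" where
  "ae_eq u v \<longleftrightarrow> (AE t in halfline. u t = v t)"

definition Lp :: "real \<Rightarrow> (real \<Rightarrow> 'u::real_normed_vector) set" where
  "Lp p = {u. strongly_measurable halfline u \<and> integrable halfline (\<lambda>t. norm (u t) powr p)}"

definition Lp_norm :: "real \<Rightarrow> (real \<Rightarrow> 'u::real_normed_vector) \<Rightarrow> real" where
  "Lp_norm p u = (\<integral>t. norm (u t) powr p \<partial>halfline) powr (1 / p)"

definition Lp_plus :: "real \<Rightarrow> (real \<Rightarrow> 'u::banach_lattice) set" where
  "Lp_plus p = {u \<in> Lp p. AE t in halfline. 0 \<le> u t}"

definition pos_part :: "(real \<Rightarrow> 'u::banach_lattice) \<Rightarrow> real \<Rightarrow> 'u" where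
  "pos_part u t = sup (u t) 0"

definition neg_part :: "(real \<Rightarrow> 'u::banach_lattice) \<Rightarrow> real \<Rightarrow> 'u" where
  "neg_part u t = sup (- u t) 0"

definition truncation :: "real \<Rightarrow> (real \<Rightarrow> 'u::zero) \<Rightarrow> real \<Rightarrow> 'u" where
  "truncation \<tau> u t = (if 0 \<le> t \<and> t < \<tau> then u t else 0)"

definition left_shift :: "real \<Rightarrow> (real \<Rightarrow> 'u) \<Rightarrow> real \<Rightarrow> 'u" where
  "left_shift \<tau> u t = u (t + \<tau>)"


section \<open>Positive semigroups, generator and resolvent\<close>

definition C0_semigroup :: "(real \<Rightarrow> 'x::real_normed_vector \<Rightarrow>\<^sub>L 'x) \<Rightarrow> bool" where
  "C0_semigroup T \<longleftrightarrow> T 0 = id_blinfun \<and>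
     (\<forall>s\<ge>0. \<forall>t\<ge>0. T (s + t) = T s o\<^sub>L T t) \<and>
     (\<forall>x. ((\<lambda>t. blinfun_apply (T t) x) \<longlongrightarrow> x) (at_right 0))"

definition positive_semigroup :: "(real \<Rightarrow> 'x::banach_lattice \<Rightarrow>\<^sub>L 'x) \<Rightarrow> bool" where
  "positive_semigroup T \<longleftrightarrow> (\<forall>t\<ge>0. \<forall>x\<ge>0. 0 \<le> blinfun_apply (T t) x)"

definition generator_dom :: "(real \<Rightarrow> 'x::real_normed_vector \<Rightarrow>\<^sub>L 'x) \<Rightarrow> 'x set" where
  "generator_dom T =
     {x. \<exists>y. ((\<lambda>h. (blinfun_apply (T h) x - x) /\<^sub>R h) \<longlongrightarrow> y) (at_right 0)}"

definition generator :: "(real \<Rightarrow> 'x::real_normed_vector \<Rightarrow>\<^sub>L 'x) \<Rightarrow> 'x \<Rightarrow> 'x" where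
  "generator T x = Lim (at_right 0) (\<lambda>h. (blinfun_apply (T h) x - x) /\<^sub>R h)"

definition resolvent ::
    "(real \<Rightarrow> 'x::real_normed_vector \<Rightarrow>\<^sub>L 'x) \<Rightarrow> real \<Rightarrow> 'x \<Rightarrow> 'x" where
  "resolvent T \<mu> = inv_into (generator_dom T) (\<lambda>x. \<mu> *\<^sub>R x - generator T x)"

definition resolvent_set :: "(real \<Rightarrow> 'x::real_normed_vector \<Rightarrow>\<^sub>L 'x) \<Rightarrow> real set" where
  "resolvent_set T =
     {\<mu>. bij_betw (\<lambda>x. \<mu> *\<^sub>R x - generator T x) (generator_dom T) UNIV \<and>
          bounded_linear (resolvent T \<mu>)}"


section \<open>Extrapolation space\<close>

text \<open>The space \<open>X\<^bsub>-1,A\<^esub>\<close> depends on \<open>A\<close>, so it cannot be a type constructed from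
  the type of \<open>X\<close>.  Instead, the complete space \<open>'z\<close> together with the embedding \<open>J\<close> is an
  arbitrary realization of the completion of \<open>X\<close> in the norm \<open>\<parallel>(\<mu>I - A)\<^sup>-\<^sup>1 x\<parallel>\<close>.
  For \<open>T\<close> a \<open>C\<^sub>0\<close>-semigroup there always is one: \<open>'z = 'x\<close> with \<open>J = resolvent T \<mu>\<close>,
  whose range is the dense set \<open>generator_dom T\<close>.\<close>

definition extrapolation_space ::
    "(real \<Rightarrow> 'x::real_normed_vector \<Rightarrow>\<^sub>L 'x) \<Rightarrow> real \<Rightarrow> ('x \<Rightarrow> 'z::banach) \<Rightarrow> bool" where
  "extrapolation_space T \<mu> J \<longleftrightarrow> linear J \<and>
     (\<forall>x. norm (J x) = norm (resolvent T \<mu> x)) \<and> closure (range J) = UNIV"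

definition extrapolated ::
    "('x::real_normed_vector \<Rightarrow> 'z::banach) \<Rightarrow> ('x \<Rightarrow>\<^sub>L 'x) \<Rightarrow> 'z \<Rightarrow>\<^sub>L 'z" where
  "extrapolated J S = (THE S'. \<forall>x. blinfun_apply S' (J x) = J (blinfun_apply S x))"

definition extrapolated_cone :: "('x::banach_lattice \<Rightarrow> 'z::banach) \<Rightarrow> 'z set" where
  "extrapolated_cone J = closure (J ` {x. 0 \<le> x})"

definition positive_control_operator ::
    "('x::banach_lattice \<Rightarrow> 'z::banach) \<Rightarrow> ('u::banach_lattice \<Rightarrow>\<^sub>L 'z) \<Rightarrow> bool" where
  "positive_control_operator J B \<longleftrightarrow> (\<forall>v\<ge>0. blinfun_apply B v \<in> extrapolated_cone J)"


section \<open>Abstract positive linear control systems\<close>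

definition positive_linear_extension ::
    "real \<Rightarrow> ((real \<Rightarrow> 'u::banach_lattice) \<Rightarrow> 'x::banach_lattice) \<Rightarrow>
     ((real \<Rightarrow> 'u) \<Rightarrow> 'x) \<Rightarrow> bool" where
  "positive_linear_extension p F G \<longleftrightarrow>
     (\<forall>u\<in>Lp p. \<forall>v\<in>Lp p. ae_eq u v \<longrightarrow> G u = G v) \<and>
     (\<forall>u\<in>Lp p. \<forall>v\<in>Lp p. G (\<lambda>t. u t + v t) = G u + G v) \<and>
     (\<forall>c. \<forall>u\<in>Lp p. G (\<lambda>t. c *\<^sub>R u t) = c *\<^sub>R G u) \<and>
     (\<forall>u\<in>Lp_plus p. 0 \<le> G u) \<and>
     (\<forall>u\<in>Lp_plus p. G u = F u)"

text \<open>\<open>\<Psi>\<close> is the family of extensions of \<open>\<Phi>\<close> from \<open>L\<^sup>p\<^sub>+\<close> to \<open>L\<^sup>p\<close>.  It is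
  determined by \<open>\<Phi>\<close> on \<open>L\<^sup>p\<close>, and only its values there matter.

  The functional equation alone does not make \<open>\<Phi> 0\<close> vanish: at \<open>\<tau> = 0\<close> it reads
  \<open>\<Phi> t u = \<Phi> t (truncation t u) + \<Phi> 0 (left_shift t u)\<close>, which for example is satisfied by
  \<open>\<Phi> t u = (\<integral>s. exp (-s) * u (s + t) \<partial>halfline)\<close> with \<open>X = U = \<real>\<close> and \<open>T t = id\<close>.
  Given the functional equation, \<open>\<Phi> 0 = 0\<close> is equivalent to causality,
  \<open>\<Phi> t u = \<Phi> t (truncation t u)\<close>, and it is necessary for a representation of \<open>\<Phi> t u\<close>
  as an integral over \<open>[0,t]\<close>.\<close>

definition abstract_positive_control_system ::
    "real \<Rightarrow> (real \<Rightarrow> 'x::banach_lattice \<Rightarrow>\<^sub>L 'x) \<Rightarrow>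
     (real \<Rightarrow> (real \<Rightarrow> 'u::banach_lattice) \<Rightarrow> 'x) \<Rightarrow>
     (real \<Rightarrow> (real \<Rightarrow> 'u) \<Rightarrow> 'x) \<Rightarrow> bool" where
  "abstract_positive_control_system p T \<Phi> \<Psi> \<longleftrightarrow>
     (\<forall>\<tau>\<ge>0. positive_linear_extension p (\<Phi> \<tau>) (\<Psi> \<tau>) \<and>
        (\<forall>G. positive_linear_extension p (\<Phi> \<tau>) G \<longrightarrow> (\<forall>u\<in>Lp p. G u = \<Psi> \<tau> u)) \<and>
        (\<exists>K. \<forall>u\<in>Lp p. norm (\<Psi> \<tau> u) \<le> K * Lp_norm p u)) \<and>
     (\<forall>\<tau>\<ge>0. \<forall>t\<ge>0. \<forall>u\<in>Lp p.
        \<Psi> (\<tau> + t) u = blinfun_apply (T \<tau>) (\<Psi> t (truncation t u)) + \<Psi> \<tau> (left_shift t u))"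

definition convolution_integrand ::
    "(real \<Rightarrow> 'x::banach_lattice \<Rightarrow>\<^sub>L 'x) \<Rightarrow> ('x \<Rightarrow> 'z::banach) \<Rightarrow>
     ('u::banach_lattice \<Rightarrow>\<^sub>L 'z) \<Rightarrow> real \<Rightarrow> (real \<Rightarrow> 'u) \<Rightarrow> real \<Rightarrow> 'z" where
  "convolution_integrand T J B t u s =
     blinfun_apply (extrapolated J (T (t - s))) (blinfun_apply B (u s))"

text \<open>The embedding \<open>J\<close> makes explicit that the identity is one in \<open>X\<^bsub>-1,A\<^esub>\<close>.\<close>

definition represents ::
    "real \<Rightarrow> (real \<Rightarrow> 'x::banach_lattice \<Rightarrow>\<^sub>L 'x) \<Rightarrow> ('x \<Rightarrow> 'z::banach) \<Rightarrow>
     ('u::banach_lattice \<Rightarrow>\<^sub>L 'z) \<Rightarrow> (real \<Rightarrow> (real \<Rightarrow> 'u) \<Rightarrow> 'x) \<Rightarrow> bool" where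
  "represents p T J B \<Psi> \<longleftrightarrow>
     (\<forall>u\<in>Lp p. \<forall>t\<ge>0.
        strongly_integrable (lebesgue_on {0..t}) (convolution_integrand T J B t (pos_part u)) \<and>
        strongly_integrable (lebesgue_on {0..t}) (convolution_integrand T J B t (neg_part u)) \<and>
        J (\<Psi> t u) =
          strong_integral (lebesgue_on {0..t}) (convolution_integrand T J B t (pos_part u)) -
          strong_integral (lebesgue_on {0..t}) (convolution_integrand T J B t (neg_part u)))"

end

theory Submission
  imports Defs
begin

text \<open>An additive map from the cone of \<open>L\<^sup>p\<close> to the cone of \<open>X\<close> is monotone, hence positively
  homogeneous, and therefore extends to a linear map by \<open>\<Psi> u = \<Phi> u\<^sub>+ - \<Phi> u\<^sub>-\<close>.  The extension is bounded
  automatically: positive inputs of small norm with large images could be summed to one input whose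
  image dominates all of them (\<open>bounded_on_cone\<close>).  Positive and negative parts commute with
  truncations and shifts, so the functional equation passes to \<open>\<Psi>\<close>.

  For the representation, let \<open>x t\<close> be the response to the constant input \<open>v\<close> on \<open>[0,t)\<close>.  The
  functional equation becomes \<open>x (t + s) = T t (x s) + x t\<close>, and boundedness of \<open>\<Psi> 1\<close> makes \<open>x\<close>
  continuous.  If \<open>x t\<close> is to be the integral of \<open>T\<^sub>-\<^sub>1 s (B v)\<close> over \<open>s\<close> in \<open>[0,t]\<close>, then \<open>B v\<close> must be the
  derivative of \<open>x\<close> at 0.  This derivative exists in the extrapolation space: integrating the equation
  for \<open>x\<close> over \<open>s\<close> in \<open>[0,1]\<close> expresses \<open>x t\<close> as a differentiable function minus \<open>T t w\<close> for a fixed vector \<open>w\<close>,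
  and orbits of \<open>T\<close> are differentiable after an application of the resolvent
  (\<open>cocycle_resolvent_derivative\<close>, \<open>cocycle_derivative\<close>).  The operator \<open>B\<close> is positive as a limit of
  \<open>x h / h\<close>, and it is bounded because the integration gives an explicit formula for \<open>B v\<close>.

  The fundamental theorem of calculus then yields the representation for step functions.  It extends
  to indicators of measurable sets by a Dynkin argument, to simple functions by linearity and to all
  inputs by dominated convergence (\<open>Lp_truncation_induct\<close>, \<open>represented_limit\<close>).  The condition \<open>\<Phi> 0 = 0\<close> is
  needed to replace an input by its truncation to \<open>[0,t)\<close>.  Finally \<open>B v\<close> is recovered from the
  representation of constant inputs on short intervals (\<open>represents_unique\<close>).

  The extrapolation space is handled through the isometry \<open>Q\<close> that extends the resolvent from \<open>X\<close> to it
  and intertwines the extrapolated semigroup with \<open>T\<close>.  As \<open>X\<close>, \<open>U\<close> and the extrapolation space may be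
  nonseparable, the basic theory of the strong integral comes before all of this.\<close>

section \<open>Banach lattices\<close>

lemma norm_abs_lattice [simp]: "norm \<bar>x::'a::banach_lattice\<bar> = norm x"
  by (intro antisym norm_mono_abs) simp_all

lemma norm_mono_nonneg:
  fixes x y :: "'a::banach_lattice"
  assumes "0 \<le> x" "x \<le> y"
  shows "norm x \<le> norm y"
  using assms by (intro norm_mono_abs) (metis abs_of_nonneg order_trans)

lemma sup_zero_diff_le_abs:
  fixes x y :: "'a::banach_lattice"
  shows "sup x 0 - sup y 0 \<le> \<bar>x - y\<bar>"
proof -
  have "x \<le> sup y 0 + \<bar>x - y\<bar>"
    using add_mono[of y "sup y 0" "x - y" "\<bar>x - y\<bar>"] by (simp add: abs_ge_self)
  then have "sup x 0 \<le> sup y 0 + \<bar>x - y\<bar>"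
    by (simp add: add_increasing2)
  then show ?thesis by (simp only: diff_le_eq add.commute)
qed

text \<open>The lattice operations are Lipschitz continuous.  Hence positive parts of strongly
  measurable functions are strongly measurable, and the positive cone is closed.\<close>

lemma norm_sup_zero_diff_le:
  fixes x y :: "'a::banach_lattice"
  shows "norm (sup x 0 - sup y 0) \<le> norm (x - y)"
proof -
  have "\<bar>sup x 0 - sup y 0\<bar> \<le> \<bar>x - y\<bar>"
    using sup_zero_diff_le_abs[of x y] sup_zero_diff_le_abs[of y x]
    by (intro abs_leI) (simp_all only: abs_minus_commute minus_diff_eq)
  then show ?thesis by (rule norm_mono_abs)
qed

lemma norm_sup_zero_le: "norm (sup x 0) \<le> norm (x::'a::banach_lattice)"
  using norm_sup_zero_diff_le[of x 0] by simp

lemma continuous_on_sup_zero: "continuous_on S (\<lambda>x::'a::banach_lattice. sup x 0)"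
  unfolding continuous_on_iff dist_norm
  by (meson norm_sup_zero_diff_le le_less_trans)

lemma sup_zero_minus_sup_zero: "sup x 0 - sup (- x) 0 = (x::'a::banach_lattice)"
  using prts[of x] pprt_neg[of x] unfolding pprt_def by (metis diff_minus_eq_add)

lemma nonneg_LIMSEQ:
  fixes f :: "nat \<Rightarrow> 'a::banach_lattice"
  assumes "f \<longlonglongrightarrow> x" and "\<And>n. 0 \<le> f n"
  shows "0 \<le> x"
proof -
  have "(\<lambda>n. sup (f n) 0) \<longlonglongrightarrow> sup x 0"
    using continuous_on_sup_zero[of UNIV] assms(1)
    by (auto simp: continuous_on_sequentially o_def)
  moreover have "(\<lambda>n. sup (f n) 0) = f"
    using assms(2) by (simp add: sup_absorb1)
  ultimately have "sup x 0 = x"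
    using assms(1) LIMSEQ_unique by metis
  then show ?thesis by (metis sup.cobounded2)
qed

lemma suminf_nonneg_lattice:
  fixes f :: "nat \<Rightarrow> 'a::banach_lattice"
  assumes "summable f" "\<And>n. 0 \<le> f n"
  shows "0 \<le> suminf f"
  by (rule nonneg_LIMSEQ[OF summable_LIMSEQ[OF assms(1)]]) (simp add: sum_nonneg assms(2))

lemma suminf_ge_term:
  fixes f :: "nat \<Rightarrow> 'a::banach_lattice"
  assumes f: "summable f" and nonneg: "\<And>n. 0 \<le> f n"
  shows "f k \<le> suminf f"
proof -
  have "sum f {..<Suc k} + 0 \<le> sum f {..<Suc k} + (\<Sum>n. f (n + Suc k))"
    using nonneg by (intro add_left_mono suminf_nonneg_lattice summable_ignore_initial_segment f)
  also have "\<dots> = suminf f"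
    using suminf_split_initial_segment[OF f, of "Suc k"] by (simp add: add.commute)
  finally have "sum f {..<Suc k} \<le> suminf f" by simp
  moreover have "f k \<le> sum f {..<Suc k}"
    using nonneg by (simp add: sum_nonneg)
  ultimately show ?thesis by (rule order_trans[rotated])
qed

section \<open>Strong measurability\<close>

text \<open>Strong measurability speaks of limits almost everywhere, and real functions that arise as
  such limits are measurable only when all subsets of null sets are.  This is why completeness of
  the measure is assumed wherever the norm of a strongly measurable function has to be measurable.\<close>

lemma complete_measure_lebesgue_on:
  assumes S: "S \<in> sets lebesgue"
  shows "complete_measure (lebesgue_on S)"
proof
  fix A B assume *: "A \<subseteq> B" "B \<in> null_sets (lebesgue_on S)"
  have "B \<in> null_sets lebesgue" "B \<subseteq> S"
    using * S by (auto simp: null_sets_restrict_space)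
  with * have "A \<in> null_sets lebesgue" "A \<subseteq> S"
    using completion.complete2 by blast+
  then show "A \<in> sets (lebesgue_on S)"
    using S by (simp add: null_setsD2 sets_restrict_space_iff)
qed

primrec nearest :: "(nat \<Rightarrow> 'b::real_normed_vector) \<Rightarrow> ('a \<Rightarrow> 'b) \<Rightarrow> nat \<Rightarrow> 'a \<Rightarrow> 'b" where
  "nearest c f 0 x = c 0"
| "nearest c f (Suc m) x =
     (if norm (f x - c (Suc m)) < norm (f x - nearest c f m x) then c (Suc m) else nearest c f m x)"

lemma norm_nearest_le: "i \<le> m \<Longrightarrow> norm (f x - nearest c f m x) \<le> norm (f x - c i)"
  by (induction m) (auto simp: le_Suc_eq)

context complete_measure
begin

lemma sets_if_AE_eq:
  assumes A: "A \<in> sets M" and B: "B \<subseteq> space M" and eq: "AE x in M. x \<in> A \<longleftrightarrow> x \<in> B"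
  shows "B \<in> sets M"
proof -
  have N: "{x \<in> space M. \<not> (x \<in> A \<longleftrightarrow> x \<in> B)} \<in> null_sets M"
    using eq unfolding AE_iff_null_sets .
  have "A \<subseteq> space M" using A by (rule sets.sets_into_space)
  with B have sub: "B - A \<subseteq> {x \<in> space M. \<not> (x \<in> A \<longleftrightarrow> x \<in> B)}"
    "A - B \<subseteq> {x \<in> space M. \<not> (x \<in> A \<longleftrightarrow> x \<in> B)}" by blast+
  have "B - A \<in> sets M" "A - B \<in> sets M"
    by (intro null_setsD2 complete2[OF sub(1) N] complete2[OF sub(2) N])+
  then have "(A - (A - B)) \<union> (B - A) \<in> sets M" using A by (metis sets.Un sets.Diff)
  moreover have "(A - (A - B)) \<union> (B - A) = B" by blast
  ultimately show ?thesis by simp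
qed

lemma measurable_if_AE_eq:
  assumes f: "f \<in> measurable M N" and eq: "AE x in M. f x = g x"
    and g: "g \<in> space M \<rightarrow> space N"
  shows "g \<in> measurable M N"
proof (rule measurableI)
  fix A assume "A \<in> sets N"
  then have "f -` A \<inter> space M \<in> sets M" using f by (rule measurable_sets[rotated])
  then show "g -` A \<inter> space M \<in> sets M"
  proof (rule sets_if_AE_eq)
    show "AE x in M. x \<in> f -` A \<inter> space M \<longleftrightarrow> x \<in> g -` A \<inter> space M"
      using eq by eventually_elim simp
  qed simp
qed (use g in auto)

lemma borel_measurable_AE_LIMSEQ:
  fixes f :: "nat \<Rightarrow> 'a \<Rightarrow> real"
  assumes f: "\<And>n. f n \<in> borel_measurable M" and lim: "AE x in M. (\<lambda>n. f n x) \<longlonglongrightarrow> g x"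
  shows "g \<in> borel_measurable M"
proof (rule measurable_if_AE_eq)
  show "(\<lambda>x. lim (\<lambda>n. f n x)) \<in> borel_measurable M"
    using f by (rule borel_measurable_lim_metric)
  show "AE x in M. lim (\<lambda>n. f n x) = g x"
    using lim by eventually_elim (rule limI)
qed simp

lemma borel_measurable_compose_strongly_measurable:
  fixes f :: "'a \<Rightarrow> 'b::real_normed_vector" and h :: "'b \<Rightarrow> real"
  assumes f: "strongly_measurable M f" and h: "continuous_on UNIV h"
  shows "(\<lambda>x. h (f x)) \<in> borel_measurable M"
proof -
  obtain s where s: "\<And>n. simple_function M (s n)" "AE x in M. (\<lambda>n. s n x) \<longlonglongrightarrow> f x"
    using f unfolding strongly_measurable_def by blast
  show ?thesis
  proof (rule borel_measurable_AE_LIMSEQ)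
    show "(\<lambda>x. h (s n x)) \<in> borel_measurable M" for n
      by (rule borel_measurable_simple_function[OF simple_function_compose1[OF s(1)]])
    show "AE x in M. (\<lambda>n. h (s n x)) \<longlonglongrightarrow> h (f x)"
      using s(2) by eventually_elim (use h in \<open>auto simp: continuous_on_sequentially o_def\<close>)
  qed
qed

lemmas borel_measurable_norm_strongly_measurable =
  borel_measurable_compose_strongly_measurable[OF _ continuous_on_norm_id]

text \<open>This is the criterion of Pettis.  The functions \<open>nearest c f m\<close>, for an enumeration \<open>c\<close> of
  \<open>C\<close>, are simple because they are defined by comparing measurable distances, and they converge to
  \<open>f x\<close> as soon as \<open>f x\<close> is in the closure of \<open>C\<close>.\<close>

lemma strongly_measurable_if_separable:
  fixes f :: "'a \<Rightarrow> 'b::real_normed_vector"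
  assumes C: "countable C" and range: "AE x in M. f x \<in> closure C"
    and meas: "\<And>c. c \<in> C \<Longrightarrow> (\<lambda>x. norm (f x - c)) \<in> borel_measurable M"
  shows "strongly_measurable M f"
proof (cases "C = {}")
  case True
  have "AE x in M. (\<lambda>n::nat. 0) \<longlonglongrightarrow> f x"
    using range True by (auto elim: eventually_mono)
  then show ?thesis unfolding strongly_measurable_def
    by (intro exI[of _ "\<lambda>_ _. 0"]) simp
next
  case False
  define c where "c = from_nat_into C"
  have C_eq: "C = c ` UNIV" using C False by (simp add: c_def range_from_nat_into)
  have m: "(\<lambda>x. norm (f x - c n)) \<in> borel_measurable M" for n
    using meas C_eq by blast
  have near: "(\<lambda>x. norm (f x - nearest c f n x)) \<in> borel_measurable M
      \<and> simple_function M (nearest c f n)" for n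
  proof (induction n)
    case (Suc n)
    then have [measurable]: "(\<lambda>x. norm (f x - nearest c f n x)) \<in> borel_measurable M"
      and sf: "simple_function M (nearest c f n)" by auto
    note m[of "Suc n", measurable]
    have "(\<lambda>x. norm (f x - nearest c f (Suc n) x)) =
      (\<lambda>x. min (norm (f x - c (Suc n))) (norm (f x - nearest c f n x)))"
      by (auto simp: min_def)
    then have 1: "(\<lambda>x. norm (f x - nearest c f (Suc n) x)) \<in> borel_measurable M"
      by (simp only:) measurable
    have "simple_function M (\<lambda>x. if norm (f x - c (Suc n)) < norm (f x - nearest c f n x)
        then c (Suc n) else nearest c f n x)"
      by (intro simple_function_If simple_function_const sf) measurable
    moreover have "nearest c f (Suc n) = (\<lambda>x. if norm (f x - c (Suc n)) < norm (f x - nearest c f n x)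
        then c (Suc n) else nearest c f n x)"
      by (rule ext) simp
    ultimately have "simple_function M (nearest c f (Suc n))"
      by simp
    with 1 show ?case by blast
  next
    case 0
    have eq: "nearest c f 0 = (\<lambda>_. c 0)" by (simp add: fun_eq_iff)
    show ?case unfolding eq using m[of 0] by (intro conjI simple_function_const)
  qed
  have "AE x in M. (\<lambda>n. nearest c f n x) \<longlonglongrightarrow> f x"
    using range
  proof eventually_elim
    case (elim x)
    show ?case
    proof (rule LIMSEQ_I)
      fix r :: real assume "0 < r"
      with elim obtain k where k: "norm (f x - c k) < r"
        using C_eq by (auto simp: closure_approachable dist_norm norm_minus_commute)
      have "norm (nearest c f n x - f x) < r" if "k \<le> n" for n
        using norm_nearest_le[OF that, of f x c] k by (simp add: norm_minus_commute)
      then show "\<exists>no. \<forall>n\<ge>no. norm (nearest c f n x - f x) < r" by blast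
    qed
  qed
  then show ?thesis unfolding strongly_measurable_def using near by blast
qed

text \<open>Choosing a diagonal sequence of simple functions would need convergence in measure, and with it
  a finiteness condition on \<open>M\<close>.  The criterion of Pettis avoids this: all values of all approximating
  simple functions form one countable set.\<close>

lemma strongly_measurable_AE_LIMSEQ:
  fixes f :: "nat \<Rightarrow> 'a \<Rightarrow> 'b::real_normed_vector"
  assumes f: "\<And>n. strongly_measurable M (f n)"
    and lim: "AE x in M. (\<lambda>n. f n x) \<longlonglongrightarrow> g x"
  shows "strongly_measurable M g"
proof -
  have "\<forall>n. \<exists>s. (\<forall>k. simple_function M (s k)) \<and> (AE x in M. (\<lambda>k. s k x) \<longlonglongrightarrow> f n x)"
    using f unfolding strongly_measurable_def by blast
  from choice[OF this] obtain s where s: "\<And>n k. simple_function M (s n k)"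
    "\<And>n. AE x in M. (\<lambda>k. s n k x) \<longlonglongrightarrow> f n x" by blast
  define C where "C = (\<Union>n k. s n k ` space M)"
  show ?thesis
  proof (rule strongly_measurable_if_separable)
    show "countable C" unfolding C_def
      using s(1) by (intro countable_UN) (auto simp: simple_function_def countable_finite)
    have "AE x in M. \<forall>n. (\<lambda>k. s n k x) \<longlonglongrightarrow> f n x"
      using s(2) by (simp add: AE_all_countable)
    then show "AE x in M. g x \<in> closure C"
      using lim AE_space
    proof eventually_elim
      case (elim x)
      have "f n x \<in> closure C" for n
      proof (rule closed_sequentially[OF closed_closure])
        show "s n k x \<in> closure C" for k
          using elim closure_subset[of C] unfolding C_def by blast
        show "(\<lambda>k. s n k x) \<longlonglongrightarrow> f n x" using elim by blast
      qed
      moreover have "(\<lambda>n. f n x) \<longlonglongrightarrow> g x" using elim by blast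
      ultimately show ?case
        by (rule closed_sequentially[OF closed_closure])
    qed
    fix c
    show "(\<lambda>x. norm (g x - c)) \<in> borel_measurable M"
    proof (rule borel_measurable_AE_LIMSEQ)
      show "(\<lambda>x. norm (f n x - c)) \<in> borel_measurable M" for n
        by (intro borel_measurable_compose_strongly_measurable[OF f] continuous_intros)
      show "AE x in M. (\<lambda>n. norm (f n x - c)) \<longlonglongrightarrow> norm (g x - c)"
        using lim by eventually_elim (intro tendsto_intros)
    qed
  qed
qed

end

lemma strongly_measurable_simple: "simple_function M f \<Longrightarrow> strongly_measurable M f"
  unfolding strongly_measurable_def by (intro exI[of _ "\<lambda>_. f"]) simp

lemma strongly_measurable_cong_AE:
  assumes "strongly_measurable M f" "AE x in M. f x = g x"
  shows "strongly_measurable M g"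
proof -
  obtain s where s: "\<And>n. simple_function M (s n)" "AE x in M. (\<lambda>n. s n x) \<longlonglongrightarrow> f x"
    using assms(1) unfolding strongly_measurable_def by blast
  have "AE x in M. (\<lambda>n. s n x) \<longlonglongrightarrow> g x"
    using s(2) assms(2) by eventually_elim simp
  with s(1) show ?thesis unfolding strongly_measurable_def by blast
qed

lemma strongly_measurable_compose2:
  assumes "strongly_measurable M f" "strongly_measurable M g"
    and h: "\<And>a b X Y. X \<longlonglongrightarrow> a \<Longrightarrow> Y \<longlonglongrightarrow> b \<Longrightarrow> (\<lambda>n::nat. h (X n) (Y n)) \<longlonglongrightarrow> h a b"
  shows "strongly_measurable M (\<lambda>x. h (f x) (g x))"
proof -
  obtain s where s: "\<And>n. simple_function M (s n)" "AE x in M. (\<lambda>n. s n x) \<longlonglongrightarrow> f x"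
    using assms(1) unfolding strongly_measurable_def by blast
  obtain t where t: "\<And>n. simple_function M (t n)" "AE x in M. (\<lambda>n. t n x) \<longlonglongrightarrow> g x"
    using assms(2) unfolding strongly_measurable_def by blast
  have "AE x in M. (\<lambda>n. h (s n x) (t n x)) \<longlonglongrightarrow> h (f x) (g x)"
    using s(2) t(2) by eventually_elim (rule h)
  moreover have "simple_function M (\<lambda>x. h (s n x) (t n x))" for n
    using s(1) t(1) by (rule simple_function_compose2)
  ultimately show ?thesis unfolding strongly_measurable_def
    by (intro exI[of _ "\<lambda>n x. h (s n x) (t n x)"]) blast
qed

lemma strongly_measurable_compose:
  assumes "strongly_measurable M f" and "continuous_on UNIV h"
  shows "strongly_measurable M (\<lambda>x. h (f x))"
  using strongly_measurable_compose2[of M f f "\<lambda>a b. h a"] assms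
  by (auto simp: continuous_on_sequentially o_def)

lemma strongly_measurable_add:
  "strongly_measurable M f \<Longrightarrow> strongly_measurable M g \<Longrightarrow> strongly_measurable M (\<lambda>x. f x + g x)"
  by (rule strongly_measurable_compose2) (auto intro: tendsto_intros)

lemma strongly_measurable_diff:
  "strongly_measurable M f \<Longrightarrow> strongly_measurable M g \<Longrightarrow> strongly_measurable M (\<lambda>x. f x - g x)"
  by (rule strongly_measurable_compose2) (auto intro: tendsto_intros)

lemma strongly_measurable_sum:
  "finite I \<Longrightarrow> (\<And>i. i \<in> I \<Longrightarrow> strongly_measurable M (f i)) \<Longrightarrow>
    strongly_measurable M (\<lambda>x. \<Sum>i\<in>I. f i x)"
  by (induction I rule: finite_induct)
    (auto intro: strongly_measurable_add strongly_measurable_simple)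

lemma strongly_measurable_indicator_scaleR:
  assumes "strongly_measurable M f" "A \<in> sets M"
  shows "strongly_measurable M (\<lambda>x. indicator A x *\<^sub>R f x)"
  by (rule strongly_measurable_compose2[OF strongly_measurable_simple assms(1), of "indicator A :: _ \<Rightarrow> real"])
     (use assms(2) in \<open>auto intro: tendsto_intros\<close>)

section \<open>The strong integral\<close>

abbreviation "simply_integrable \<equiv> Bochner_Integration.simple_bochner_integrable"
abbreviation "simple_strong_integral \<equiv> Bochner_Integration.simple_bochner_integral"

lemma simply_integrable_simple_function: "simply_integrable M s \<Longrightarrow> simple_function M s"
  by (simp add: simple_bochner_integrable.simps)

context complete_measure
begin

text \<open>Replacing an approximation by 0 wherever its norm exceeds \<open>2 * norm (f x)\<close> keeps the
  convergence, because this eventually stops happening at every point with \<open>f x \<noteq> 0\<close>.\<close>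

lemma strongly_measurable_obtains_dominated:
  fixes f :: "'a \<Rightarrow> 'b::real_normed_vector"
  assumes "strongly_measurable M f"
  obtains s where "\<And>n::nat. simple_function M (s n)" "AE x in M. (\<lambda>n. s n x) \<longlonglongrightarrow> f x"
    "\<And>n x. norm (s n x) \<le> 2 * norm (f x)"
proof -
  obtain t where t: "\<And>n::nat. simple_function M (t n)" "AE x in M. (\<lambda>n. t n x) \<longlonglongrightarrow> f x"
    using assms unfolding strongly_measurable_def by blast
  define s where "s n x = (if norm (t n x) \<le> 2 * norm (f x) then t n x else 0)" for n x
  have [measurable]: "(\<lambda>x. norm (f x)) \<in> borel_measurable M"
    by (rule borel_measurable_norm_strongly_measurable) fact
  have [measurable]: "(\<lambda>x. norm (t n x)) \<in> borel_measurable M" for n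
    by (rule borel_measurable_simple_function[OF simple_function_compose1[OF t(1)]])
  have "simple_function M (s n)" for n
    unfolding s_def by (intro simple_function_If simple_function_const t(1)) measurable
  moreover have "norm (s n x) \<le> 2 * norm (f x)" for n x by (simp add: s_def)
  moreover have "AE x in M. (\<lambda>n. s n x) \<longlonglongrightarrow> f x"
    using t(2)
  proof eventually_elim
    case (elim x)
    show ?case
    proof (cases "f x = 0")
      case True
      then have "s n x = 0" for n by (simp add: s_def)
      with True show ?thesis by simp
    next
      case False
      have "\<forall>\<^sub>F n in sequentially. norm (t n x) < 2 * norm (f x)"
        using tendsto_norm[OF elim] False by (intro order_tendstoD) auto
      then have "\<forall>\<^sub>F n in sequentially. t n x = s n x"
        by eventually_elim (simp add: s_def)
      with elim show ?thesis by (rule Lim_transform_eventually)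
    qed
  qed
  ultimately show ?thesis using that by blast
qed

lemma borel_measurable_norm_diff_simple:
  assumes "strongly_measurable M f" "simply_integrable M s"
  shows "(\<lambda>x. ennreal (norm (f x - s x))) \<in> borel_measurable M"
  by (intro measurable_compose[OF _ measurable_ennreal] borel_measurable_norm_strongly_measurable
      strongly_measurable_diff assms strongly_measurable_simple simply_integrable_simple_function)

lemma norm_simple_strong_integral_le:
  assumes "simply_integrable M s"
  shows "ennreal (norm (simple_strong_integral M s)) \<le> (\<integral>\<^sup>+x. norm (s x) \<partial>M)"
proof -
  have "ennreal (norm (simple_strong_integral M s)) \<le> ennreal (simple_strong_integral M (\<lambda>x. norm (s x)))"
    using assms by (intro ennreal_leI simple_bochner_integral_norm_bound)
  also have "\<dots> = (\<integral>\<^sup>+x. norm (s x) \<partial>M)"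
    using simple_bochner_integrable_compose2[of "\<lambda>x y. norm x" M s s] assms
    by (intro simple_bochner_integral_eq_nn_integral) auto
  finally show ?thesis .
qed

text \<open>Uniqueness of the integral, the dominated convergence theorem and the differentiation of
  integrals all follow from this estimate, applied to differences.\<close>

lemma has_strong_integral_norm_le:
  fixes f :: "'a \<Rightarrow> 'b::real_normed_vector"
  assumes "has_strong_integral M f I"
  shows "ennreal (norm I) \<le> (\<integral>\<^sup>+x. norm (f x) \<partial>M)"
proof -
  obtain s where f: "strongly_measurable M f" and s: "\<And>n. simply_integrable M (s n)"
    and lim: "(\<lambda>n. \<integral>\<^sup>+x. ennreal (norm (f x - s n x)) \<partial>M) \<longlonglongrightarrow> 0"
    and I: "(\<lambda>n. simple_strong_integral M (s n)) \<longlonglongrightarrow> I"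
    using assms unfolding has_strong_integral_def by blast
  have [measurable]: "(\<lambda>x. ennreal (norm (f x))) \<in> borel_measurable M"
    by (intro measurable_compose[OF _ measurable_ennreal] borel_measurable_norm_strongly_measurable f)
  have le: "ennreal (norm (simple_strong_integral M (s n))) \<le> (\<integral>\<^sup>+x. norm (f x) \<partial>M) + (\<integral>\<^sup>+x. norm (f x - s n x) \<partial>M)" for n
  proof -
    note borel_measurable_norm_diff_simple[OF f s[of n], measurable]
    have "ennreal (norm (s n x)) \<le> ennreal (norm (f x)) + ennreal (norm (f x - s n x))" for x
      using norm_triangle_ineq4[of "f x" "f x - s n x"] by (simp flip: ennreal_plus)
    then have "(\<integral>\<^sup>+x. norm (s n x) \<partial>M) \<le> (\<integral>\<^sup>+x. ennreal (norm (f x)) + norm (f x - s n x) \<partial>M)"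
      by (intro nn_integral_mono) simp
    also have "\<dots> = (\<integral>\<^sup>+x. norm (f x) \<partial>M) + (\<integral>\<^sup>+x. norm (f x - s n x) \<partial>M)"
      by (intro nn_integral_add) measurable
    finally show ?thesis using norm_simple_strong_integral_le[OF s[of n]] order_trans by blast
  qed
  have "(\<lambda>n. ennreal (norm (simple_strong_integral M (s n)))) \<longlonglongrightarrow> ennreal (norm I)"
    by (intro tendsto_ennrealI tendsto_norm I)
  moreover have "(\<lambda>n. (\<integral>\<^sup>+x. norm (f x) \<partial>M) + (\<integral>\<^sup>+x. norm (f x - s n x) \<partial>M)) \<longlonglongrightarrow> (\<integral>\<^sup>+x. norm (f x) \<partial>M) + 0"
    by (intro tendsto_add tendsto_const lim)
  ultimately show ?thesis
    using LIMSEQ_le[of _ "ennreal (norm I)"] le by (metis (no_types, lifting) add.right_neutral)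
qed

lemma has_strong_integral_add:
  fixes f g :: "'a \<Rightarrow> 'b::real_normed_vector"
  assumes "has_strong_integral M f I" "has_strong_integral M g K"
  shows "has_strong_integral M (\<lambda>x. f x + g x) (I + K)"
proof -
  obtain s where f: "strongly_measurable M f" and s: "\<And>n. simply_integrable M (s n)"
    and s_lim: "(\<lambda>n. \<integral>\<^sup>+x. ennreal (norm (f x - s n x)) \<partial>M) \<longlonglongrightarrow> 0"
    and I: "(\<lambda>n. simple_strong_integral M (s n)) \<longlonglongrightarrow> I"
    using assms(1) unfolding has_strong_integral_def by blast
  obtain t where g: "strongly_measurable M g" and t: "\<And>n. simply_integrable M (t n)"
    and t_lim: "(\<lambda>n. \<integral>\<^sup>+x. ennreal (norm (g x - t n x)) \<partial>M) \<longlonglongrightarrow> 0"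
    and K: "(\<lambda>n. simple_strong_integral M (t n)) \<longlonglongrightarrow> K"
    using assms(2) unfolding has_strong_integral_def by blast
  have le: "(\<integral>\<^sup>+x. norm (f x + g x - (s n x + t n x)) \<partial>M) \<le>
      (\<integral>\<^sup>+x. norm (f x - s n x) \<partial>M) + (\<integral>\<^sup>+x. norm (g x - t n x) \<partial>M)" for n
  proof -
    note borel_measurable_norm_diff_simple[OF f s[of n], measurable]
      borel_measurable_norm_diff_simple[OF g t[of n], measurable]
    have "(\<integral>\<^sup>+x. norm (f x + g x - (s n x + t n x)) \<partial>M) \<le>
        (\<integral>\<^sup>+x. ennreal (norm (f x - s n x)) + norm (g x - t n x) \<partial>M)"
      by (auto intro!: nn_integral_mono norm_diff_triangle_ineq simp flip: ennreal_plus)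
    also have "\<dots> = (\<integral>\<^sup>+x. norm (f x - s n x) \<partial>M) + (\<integral>\<^sup>+x. norm (g x - t n x) \<partial>M)"
      by (intro nn_integral_add) measurable
    finally show ?thesis .
  qed
  have "(\<lambda>n. \<integral>\<^sup>+x. norm (f x + g x - (s n x + t n x)) \<partial>M) \<longlonglongrightarrow> 0"
  proof (rule tendsto_sandwich[OF _ _ tendsto_const])
    show "(\<lambda>n. (\<integral>\<^sup>+x. norm (f x - s n x) \<partial>M) + (\<integral>\<^sup>+x. norm (g x - t n x) \<partial>M)) \<longlonglongrightarrow> 0"
      using tendsto_add[OF s_lim t_lim] by simp
    show "\<forall>\<^sub>F n in sequentially. (\<integral>\<^sup>+x. norm (f x + g x - (s n x + t n x)) \<partial>M) \<le>
      (\<integral>\<^sup>+x. norm (f x - s n x) \<partial>M) + (\<integral>\<^sup>+x. norm (g x - t n x) \<partial>M)"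
      using le by (intro always_eventually allI)
  qed simp
  moreover have "simply_integrable M (\<lambda>x. s n x + t n x)" for n
    using s t by (simp add: simple_bochner_integrable_compose2)
  moreover have "(\<lambda>n. simple_strong_integral M (\<lambda>x. s n x + t n x)) \<longlonglongrightarrow> I + K"
    using tendsto_add[OF I K] by (simp add: simple_bochner_integral_add s t)
  ultimately show ?thesis
    unfolding has_strong_integral_def
    by (intro conjI strongly_measurable_add f g exI[of _ "\<lambda>n x. s n x + t n x"]) auto
qed

lemma has_strong_integral_minus:
  fixes f :: "'a \<Rightarrow> 'b::real_normed_vector"
  assumes "has_strong_integral M f I"
  shows "has_strong_integral M (\<lambda>x. - f x) (- I)"
proof -
  obtain s where f: "strongly_measurable M f" and s: "\<And>n. simply_integrable M (s n)"
    and s_lim: "(\<lambda>n. \<integral>\<^sup>+x. ennreal (norm (f x - s n x)) \<partial>M) \<longlonglongrightarrow> 0"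
    and I: "(\<lambda>n. simple_strong_integral M (s n)) \<longlonglongrightarrow> I"
    using assms(1) unfolding has_strong_integral_def by blast
  have "simply_integrable M (\<lambda>x. - s n x)" for n
    using simple_bochner_integrable_compose2[of "\<lambda>x y. - x" M "s n" "s n"] s by simp
  moreover have "(\<lambda>n. simple_strong_integral M (\<lambda>x. - s n x)) \<longlonglongrightarrow> - I"
    using tendsto_minus[OF I] by (simp add: simple_bochner_integral_minus s)
  moreover have "norm (- f x - - s n x) = norm (f x - s n x)" for n x
    by (simp add: norm_minus_commute)
  moreover have "strongly_measurable M (\<lambda>x. - f x)"
    by (rule strongly_measurable_compose[OF f]) (intro continuous_intros)
  ultimately show ?thesis
    unfolding has_strong_integral_def using s_lim
    by (intro conjI exI[of _ "\<lambda>n x. - s n x"]) auto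
qed

lemma has_strong_integral_diff:
  fixes f g :: "'a \<Rightarrow> 'b::real_normed_vector"
  assumes "has_strong_integral M f I" "has_strong_integral M g K"
  shows "has_strong_integral M (\<lambda>x. f x - g x) (I - K)"
  using has_strong_integral_add[OF assms(1) has_strong_integral_minus[OF assms(2)]] by simp

lemma has_strong_integral_unique:
  fixes f :: "'a \<Rightarrow> 'b::real_normed_vector"
  assumes "has_strong_integral M f I" "has_strong_integral M f K"
  shows "I = K"
  using has_strong_integral_norm_le[OF has_strong_integral_diff[OF assms]] by simp

lemma strong_integral_eq:
  "has_strong_integral M f I \<Longrightarrow> strong_integral M f = (I::'b::real_normed_vector)"
  unfolding strong_integral_def using has_strong_integral_unique by blast

lemma has_strong_integral_cong_AE:
  fixes f g :: "'a \<Rightarrow> 'b::real_normed_vector"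
  assumes "has_strong_integral M f I" "AE x in M. f x = g x"
  shows "has_strong_integral M g I"
proof -
  have "(\<integral>\<^sup>+x. ennreal (norm (g x - s x)) \<partial>M) = (\<integral>\<^sup>+x. ennreal (norm (f x - s x)) \<partial>M)" for s
    by (rule nn_integral_cong_AE) (use assms(2) in \<open>auto elim: eventually_mono\<close>)
  then show ?thesis
    using assms(1) strongly_measurable_cong_AE[OF _ assms(2)]
    unfolding has_strong_integral_def by simp
qed

lemma has_strong_integral_simple:
  "simply_integrable M (s :: 'a \<Rightarrow> 'b::real_normed_vector) \<Longrightarrow> has_strong_integral M s (simple_strong_integral M s)"
  unfolding has_strong_integral_def
  by (intro conjI strongly_measurable_simple simply_integrable_simple_function exI[of _ "\<lambda>_. s"]) auto

lemma has_strong_integral_indicator: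
  fixes c :: "'b::real_normed_vector"
  assumes A: "A \<in> sets M" "emeasure M A < \<infinity>"
  shows "has_strong_integral M (\<lambda>x. indicator A x *\<^sub>R c) (measure M A *\<^sub>R c)"
proof -
  have AM: "A \<subseteq> space M" using A(1) by (rule sets.sets_into_space)
  have able: "simply_integrable M (indicator A :: 'a \<Rightarrow> real)"
  proof (rule simple_bochner_integrable.intros)
    have "{y \<in> space M. (indicator A y::real) \<noteq> 0} = A"
      using AM by (auto split: split_indicator)
    then show "emeasure M {y \<in> space M. (indicator A y::real) \<noteq> 0} \<noteq> \<infinity>"
      using A(2) by simp
  qed (use A(1) in simp)
  have "ennreal (simple_strong_integral M (indicator A)) = emeasure M A"
    using simple_bochner_integral_eq_nn_integral[OF able] A(1) by (simp add: ennreal_indicator)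
  then have sb: "simple_strong_integral M (indicator A) = measure M A"
    by (metis enn2real_ennreal measure_def simple_bochner_integral_nonneg indicator_pos_le)
  have "linear (\<lambda>r::real. r *\<^sub>R c)" by (simp add: linear_iff scaleR_left_distrib)
  from simple_bochner_integral_linear[OF this able] sb
  have "simple_strong_integral M (\<lambda>x. indicator A x *\<^sub>R c) = measure M A *\<^sub>R c" by simp
  moreover have "simply_integrable M (\<lambda>x. indicator A x *\<^sub>R c)"
    using simple_bochner_integrable_compose2[of "\<lambda>x y. x *\<^sub>R c" M _ "indicator A :: 'a \<Rightarrow> real", OF _ able able]
    by simp
  ultimately show ?thesis using has_strong_integral_simple by metis
qed

lemma has_strong_integral_exists:
  fixes f :: "'a \<Rightarrow> 'b::banach"
  assumes f: "strongly_measurable M f" and fin: "(\<integral>\<^sup>+x. norm (f x) \<partial>M) < \<infinity>"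
  shows "\<exists>I. has_strong_integral M f I"
proof -
  obtain s where s: "\<And>n. simple_function M (s n)" "AE x in M. (\<lambda>n. s n x) \<longlonglongrightarrow> f x"
    "\<And>n x. norm (s n x) \<le> 2 * norm (f x)"
    using strongly_measurable_obtains_dominated[OF f] by blast
  have [measurable]: "(\<lambda>x. norm (f x)) \<in> borel_measurable M"
    by (rule borel_measurable_norm_strongly_measurable[OF f])
  have fin3: "(\<integral>\<^sup>+x. ennreal (c * norm (f x)) \<partial>M) < \<infinity>" if "0 \<le> c" for c
    using fin that by (simp add: ennreal_mult nn_integral_cmult ennreal_mult_less_top)
  have able: "simply_integrable M (s n)" for n
  proof (rule simple_bochner_integrableI_bounded[OF s(1)])
    have "(\<integral>\<^sup>+x. norm (s n x) \<partial>M) \<le> (\<integral>\<^sup>+x. ennreal (2 * norm (f x)) \<partial>M)"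
      by (intro nn_integral_mono ennreal_leI s(3))
    then show "(\<integral>\<^sup>+x. norm (s n x) \<partial>M) < \<infinity>"
      using fin3[of 2] by (simp add: le_less_trans)
  qed
  note meas = borel_measurable_norm_diff_simple[OF f able]
  have lim: "(\<lambda>n. \<integral>\<^sup>+x. ennreal (norm (f x - s n x)) \<partial>M) \<longlonglongrightarrow> (\<integral>\<^sup>+x. 0 \<partial>M)"
  proof (rule nn_integral_dominated_convergence[OF meas])
    show "(\<lambda>x. ennreal (3 * norm (f x))) \<in> borel_measurable M" by measurable
    have "norm (f x - s n x) \<le> 3 * norm (f x)" for n x
      using norm_triangle_ineq4[of "f x" "s n x"] s(3)[of n x] by simp
    then show "AE x in M. ennreal (norm (f x - s j x)) \<le> ennreal (3 * norm (f x))" for j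
      by (intro AE_I2 ennreal_leI)
    show "AE x in M. (\<lambda>n. ennreal (norm (f x - s n x))) \<longlonglongrightarrow> 0"
      using s(2)
    proof eventually_elim
      case (elim x)
      then have "(\<lambda>n. norm (f x - s n x)) \<longlonglongrightarrow> 0"
        using tendsto_diff[OF tendsto_const elim, of "f x"] by (intro tendsto_norm_zero) simp
      from tendsto_ennrealI[OF this] show ?case by simp
    qed
  qed (use fin3[of 3] in auto)
  have bound: "ennreal (norm (simple_strong_integral M (s m) - simple_strong_integral M (s n))) \<le>
     (\<integral>\<^sup>+x. norm (f x - s m x) \<partial>M) + (\<integral>\<^sup>+x. norm (f x - s n x) \<partial>M)" for m n
  proof -
    have able': "simply_integrable M (\<lambda>x. s m x - s n x)"
      by (rule simple_bochner_integrable_compose2[of "(-)"]) (use able in auto)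
    have "ennreal (norm (simple_strong_integral M (s m) - simple_strong_integral M (s n))) \<le> (\<integral>\<^sup>+x. norm (s m x - s n x) \<partial>M)"
      using norm_simple_strong_integral_le[OF able'] by (simp add: simple_bochner_integral_diff able)
    also have "\<dots> \<le> (\<integral>\<^sup>+x. ennreal (norm (f x - s m x)) + norm (f x - s n x) \<partial>M)"
    proof (intro nn_integral_mono)
      fix x
      have "norm (s m x - s n x) \<le> norm (f x - s m x) + norm (f x - s n x)"
        by (metis dual_order.refl norm_diff_triangle_le norm_minus_commute)
      then show "ennreal (norm (s m x - s n x)) \<le> ennreal (norm (f x - s m x)) + norm (f x - s n x)"
        by (simp flip: ennreal_plus)
    qed
    also have "\<dots> = (\<integral>\<^sup>+x. norm (f x - s m x) \<partial>M) + (\<integral>\<^sup>+x. norm (f x - s n x) \<partial>M)"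
      by (intro nn_integral_add meas)
    finally show ?thesis .
  qed
  have "Cauchy (\<lambda>n. simple_strong_integral M (s n))"
  proof (rule CauchyI)
    fix e :: real assume "0 < e"
    then have "0 < ennreal (e / 2)" by simp
    moreover have "(\<lambda>n. \<integral>\<^sup>+x. ennreal (norm (f x - s n x)) \<partial>M) \<longlonglongrightarrow> 0"
      using lim by simp
    ultimately have "\<forall>\<^sub>F n in sequentially. (\<integral>\<^sup>+x. ennreal (norm (f x - s n x)) \<partial>M) < ennreal (e / 2)"
      by (rule order_tendstoD(2)[rotated])
    then obtain N where N: "\<And>n. n \<ge> N \<Longrightarrow> (\<integral>\<^sup>+x. ennreal (norm (f x - s n x)) \<partial>M) < ennreal (e / 2)"
      by (auto simp: eventually_sequentially)
    have "norm (simple_strong_integral M (s m) - simple_strong_integral M (s n)) < e" if "m \<ge> N" "n \<ge> N" for m n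
    proof -
      have "ennreal (norm (simple_strong_integral M (s m) - simple_strong_integral M (s n))) < ennreal (e/2) + ennreal (e/2)"
        using bound[of m n] add_strict_mono[OF N[OF that(1)] N[OF that(2)]] by (rule le_less_trans)
      also have "\<dots> = ennreal e" using \<open>0 < e\<close> by (simp flip: ennreal_plus)
      finally show ?thesis using \<open>0 < e\<close> by (simp add: ennreal_less_iff)
    qed
    then show "\<exists>N. \<forall>m\<ge>N. \<forall>n\<ge>N. norm (simple_strong_integral M (s m) - simple_strong_integral M (s n)) < e" by blast
  qed
  then obtain I where "(\<lambda>n. simple_strong_integral M (s n)) \<longlonglongrightarrow> I"
    using Cauchy_convergent convergent_def by blast
  with f able lim show ?thesis unfolding has_strong_integral_def by auto
qed

lemma has_strong_integral_dominated_convergence: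
  fixes f :: "nat \<Rightarrow> 'a \<Rightarrow> 'b::banach"
  assumes f: "\<And>n. has_strong_integral M (f n) (I n)"
    and lim: "AE x in M. (\<lambda>n. f n x) \<longlonglongrightarrow> h x"
    and g: "g \<in> borel_measurable M" "(\<integral>\<^sup>+x. ennreal (g x) \<partial>M) < \<infinity>"
    and bound: "\<And>n. AE x in M. norm (f n x) \<le> g x"
  shows "\<exists>K. has_strong_integral M h K \<and> I \<longlonglongrightarrow> K"
proof -
  have fm: "strongly_measurable M (f n)" for n
    using f[of n] by (simp add: has_strong_integral_def)
  have hm: "strongly_measurable M h"
    by (rule strongly_measurable_AE_LIMSEQ[OF fm lim])
  have hb: "AE x in M. norm (h x) \<le> g x"
  proof -
    have "AE x in M. \<forall>n. norm (f n x) \<le> g x" using bound by (simp add: AE_all_countable)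
    with lim show ?thesis
      by eventually_elim (auto intro: LIMSEQ_le_const2[OF tendsto_norm])
  qed
  have "(\<integral>\<^sup>+x. norm (h x) \<partial>M) \<le> (\<integral>\<^sup>+x. ennreal (g x) \<partial>M)"
    by (rule nn_integral_mono_AE) (use hb in \<open>auto elim: eventually_mono intro: ennreal_leI\<close>)
  from le_less_trans[OF this g(2)] have "(\<integral>\<^sup>+x. norm (h x) \<partial>M) < \<infinity>" .
  then obtain K where K: "has_strong_integral M h K"
    using has_strong_integral_exists[OF hm] by blast
  have "(\<lambda>n. \<integral>\<^sup>+x. ennreal (norm (f n x - h x)) \<partial>M) \<longlonglongrightarrow> (\<integral>\<^sup>+x. 0 \<partial>M)"
  proof (rule nn_integral_dominated_convergence)
    show "(\<lambda>x. ennreal (norm (f n x - h x))) \<in> borel_measurable M" for n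
      by (intro measurable_compose[OF _ measurable_ennreal] borel_measurable_norm_strongly_measurable
          strongly_measurable_diff fm hm)
    show "(\<lambda>x. 2 * ennreal (g x)) \<in> borel_measurable M" using g(1) by measurable
    show "AE x in M. ennreal (norm (f j x - h x)) \<le> 2 * ennreal (g x)" for j
      using bound[of j] hb
    proof eventually_elim
      case (elim x)
      have "0 \<le> g x" using elim(1) norm_ge_zero[of "f j x"] by linarith
      moreover have "norm (f j x - h x) \<le> 2 * g x"
        using norm_triangle_ineq4[of "f j x" "h x"] elim by linarith
      ultimately show ?case
        using ennreal_leI[of "norm (f j x - h x)" "2 * g x"] by (simp add: ennreal_mult)
    qed
    show "(\<integral>\<^sup>+x. 2 * ennreal (g x) \<partial>M) < \<infinity>"
      using g by (simp add: nn_integral_cmult ennreal_mult_less_top)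
    show "AE x in M. (\<lambda>n. ennreal (norm (f n x - h x))) \<longlonglongrightarrow> 0"
      using lim
    proof eventually_elim
      case (elim x)
      then have "(\<lambda>n. norm (f n x - h x)) \<longlonglongrightarrow> 0"
        by (intro tendsto_norm_zero) (simp add: LIM_zero)
      from tendsto_ennrealI[OF this] show ?case by simp
    qed
  qed simp
  then have lim0: "(\<lambda>n. \<integral>\<^sup>+x. ennreal (norm (f n x - h x)) \<partial>M) \<longlonglongrightarrow> 0" by simp
  have "(\<lambda>n. ennreal (norm (I n - K))) \<longlonglongrightarrow> 0"
  proof (rule tendsto_sandwich[OF _ _ tendsto_const lim0])
    show "\<forall>\<^sub>F n in sequentially. ennreal (norm (I n - K)) \<le> (\<integral>\<^sup>+x. ennreal (norm (f n x - h x)) \<partial>M)"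
      by (intro always_eventually allI has_strong_integral_norm_le has_strong_integral_diff f K)
  qed simp
  then have "(\<lambda>n. norm (I n - K)) \<longlonglongrightarrow> 0"
    by (simp add: tendsto_ennreal_iff flip: ennreal_0)
  then have "I \<longlonglongrightarrow> K" by (simp add: LIM_zero_iff tendsto_norm_zero_iff)
  with K show ?thesis by blast
qed

end


section \<open>The fundamental theorem of calculus for the strong integral\<close>

lemma strongly_measurable_continuous_on:
  fixes f :: "real \<Rightarrow> 'b::real_normed_vector"
  assumes S: "S \<in> sets lebesgue" and f: "continuous_on S f"
  shows "strongly_measurable (lebesgue_on S) f"
proof -
  interpret complete_measure "lebesgue_on S" using S by (rule complete_measure_lebesgue_on)
  obtain D where D: "countable D" "D \<subseteq> S" "S \<subseteq> closure D" by (rule separable)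
  show ?thesis
  proof (rule strongly_measurable_if_separable)
    show "countable (f ` D)" using D(1) by simp
    have "f x \<in> closure (f ` D)" if x: "x \<in> S" for x
    proof -
      obtain X where X: "\<And>n. X n \<in> D" "X \<longlonglongrightarrow> x"
        using D(3) x by (meson closure_sequential subsetD)
      have "(\<lambda>n. f (X n)) \<longlonglongrightarrow> f x"
        using f X D(2) x unfolding continuous_on_sequentially by (auto simp: o_def)
      with X(1) show ?thesis unfolding closure_sequential
        by (intro exI[of _ "\<lambda>n. f (X n)"]) blast
    qed
    then show "AE x in lebesgue_on S. f x \<in> closure (f ` D)"
      by (intro AE_I2) simp
    fix c
    show "(\<lambda>x. norm (f x - c)) \<in> borel_measurable (lebesgue_on S)"
      by (intro continuous_imp_measurable_on_sets_lebesgue continuous_intros f S)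
  qed
qed

text \<open>As functions of \<open>x\<close>, both sides have the derivative \<open>f\<close> and vanish at \<open>a\<close>.  The indicator of
  a subinterval in the integrand, instead of a smaller domain, keeps all integrals on one measure
  space, where they can be subtracted.\<close>

lemma has_strong_integral_derivative:
  fixes f :: "real \<Rightarrow> 'b::banach"
  assumes f: "continuous_on {a..b} f"
    and g: "\<And>x. x \<in> {a..b} \<Longrightarrow> (g has_vector_derivative f x) (at x within {a..b})"
    and x: "x \<in> {a..b}"
  shows "has_strong_integral (lebesgue_on {a..b}) (\<lambda>s. indicator {a..<x} s *\<^sub>R f s) (g x - g a)"
proof -
  let ?M = "lebesgue_on {a..b}"
  interpret complete_measure ?M by (rule complete_measure_lebesgue_on) simp
  have sets: "{u..<v} \<in> sets ?M" if "a \<le> u" "v \<le> b" for u v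
    using that by (auto simp: sets_restrict_space_iff)
  have emeasure: "emeasure ?M {u..<v} = ennreal (v - u)" if "a \<le> u" "u \<le> v" "v \<le> b" for u v
    using that by (subst emeasure_restrict_space) auto
  have measure: "measure ?M {u..<v} = v - u" if "a \<le> u" "u \<le> v" "v \<le> b" for u v
    using emeasure[OF that] that by (simp add: measure_def)
  have fm: "strongly_measurable ?M f"
    by (rule strongly_measurable_continuous_on) (use f in auto)
  have "bounded (f ` {a..b})"
    using f by (intro compact_imp_bounded compact_continuous_image) auto
  then obtain c where c: "0 < c" "\<And>s. s \<in> {a..b} \<Longrightarrow> norm (f s) \<le> c"
    by (auto simp: bounded_pos)
  have "\<exists>I. has_strong_integral ?M (\<lambda>s. indicator {a..<y} s *\<^sub>R f s) I" if "y \<in> {a..b}" for y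
  proof (rule has_strong_integral_exists)
    show "strongly_measurable ?M (\<lambda>s. indicator {a..<y} s *\<^sub>R f s)"
      by (intro strongly_measurable_indicator_scaleR fm sets) (use that in auto)
    have "(\<integral>\<^sup>+s. norm (indicator {a..<y} s *\<^sub>R f s) \<partial>?M) \<le> (\<integral>\<^sup>+s. ennreal c * indicator {a..<y} s \<partial>?M)"
      using c by (intro nn_integral_mono) (auto split: split_indicator)
    also have "\<dots> = ennreal c * ennreal (y - a)"
      using that sets emeasure by (subst nn_integral_cmult_indicator) auto
    also have "\<dots> < \<infinity>" by (simp add: ennreal_mult_less_top)
    finally show "(\<integral>\<^sup>+s. norm (indicator {a..<y} s *\<^sub>R f s) \<partial>?M) < \<infinity>" .
  qed
  then obtain F where F: "\<And>y. y \<in> {a..b} \<Longrightarrow>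
      has_strong_integral ?M (\<lambda>s. indicator {a..<y} s *\<^sub>R f s) (F y)" by metis
  \<comment> \<open>If \<open>f\<close> is within \<open>e\<close> of \<open>d\<close> on \<open>[u,v]\<close>, its integral over \<open>[u,v)\<close> is within \<open>e (v - u)\<close>
    of that of the constant \<open>d\<close>.\<close>
  have err: "norm (F v - F u - (v - u) *\<^sub>R d) \<le> e * (v - u)"
    if uv: "a \<le> u" "u \<le> v" "v \<le> b" and d: "\<And>s. s \<in> {u..v} \<Longrightarrow> norm (f s - d) \<le> e" for u v d e
  proof -
    have "0 \<le> e" using order_trans[OF norm_ge_zero d[of u]] uv by simp
    have "has_strong_integral ?M (\<lambda>s. indicator {u..<v} s *\<^sub>R d) ((v - u) *\<^sub>R d)"
      using has_strong_integral_indicator[OF sets, of u v d] emeasure[OF uv] measure[OF uv] uv by simp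
    from has_strong_integral_diff[OF has_strong_integral_diff[OF F F] this, of v u] uv
    have "has_strong_integral ?M (\<lambda>s. indicator {a..<v} s *\<^sub>R f s - indicator {a..<u} s *\<^sub>R f s
        - indicator {u..<v} s *\<^sub>R d) (F v - F u - (v - u) *\<^sub>R d)" by simp
    from has_strong_integral_norm_le[OF this]
    have "ennreal (norm (F v - F u - (v - u) *\<^sub>R d)) \<le>
      (\<integral>\<^sup>+s. norm (indicator {a..<v} s *\<^sub>R f s - indicator {a..<u} s *\<^sub>R f s - indicator {u..<v} s *\<^sub>R d) \<partial>?M)" .
    also have "\<dots> \<le> (\<integral>\<^sup>+s. ennreal e * indicator {u..<v} s \<partial>?M)"
      using d uv by (intro nn_integral_mono) (auto split: split_indicator intro!: ennreal_leI)
    also have "\<dots> = ennreal e * ennreal (v - u)"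
      using uv sets emeasure by (subst nn_integral_cmult_indicator) auto
    also have "\<dots> = ennreal (e * (v - u))"
      using \<open>0 \<le> e\<close> uv by (simp add: ennreal_mult)
    finally show ?thesis using \<open>0 \<le> e\<close> uv by (simp add: ennreal_le_iff)
  qed
  have dF: "(F has_vector_derivative f y) (at y within {a..b})" if y: "y \<in> {a..b}" for y
    unfolding has_vector_derivative_def has_derivative_within_alt
  proof (intro conjI allI impI bounded_linear_scaleR_left)
    fix e :: real assume "0 < e"
    then obtain r where r: "0 < r" "\<And>s. s \<in> {a..b} \<Longrightarrow> dist s y < r \<Longrightarrow> dist (f s) (f y) < e"
      using f y unfolding continuous_on_iff by blast
    have "norm (F z - F y - (z - y) *\<^sub>R f y) \<le> e * norm (z - y)"
      if z: "z \<in> {a..b}" "norm (z - y) < r" for z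
    proof (cases "y \<le> z")
      case True
      have "norm (f s - f y) \<le> e" if "s \<in> {y..z}" for s
        using r(2)[of s] that z y by (auto simp: dist_norm)
      from err[OF _ True _ this] show ?thesis using y z True by simp
    next
      case False
      have "norm (f s - f y) \<le> e" if "s \<in> {z..y}" for s
        using r(2)[of s] that z y by (auto simp: dist_norm)
      from err[OF _ _ _ this] have "norm (F y - F z - (y - z) *\<^sub>R f y) \<le> e * (y - z)"
        using y z False by simp
      moreover have "F z - F y - (z - y) *\<^sub>R f y = - (F y - F z - (y - z) *\<^sub>R f y)"
        by (simp add: algebra_simps)
      ultimately show ?thesis using False by (simp only: norm_minus_cancel) simp
    qed
    with r(1) show "\<exists>d>0. \<forall>z\<in>{a..b}. norm (z - y) < d \<longrightarrow>
        norm (F z - F y - (z - y) *\<^sub>R f y) \<le> e * norm (z - y)" by blast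
  qed
  have sub: "{a..x} \<subseteq> {a..b}" "a \<le> x" using x by auto
  have "(f has_integral (F x - F a)) {a..x}"
    by (rule fundamental_theorem_of_calculus[OF sub(2)])
       (use dF sub in \<open>blast intro: has_vector_derivative_within_subset\<close>)
  moreover have "(f has_integral (g x - g a)) {a..x}"
    by (rule fundamental_theorem_of_calculus[OF sub(2)])
       (use g sub in \<open>blast intro: has_vector_derivative_within_subset\<close>)
  ultimately have "F x - F a = g x - g a" by (rule has_integral_unique)
  moreover have "F a = 0"
    using has_strong_integral_norm_le[OF F[of a]] x by simp
  ultimately show ?thesis using F[OF x] by simp
qed

section \<open>The spaces \<open>L\<^sup>p\<close> on the half-line\<close>

interpretation halfline: complete_measure halfline
  by (rule complete_measure_lebesgue_on) simp

lemma powr_add_le: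
  fixes a b p :: real
  assumes "0 \<le> a" "0 \<le> b" "0 \<le> p"
  shows "(a + b) powr p \<le> 2 powr p * (a powr p + b powr p)"
proof -
  have "(a + b) powr p \<le> (2 * max a b) powr p"
    using assms by (intro powr_mono2) auto
  also have "\<dots> = 2 powr p * max a b powr p"
    using assms by (simp add: powr_mult)
  also have "\<dots> \<le> 2 powr p * (a powr p + b powr p)"
    using assms by (intro mult_left_mono) (auto simp: max_def)
  finally show ?thesis .
qed

lemma Lp_strongly_measurable: "u \<in> Lp p \<Longrightarrow> strongly_measurable halfline u"
  by (simp add: Lp_def)

lemma Lp_norm_measurable: "u \<in> Lp p \<Longrightarrow> (\<lambda>t. norm (u t)) \<in> borel_measurable halfline"
  by (intro halfline.borel_measurable_norm_strongly_measurable Lp_strongly_measurable)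

lemma Lp_dominated:
  assumes u: "strongly_measurable halfline u" and g: "integrable halfline g"
    and le: "AE t in halfline. norm (u t) powr p \<le> g t"
  shows "u \<in> Lp p"
proof -
  have "integrable halfline (\<lambda>t. norm (u t) powr p)"
  proof (rule Bochner_Integration.integrable_bound[OF g])
    show "(\<lambda>t. norm (u t) powr p) \<in> borel_measurable halfline"
      using halfline.borel_measurable_norm_strongly_measurable[OF u] by measurable
    show "AE t in halfline. norm (norm (u t) powr p) \<le> norm (g t)"
      using le by eventually_elim auto
  qed
  with u show ?thesis by (simp add: Lp_def)
qed

lemma Lp_dominated_Lp:
  assumes u: "strongly_measurable halfline u" and g: "g \<in> Lp p" and "0 \<le> p"
    and le: "AE t in halfline. norm (u t) \<le> norm (g t)"
  shows "u \<in> Lp p"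
proof (rule Lp_dominated[OF u])
  show "integrable halfline (\<lambda>t. norm (g t) powr p)" using g by (simp add: Lp_def)
  show "AE t in halfline. norm (u t) powr p \<le> norm (g t) powr p"
    using le by eventually_elim (use \<open>0 \<le> p\<close> in \<open>simp add: powr_mono2\<close>)
qed

lemma Lp_cong_AE: "u \<in> Lp p \<Longrightarrow> 0 \<le> p \<Longrightarrow> AE t in halfline. u t = v t \<Longrightarrow> v \<in> Lp p"
  by (rule Lp_dominated_Lp[of v u])
     (auto intro: strongly_measurable_cong_AE[OF Lp_strongly_measurable] elim: eventually_mono)

lemma Lp_add:
  assumes u: "u \<in> Lp p" and v: "v \<in> Lp p" and p: "0 \<le> p"
  shows "(\<lambda>t. u t + v t) \<in> Lp p"
proof (rule Lp_dominated)
  show "strongly_measurable halfline (\<lambda>t. u t + v t)"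
    by (intro strongly_measurable_add Lp_strongly_measurable[OF u] Lp_strongly_measurable[OF v])
  show "integrable halfline (\<lambda>t. 2 powr p * (norm (u t) powr p + norm (v t) powr p))"
    using u v by (auto simp: Lp_def)
  have "norm (u t + v t) powr p \<le> (norm (u t) + norm (v t)) powr p" for t
    using p by (intro powr_mono2 norm_triangle_ineq) auto
  then show "AE t in halfline. norm (u t + v t) powr p \<le> 2 powr p * (norm (u t) powr p + norm (v t) powr p)"
    by (intro AE_I2) (rule order_trans[OF _ powr_add_le[OF norm_ge_zero norm_ge_zero p]])
qed

lemma Lp_scaleR:
  assumes u: "u \<in> Lp p" and p: "0 \<le> p"
  shows "(\<lambda>t. c *\<^sub>R u t) \<in> Lp p"
proof (rule Lp_dominated)
  show "strongly_measurable halfline (\<lambda>t. c *\<^sub>R u t)"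
    by (rule strongly_measurable_compose[OF Lp_strongly_measurable[OF u]]) (intro continuous_intros)
  show "integrable halfline (\<lambda>t. \<bar>c\<bar> powr p * norm (u t) powr p)"
    using u by (auto simp: Lp_def)
qed (simp add: powr_mult)

lemma Lp_diff: "u \<in> Lp p \<Longrightarrow> v \<in> Lp p \<Longrightarrow> 0 \<le> p \<Longrightarrow> (\<lambda>t. u t - v t) \<in> Lp p"
  using Lp_add[of u p "\<lambda>t. (-1) *\<^sub>R v t"] Lp_scaleR[of v p "-1"] by simp

lemma Lp_zero: "0 \<le> p \<Longrightarrow> (\<lambda>t. 0) \<in> Lp p"
  by (rule Lp_dominated[of _ "\<lambda>t. 0"]) (auto intro: strongly_measurable_simple)

lemma pos_part_nonneg [simp]: "0 \<le> pos_part u t"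
  and neg_part_nonneg [simp]: "0 \<le> neg_part u t"
  by (simp_all add: pos_part_def neg_part_def)

lemma pos_part_minus_neg_part: "pos_part u t - neg_part u t = u t"
  unfolding pos_part_def neg_part_def by (rule sup_zero_minus_sup_zero)

lemma norm_pos_part_le: "norm (pos_part u t) \<le> norm (u t)"
  and norm_neg_part_le: "norm (neg_part u t) \<le> norm (u t)"
  using norm_sup_zero_le[of "u t"] norm_sup_zero_le[of "- u t"]
  by (simp_all add: pos_part_def neg_part_def)

lemma pos_part_eq: "0 \<le> u t \<Longrightarrow> pos_part u t = u t"
  and neg_part_eq: "0 \<le> u t \<Longrightarrow> neg_part u t = 0"
  by (simp_all add: pos_part_def neg_part_def sup_absorb1 sup_absorb2)

lemma Lp_pos_part: "u \<in> Lp p \<Longrightarrow> 0 \<le> p \<Longrightarrow> pos_part u \<in> Lp p"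
  unfolding pos_part_def[abs_def]
  by (rule Lp_dominated_Lp[of _ u])
     (auto intro: strongly_measurable_compose[OF Lp_strongly_measurable] continuous_on_sup_zero
        norm_sup_zero_le)

lemma neg_part_eq_pos_part: "neg_part u = pos_part (\<lambda>t. - u t)"
  by (simp add: fun_eq_iff pos_part_def neg_part_def)

lemma Lp_neg_part: "u \<in> Lp p \<Longrightarrow> 0 \<le> p \<Longrightarrow> neg_part u \<in> Lp p"
  unfolding neg_part_eq_pos_part using Lp_scaleR[of u p "-1"] by (intro Lp_pos_part) auto

lemma Lp_plus_I: "u \<in> Lp p \<Longrightarrow> (\<And>t. 0 \<le> u t) \<Longrightarrow> u \<in> Lp_plus p"
  by (simp add: Lp_plus_def)

lemma Lp_plus_add: "u \<in> Lp_plus p \<Longrightarrow> v \<in> Lp_plus p \<Longrightarrow> 0 \<le> p \<Longrightarrow> (\<lambda>t. u t + v t) \<in> Lp_plus p"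
  unfolding Lp_plus_def by (auto intro!: Lp_add elim!: AE_mp)

lemma Lp_plus_scaleR: "u \<in> Lp_plus p \<Longrightarrow> 0 \<le> p \<Longrightarrow> 0 \<le> c \<Longrightarrow> (\<lambda>t. c *\<^sub>R u t) \<in> Lp_plus p"
  unfolding Lp_plus_def by (auto intro!: Lp_scaleR elim!: eventually_mono simp: scaleR_nonneg_nonneg)

lemma Lp_indicator:
  assumes E: "E \<in> sets halfline" "emeasure halfline E < \<infinity>" and p: "0 < p"
  shows "(\<lambda>t. indicator E t *\<^sub>R v) \<in> Lp p"
proof (rule Lp_dominated)
  show "strongly_measurable halfline (\<lambda>t. indicator E t *\<^sub>R v)"
    by (intro strongly_measurable_indicator_scaleR E strongly_measurable_simple simple_function_const)
  show "integrable halfline (\<lambda>t. indicator E t * (norm v powr p))"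
    using E by (intro integrable_mult_left integrable_real_indicator) auto
qed (auto split: split_indicator)

lemma Lp_norm_nonneg [simp]: "0 \<le> Lp_norm p u"
  by (simp add: Lp_norm_def)

lemma Lp_norm_mono:
  assumes "u \<in> Lp p" "v \<in> Lp p" "0 < p" "AE t in halfline. norm (u t) \<le> norm (v t)"
  shows "Lp_norm p u \<le> Lp_norm p v"
  unfolding Lp_norm_def
proof (intro powr_mono2 integral_mono_AE)
  show "AE t in halfline. norm (u t) powr p \<le> norm (v t) powr p"
    using assms(4) by eventually_elim (use assms(3) in \<open>simp add: powr_mono2\<close>)
qed (use assms in \<open>auto simp: Lp_def integral_nonneg_AE\<close>)

lemma Lp_norm_powr: "0 < p \<Longrightarrow> Lp_norm p u powr p = (\<integral>t. norm (u t) powr p \<partial>halfline)"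
  by (simp add: Lp_norm_def powr_powr integral_nonneg_AE)

lemma Lp_norm_scaleR: "0 < p \<Longrightarrow> Lp_norm p (\<lambda>t. c *\<^sub>R u t) = \<bar>c\<bar> * Lp_norm p u"
  by (simp add: Lp_norm_def powr_mult powr_powr integral_nonneg_AE)

lemma Lp_norm_eq_0D:
  assumes u: "u \<in> Lp p" and p: "0 < p" and 0: "Lp_norm p u = 0"
  shows "AE t in halfline. u t = 0"
proof -
  have "(\<integral>t. norm (u t) powr p \<partial>halfline) = 0"
    using Lp_norm_powr[OF p, of u] 0 by simp
  then have "AE t in halfline. norm (u t) powr p = 0"
    using u by (subst (asm) integral_nonneg_eq_0_iff_AE) (auto simp: Lp_def)
  then show ?thesis by eventually_elim simp
qed

lemma Lp_norm_indicator:
  assumes E: "E \<in> sets halfline" "emeasure halfline E < \<infinity>" and p: "0 < p"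
  shows "Lp_norm p (\<lambda>t. indicator E t *\<^sub>R v) = measure halfline E powr (1 / p) * norm v"
proof -
  have "norm (indicator E t *\<^sub>R v) powr p = indicator E t * (norm v powr p)" for t
    using p by (simp split: split_indicator)
  then have "Lp_norm p (\<lambda>t. indicator E t *\<^sub>R v) = (measure halfline E * norm v powr p) powr (1 / p)"
    using E sets.sets_into_space[OF E(1)] by (simp add: Lp_norm_def Int_absorb2)
  then show ?thesis using p by (simp add: powr_mult powr_powr)
qed

text \<open>The two ways in which this is used are the density of simple functions in \<open>L\<^sup>p\<close> and the
  countable additivity of \<open>E \<mapsto> \<Psi> (1\<^sub>E v)\<close> for a bounded linear map \<open>\<Psi>\<close> on \<open>L\<^sup>p\<close>; only for finite \<open>p\<close> does
  domination imply convergence in norm.\<close>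

lemma Lp_dominated_convergence:
  fixes u :: "nat \<Rightarrow> real \<Rightarrow> 'u::real_normed_vector"
  assumes p: "0 < p" and u: "\<And>n. u n \<in> Lp p"
    and lim: "AE t in halfline. (\<lambda>n. u n t) \<longlonglongrightarrow> v t"
    and g: "g \<in> Lp p" and bound: "\<And>n. AE t in halfline. norm (u n t) \<le> norm (g t)"
  shows "v \<in> Lp p" "(\<lambda>n. Lp_norm p (\<lambda>t. u n t - v t)) \<longlonglongrightarrow> 0"
proof -
  have bv: "AE t in halfline. norm (v t) \<le> norm (g t)"
  proof -
    have "AE t in halfline. \<forall>n. norm (u n t) \<le> norm (g t)" using bound by (simp add: AE_all_countable)
    with lim show ?thesis
      by eventually_elim (auto intro: LIMSEQ_le_const2[OF tendsto_norm])
  qed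
  show v: "v \<in> Lp p"
    using p by (intro Lp_dominated_Lp[OF _ g _ bv]
        halfline.strongly_measurable_AE_LIMSEQ[OF Lp_strongly_measurable[OF u] lim]) simp
  have "(\<lambda>n. \<integral>t. norm (u n t - v t) powr p \<partial>halfline) \<longlonglongrightarrow> (\<integral>t. 0 \<partial>halfline)"
  proof (rule integral_dominated_convergence)
    show "integrable halfline (\<lambda>t. 2 powr p * norm (g t) powr p)"
      using g by (auto simp: Lp_def)
    show "(\<lambda>t. norm (u n t - v t) powr p) \<in> borel_measurable halfline" for n
    proof -
      have [measurable]: "(\<lambda>t. norm (u n t - v t)) \<in> borel_measurable halfline"
        using p by (intro Lp_norm_measurable[of _ p] Lp_diff u v) simp
      show ?thesis by measurable
    qed
    show "AE t in halfline. norm (norm (u n t - v t) powr p) \<le> 2 powr p * norm (g t) powr p" for n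
      using bound[of n] bv
    proof eventually_elim
      case (elim t)
      have "norm (u n t - v t) \<le> 2 * norm (g t)"
        using norm_triangle_ineq4[of "u n t" "v t"] elim by simp
      then have "norm (u n t - v t) powr p \<le> (2 * norm (g t)) powr p"
        using p by (intro powr_mono2) auto
      then show ?case by (simp add: powr_mult)
    qed
    show "AE t in halfline. (\<lambda>n. norm (u n t - v t) powr p) \<longlonglongrightarrow> 0"
      using lim
    proof eventually_elim
      case (elim t)
      have "(\<lambda>n. norm (u n t - v t)) \<longlonglongrightarrow> 0"
        using elim by (intro tendsto_norm_zero) (simp add: LIM_zero)
      then show ?case using p by (intro tendsto_zero_powrI tendsto_const) auto
    qed
  qed simp
  then have "(\<lambda>n. \<integral>t. norm (u n t - v t) powr p \<partial>halfline) \<longlonglongrightarrow> 0" by simp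
  then show "(\<lambda>n. Lp_norm p (\<lambda>t. u n t - v t)) \<longlonglongrightarrow> 0"
    unfolding Lp_norm_def using p
    by (intro tendsto_zero_powrI[OF _ tendsto_const]) (auto simp: integral_nonneg_AE)
qed

section \<open>Positive additive maps on the cone of \<open>L\<^sup>p\<close>\<close>

locale positive_additive =
  fixes p :: real and F :: "(real \<Rightarrow> 'u::banach_lattice) \<Rightarrow> 'x::banach_lattice"
  assumes p: "0 < p"
    and cong: "\<And>u v. u \<in> Lp_plus p \<Longrightarrow> v \<in> Lp_plus p \<Longrightarrow> ae_eq u v \<Longrightarrow> F u = F v"
    and nonneg: "\<And>u. u \<in> Lp_plus p \<Longrightarrow> 0 \<le> F u"
    and add: "\<And>u v. u \<in> Lp_plus p \<Longrightarrow> v \<in> Lp_plus p \<Longrightarrow> F (\<lambda>t. u t + v t) = F u + F v"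
begin

lemma Lp_plus_pos_part [simp]: "u \<in> Lp p \<Longrightarrow> pos_part u \<in> Lp_plus p"
  and Lp_plus_neg_part [simp]: "u \<in> Lp p \<Longrightarrow> neg_part u \<in> Lp_plus p"
  using p by (auto intro!: Lp_plus_I Lp_pos_part Lp_neg_part)

lemma zero: "F (\<lambda>t. 0) = 0"
  using add[of "\<lambda>t. 0" "\<lambda>t. 0"] Lp_plus_I[OF Lp_zero[of p]] p by simp

lemma AE_zero: "u \<in> Lp_plus p \<Longrightarrow> AE t in halfline. u t = 0 \<Longrightarrow> F u = 0"
  using cong[of u "\<lambda>t. 0"] Lp_plus_I[OF Lp_zero[of p]] p zero by (simp add: ae_eq_def)

lemma mono:
  assumes u: "u \<in> Lp_plus p" and v: "v \<in> Lp_plus p" and le: "AE t in halfline. u t \<le> v t"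
  shows "F u \<le> F v"
proof -
  have "(\<lambda>t. v t - u t) \<in> Lp_plus p"
    using u v le p by (auto simp: Lp_plus_def intro!: Lp_diff)
  from add[OF u this] nonneg[OF this] show ?thesis by simp
qed

lemma of_nat: "u \<in> Lp_plus p \<Longrightarrow> F (\<lambda>t. real n *\<^sub>R u t) = real n *\<^sub>R F u"
proof (induction n)
  case 0
  show ?case by (simp add: zero)
next
  case (Suc n)
  have "F (\<lambda>t. real n *\<^sub>R u t + u t) = F (\<lambda>t. real n *\<^sub>R u t) + F u"
    using Suc.prems p by (intro add Lp_plus_scaleR) auto
  then show ?case using Suc by (simp add: scaleR_left_distrib add.commute)
qed

text \<open>An additive positive map is monotone, hence positively homogeneous, because a Banach lattice
  is Archimedean: with \<open>k\<close> the integer part of \<open>n c\<close>, both \<open>n F (c u)\<close> and \<open>n c F u\<close> lie between \<open>k F u\<close>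
  and \<open>(k + 1) F u\<close>, so that \<open>n (F (c u) - c F u)\<close> lies between \<open>- F u\<close> and \<open>F u\<close> for every \<open>n\<close>.\<close>

lemma scaleR:
  assumes u: "u \<in> Lp_plus p" and c: "0 \<le> c"
  shows "F (\<lambda>t. c *\<^sub>R u t) = c *\<^sub>R F u"
proof -
  define d where "d = F (\<lambda>t. c *\<^sub>R u t) - c *\<^sub>R F u"
  have cu: "(\<lambda>t. c *\<^sub>R u t) \<in> Lp_plus p" using u c p by (simp add: Lp_plus_scaleR)
  have Fu: "0 \<le> F u" using u by (rule nonneg)
  have uAE: "AE t in halfline. 0 \<le> u t" using u by (simp add: Lp_plus_def)
  have bound: "real n * norm d \<le> norm (F u)" for n
  proof -
    define k where "k = nat \<lfloor>real n * c\<rfloor>"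
    have k: "real k \<le> real n * c" "real n * c \<le> real (Suc k)"
      using c by (auto simp: k_def) linarith+
    have nF: "real n *\<^sub>R F (\<lambda>t. c *\<^sub>R u t) = F (\<lambda>t. (real n * c) *\<^sub>R u t)"
      using of_nat[OF cu, of n] by simp
    have "F (\<lambda>t. real k *\<^sub>R u t) \<le> F (\<lambda>t. (real n * c) *\<^sub>R u t)"
      using k c p u uAE by (intro mono Lp_plus_scaleR)
        (auto elim!: eventually_mono intro: scaleR_right_mono)
    moreover have "F (\<lambda>t. (real n * c) *\<^sub>R u t) \<le> F (\<lambda>t. real (Suc k) *\<^sub>R u t)"
      using k c p u uAE by (intro mono Lp_plus_scaleR)
        (auto elim!: eventually_mono intro!: scaleR_right_mono)
    ultimately have *: "real k *\<^sub>R F u \<le> real n *\<^sub>R F (\<lambda>t. c *\<^sub>R u t)"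
      "real n *\<^sub>R F (\<lambda>t. c *\<^sub>R u t) \<le> real (Suc k) *\<^sub>R F u"
      unfolding nF of_nat[OF u] by auto
    have **: "(real n * c) *\<^sub>R F u \<le> real (Suc k) *\<^sub>R F u" "real k *\<^sub>R F u \<le> (real n * c) *\<^sub>R F u"
      using k Fu by (intro scaleR_right_mono; simp)+
    have nd: "real n *\<^sub>R d = real n *\<^sub>R F (\<lambda>t. c *\<^sub>R u t) - (real n * c) *\<^sub>R F u"
      by (simp add: d_def scaleR_right_diff_distrib)
    have "real n *\<^sub>R d \<le> real (Suc k) *\<^sub>R F u - real k *\<^sub>R F u"
      unfolding nd using *(2) **(2) by (rule diff_mono)
    moreover have "- (real n *\<^sub>R d) \<le> real (Suc k) *\<^sub>R F u - real k *\<^sub>R F u"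
      unfolding nd minus_diff_eq using **(1) *(1) by (rule diff_mono)
    moreover have "real (Suc k) *\<^sub>R F u - real k *\<^sub>R F u = F u"
      by (simp add: scaleR_left_distrib)
    ultimately have "\<bar>real n *\<^sub>R d\<bar> \<le> \<bar>F u\<bar>"
      using Fu by (intro abs_leI) auto
    from norm_mono_abs[OF this] show ?thesis by simp
  qed
  have "norm d = 0"
  proof (rule ccontr)
    assume "norm d \<noteq> 0"
    then obtain n where "norm (F u) < real n * norm d"
      using reals_Archimedean3[of "norm d"] by auto
    with bound[of n] show False by simp
  qed
  then show ?thesis by (simp add: d_def)
qed


text \<open>If \<open>F\<close> were unbounded, there would be \<open>w n \<ge> 0\<close> with \<open>\<parallel>w n\<parallel> = 2\<^sup>-\<^sup>n\<close> and
  \<open>\<parallel>F (w n)\<parallel> \<ge> 4\<^sup>n\<close>.  Then \<open>u = (\<Sum>n. 2\<^sup>-\<^sup>n w n)\<close> would satisfy \<open>F u \<ge> 2\<^sup>-\<^sup>n F (w n)\<close> for every \<open>n\<close>, which is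
  absurd.  That \<open>u\<close> is in \<open>L\<^sup>p\<close> does not require Minkowski's inequality: with
  \<open>\<psi> t = (\<Sum>n. \<parallel>w n t\<parallel>\<^sup>p)\<close>, which is integrable, every \<open>\<parallel>w n t\<parallel>\<close> is at most \<open>\<psi> t\<close> to the power \<open>1 / p\<close>,
  and so \<open>\<parallel>u t\<parallel>\<^sup>p \<le> 2\<^sup>p \<psi> t\<close>.\<close>

lemma bounded_on_cone:
  assumes p1: "1 \<le> p"
  shows "\<exists>K\<ge>0. \<forall>u\<in>Lp_plus p. norm (F u) \<le> K * Lp_norm p u"
proof (rule ccontr)
  assume *: "\<not> ?thesis"
  have unbounded: "\<exists>u\<in>Lp_plus p. K * Lp_norm p u < norm (F u)" if "0 \<le> K" for K
    using * that by (meson not_le)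
  have "\<exists>w\<in>Lp_plus p. Lp_norm p w = (1/2)^n \<and> 4^n \<le> norm (F w)" for n :: nat
  proof -
    obtain u where u: "u \<in> Lp_plus p" "8^n * Lp_norm p u < norm (F u)"
      using unbounded[of "8^n"] by auto
    \<comment> \<open>The factor \<open>8\<^sup>n = 2\<^sup>n 4\<^sup>n\<close> leaves \<open>4\<^sup>n\<close> after \<open>u\<close> is scaled to norm \<open>2\<^sup>-\<^sup>n\<close>.\<close>
    have "Lp_norm p u \<noteq> 0"
    proof
      assume "Lp_norm p u = 0"
      then have "F u = 0"
        using u(1) p by (intro AE_zero Lp_norm_eq_0D) (auto simp: Lp_plus_def)
      then show False using u(2) \<open>Lp_norm p u = 0\<close> by simp
    qed
    then have pos: "0 < Lp_norm p u" using Lp_norm_nonneg[of p u] by linarith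
    define c where "c = (1/2)^n / Lp_norm p u"
    have c: "0 < c" using pos by (simp add: c_def)
    have "norm (F (\<lambda>t. c *\<^sub>R u t)) = c * norm (F u)"
      using scaleR[OF u(1)] c by simp
    moreover have "c * (8^n * Lp_norm p u) \<le> c * norm (F u)"
      using u(2) c by (intro mult_left_mono) auto
    moreover have "c * (8^n * Lp_norm p u) = 4^n"
      using pos by (simp add: c_def field_simps flip: power_mult_distrib)
    moreover have "Lp_norm p (\<lambda>t. c *\<^sub>R u t) = (1/2)^n"
      using pos c p by (simp add: Lp_norm_scaleR c_def)
    moreover have "(\<lambda>t. c *\<^sub>R u t) \<in> Lp_plus p"
      using u(1) c p by (simp add: Lp_plus_scaleR)
    ultimately show ?thesis by (intro bexI[of _ "\<lambda>t. c *\<^sub>R u t"]) auto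
  qed
  then obtain w where w: "\<And>n. w n \<in> Lp_plus p" "\<And>n. Lp_norm p (w n) = (1/2)^n"
    "\<And>n. 4^n \<le> norm (F (w n))" by metis
  have wL: "w n \<in> Lp p" for n using w(1) by (simp add: Lp_plus_def)
  define a where "a n t = norm (w n t) powr p" for n t
  have a_int: "integrable halfline (a n)" for n
    using wL[of n] by (simp add: a_def[abs_def] Lp_def)
  have a_nonneg [simp]: "0 \<le> a n t" for n t by (simp add: a_def)
  have a_le: "(\<integral>t. a n t \<partial>halfline) \<le> (1/2)^n" for n
  proof -
    have "(\<integral>t. a n t \<partial>halfline) = ((1/2)^n) powr p"
      using Lp_norm_powr[OF p, of "w n"] w(2) by (simp add: a_def)
    \<comment> \<open>For \<open>p \<ge> 1\<close>, the \<open>p\<close>-th power of a number in \<open>[0,1]\<close> is at most that number.\<close>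
    also have "\<dots> \<le> ((1/2)^n) powr 1"
      using p1 by (intro powr_mono') (auto simp: power_le_one)
    finally show ?thesis by simp
  qed
  have a_sum: "summable (\<lambda>n. \<integral>t. norm (a n t) \<partial>halfline)"
    by (rule summable_comparison_test'[OF summable_geometric[of "1/2"], of 0])
       (use a_le in \<open>auto simp: integral_nonneg_AE\<close>)
  have a_AE: "AE t in halfline. summable (\<lambda>n. a n t)"
  proof -
    have [measurable]: "a n \<in> borel_measurable halfline" for n using a_int by auto
    have "(\<integral>\<^sup>+t. (\<Sum>n. ennreal (a n t)) \<partial>halfline) = (\<Sum>n. \<integral>\<^sup>+t. ennreal (a n t) \<partial>halfline)"
      by (rule nn_integral_suminf) measurable
    also have "\<dots> = (\<Sum>n. ennreal (\<integral>t. a n t \<partial>halfline))"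
      by (intro suminf_cong nn_integral_eq_integral a_int) simp
    also have "\<dots> \<noteq> \<infinity>"
      using a_sum by (subst suminf_ennreal2) (auto simp: integral_nonneg_AE)
    finally have "(\<integral>\<^sup>+t. (\<Sum>n. ennreal (a n t)) \<partial>halfline) \<noteq> \<infinity>" .
    then have "AE t in halfline. (\<Sum>n. ennreal (a n t)) \<noteq> \<infinity>"
      by (intro nn_integral_PInf_AE) measurable
    then show ?thesis
      by eventually_elim (rule summable_suminf_not_top, auto)
  qed
  define \<psi> where "\<psi> t = (\<Sum>n. a n t)" for t
  have \<psi>_int: "integrable halfline \<psi>"
    unfolding \<psi>_def[abs_def] using a_int a_AE a_sum by (intro integrable_suminf) auto
  define x where "x n t = (1/2)^n *\<^sub>R w n t" for n t
  define u where "u t = (\<Sum>n. x n t)" for t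
  have x_plus: "x n \<in> Lp_plus p" for n
    unfolding x_def[abs_def] using w(1) p by (intro Lp_plus_scaleR) auto
  have x_pos: "AE t in halfline. \<forall>n. 0 \<le> x n t"
    using x_plus by (simp add: AE_all_countable Lp_plus_def)
  have x_le: "norm (x n t) \<le> (1/2)^n * \<psi> t powr (1/p)" if "summable (\<lambda>n. a n t)" for n t
  proof -
    have "a n t \<le> \<psi> t"
      unfolding \<psi>_def using sum_le_suminf[OF that, of "{n}"] by simp
    then have "a n t powr (1/p) \<le> \<psi> t powr (1/p)"
      using p by (intro powr_mono2) auto
    then have "norm (w n t) \<le> \<psi> t powr (1/p)"
      using p by (simp add: a_def powr_powr)
    then show ?thesis by (simp add: x_def mult_left_mono)
  qed
  have geo: "summable (\<lambda>n. (1/2)^n * c)" "(\<Sum>n. (1/2)^n * c) = 2 * c" for c :: real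
    by (simp_all add: summable_mult2 summable_geometric suminf_mult2[symmetric] suminf_geometric)
  have x_sum: "summable (\<lambda>n. norm (x n t))" if "summable (\<lambda>n. a n t)" for t
    by (rule summable_comparison_test'[OF geo(1), of 0]) (use x_le[OF that] in auto)
  have u_le: "norm (u t) \<le> 2 * \<psi> t powr (1/p)" if t: "summable (\<lambda>n. a n t)" for t
  proof -
    have "norm (u t) \<le> (\<Sum>n. norm (x n t))"
      unfolding u_def by (rule summable_norm[OF x_sum[OF t]])
    also have "\<dots> \<le> (\<Sum>n. (1/2)^n * \<psi> t powr (1/p))"
      by (intro suminf_le x_le t x_sum geo)
    finally show ?thesis by (simp add: geo)
  qed
  have u_Lp: "u \<in> Lp p"
  proof (rule Lp_dominated)
    have partial: "strongly_measurable halfline (\<lambda>t. \<Sum>n<N. x n t)" for N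
      using x_plus by (intro strongly_measurable_sum) (auto simp: Lp_plus_def Lp_def)
    show "strongly_measurable halfline u"
    proof (rule halfline.strongly_measurable_AE_LIMSEQ[OF partial])
      show "AE t in halfline. (\<lambda>N. \<Sum>n<N. x n t) \<longlonglongrightarrow> u t"
        using a_AE
        by eventually_elim (auto simp: u_def intro!: summable_LIMSEQ summable_norm_cancel[OF x_sum])
    qed
    show "integrable halfline (\<lambda>t. 2 powr p * \<psi> t)" using \<psi>_int by simp
    show "AE t in halfline. norm (u t) powr p \<le> 2 powr p * \<psi> t"
      using a_AE
    proof eventually_elim
      case (elim t)
      have "0 \<le> \<psi> t" unfolding \<psi>_def using elim by (simp add: suminf_nonneg)
      have "norm (u t) powr p \<le> (2 * \<psi> t powr (1/p)) powr p"
        using u_le[OF elim] p by (intro powr_mono2) auto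
      also have "\<dots> = 2 powr p * \<psi> t"
        using p \<open>0 \<le> \<psi> t\<close> by (simp add: powr_mult powr_powr)
      finally show ?case .
    qed
  qed
  have x_le_u: "AE t in halfline. x n t \<le> u t" for n
    using a_AE x_pos
    by eventually_elim (auto simp: u_def intro!: suminf_ge_term summable_norm_cancel[OF x_sum])
  have u_plus: "u \<in> Lp_plus p"
    using u_Lp x_pos x_le_u[of 0] unfolding Lp_plus_def by (auto intro: order_trans)
  have "2^n \<le> norm (F u)" for n :: nat
  proof -
    have "2^n = (1/2)^n * (4^n :: real)" by (simp flip: power_mult_distrib)
    also have "\<dots> \<le> (1/2)^n * norm (F (w n))" using w(3) by (intro mult_left_mono) auto
    also have "\<dots> = norm (F (x n))"
      using scaleR[OF w(1), of "(1/2)^n" n] by (simp add: x_def[abs_def])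
    also have "\<dots> \<le> norm (F u)"
      by (intro norm_mono_nonneg nonneg mono x_plus u_plus x_le_u)
    finally show ?thesis .
  qed
  moreover obtain n where "norm (F u) < 2^n"
    using real_arch_pow[of 2 "norm (F u)"] by auto
  ultimately show False by (meson not_le)
qed

definition extension :: "(real \<Rightarrow> 'u) \<Rightarrow> 'x" where
  "extension u = F (pos_part u) - F (neg_part u)"

text \<open>The value does not depend on how \<open>u\<close> is written as a difference of two elements of the cone.
  All algebraic properties of the extension follow from this, because sums and multiples of
  decompositions are decompositions.\<close>

lemma extension_eq_diff:
  assumes u: "u \<in> Lp p" and v: "v \<in> Lp_plus p" and w: "w \<in> Lp_plus p"
    and eq: "AE t in halfline. u t = v t - w t"
  shows "extension u = F v - F w"
proof -
  have "F (\<lambda>t. pos_part u t + w t) = F (\<lambda>t. neg_part u t + v t)"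
  proof (rule cong)
    show "ae_eq (\<lambda>t. pos_part u t + w t) (\<lambda>t. neg_part u t + v t)"
      unfolding ae_eq_def using eq
    proof eventually_elim
      case (elim t)
      then have "pos_part u t - neg_part u t = v t - w t" by (simp only: pos_part_minus_neg_part)
      then show ?case by (simp add: algebra_simps)
    qed
  qed (use u v w p in \<open>auto intro!: Lp_plus_add\<close>)
  then have "F (pos_part u) + F w = F (neg_part u) + F v"
    using u v w by (simp add: add)
  then show ?thesis unfolding extension_def by (simp add: algebra_simps)
qed

lemma extension_eq: "u \<in> Lp_plus p \<Longrightarrow> extension u = F u"
  using extension_eq_diff[of u u "\<lambda>t. 0"] zero p Lp_plus_I[OF Lp_zero[of p]]
  by (simp add: Lp_plus_def)

lemma extension_cong: "u \<in> Lp p \<Longrightarrow> v \<in> Lp p \<Longrightarrow> ae_eq u v \<Longrightarrow> extension u = extension v"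
  by (subst extension_def[of v], rule extension_eq_diff)
     (auto simp: ae_eq_def pos_part_minus_neg_part)

lemma extension_add:
  assumes u: "u \<in> Lp p" and v: "v \<in> Lp p"
  shows "extension (\<lambda>t. u t + v t) = extension u + extension v"
proof -
  have "extension (\<lambda>t. u t + v t) = F (\<lambda>t. pos_part u t + pos_part v t) - F (\<lambda>t. neg_part u t + neg_part v t)"
  proof (rule extension_eq_diff)
    have "u t + v t = (pos_part u t - neg_part u t) + (pos_part v t - neg_part v t)" for t
      by (simp only: pos_part_minus_neg_part)
    then show "AE t in halfline. u t + v t = pos_part u t + pos_part v t - (neg_part u t + neg_part v t)"
      by (simp add: algebra_simps)
  qed (use u v p in \<open>auto intro!: Lp_plus_add Lp_add\<close>)
  then show ?thesis using u v by (simp add: add extension_def algebra_simps)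
qed

lemma extension_scaleR:
  assumes u: "u \<in> Lp p"
  shows "extension (\<lambda>t. c *\<^sub>R u t) = c *\<^sub>R extension u"
proof (cases "0 \<le> c")
  case True
  have "extension (\<lambda>t. c *\<^sub>R u t) = F (\<lambda>t. c *\<^sub>R pos_part u t) - F (\<lambda>t. c *\<^sub>R neg_part u t)"
    by (rule extension_eq_diff)
      (use u p True in \<open>auto intro!: Lp_plus_scaleR Lp_scaleR
        simp: pos_part_minus_neg_part simp flip: scaleR_right_diff_distrib\<close>)
  then show ?thesis using u True
    by (simp add: scaleR extension_def scaleR_right_diff_distrib)
next
  case False
  have eq: "c *\<^sub>R u t = (-c) *\<^sub>R neg_part u t - (-c) *\<^sub>R pos_part u t" for t
  proof -
    have "c *\<^sub>R u t = c *\<^sub>R (pos_part u t - neg_part u t)" by (simp only: pos_part_minus_neg_part)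
    then show ?thesis by (simp add: scaleR_right_diff_distrib)
  qed
  have "extension (\<lambda>t. c *\<^sub>R u t) = F (\<lambda>t. (-c) *\<^sub>R neg_part u t) - F (\<lambda>t. (-c) *\<^sub>R pos_part u t)"
  proof (rule extension_eq_diff)
    show "(\<lambda>t. c *\<^sub>R u t) \<in> Lp p" using u p by (simp add: Lp_scaleR)
    show "AE t in halfline. c *\<^sub>R u t = (-c) *\<^sub>R neg_part u t - (-c) *\<^sub>R pos_part u t"
      by (intro AE_I2 eq)
  qed (use u p False in \<open>auto intro!: Lp_plus_scaleR simp del: scaleR_minus_left\<close>)
  also have "\<dots> = (-c) *\<^sub>R F (neg_part u) - (-c) *\<^sub>R F (pos_part u)"
    using u False by (subst (1 2) scaleR) auto
  finally show ?thesis by (simp add: extension_def scaleR_right_diff_distrib)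
qed

lemma extension_diff: "u \<in> Lp p \<Longrightarrow> v \<in> Lp p \<Longrightarrow> extension (\<lambda>t. u t - v t) = extension u - extension v"
  using extension_add[of u "\<lambda>t. (-1) *\<^sub>R v t"] extension_scaleR[of v "-1"] Lp_scaleR[of v p "-1"] p
  by simp

lemma positive_linear_extension: "positive_linear_extension p F extension"
  unfolding positive_linear_extension_def
  by (auto simp: extension_add extension_scaleR extension_eq nonneg intro: extension_cong)

lemma extension_unique:
  assumes G: "positive_linear_extension p F G" and u: "u \<in> Lp p"
  shows "G u = extension u"
proof -
  have L: "pos_part u \<in> Lp p" "neg_part u \<in> Lp p" "(\<lambda>t. (-1) *\<^sub>R neg_part u t) \<in> Lp p"
    using u p by (intro Lp_scaleR Lp_pos_part Lp_neg_part; simp)+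
  have "u = (\<lambda>t. pos_part u t + (-1) *\<^sub>R neg_part u t)"
    by (rule ext) (simp add: pos_part_minus_neg_part)
  then have "G u = G (\<lambda>t. pos_part u t + (-1) *\<^sub>R neg_part u t)" by simp
  also have "\<dots> = G (pos_part u) + (-1) *\<^sub>R G (neg_part u)"
    using G L unfolding positive_linear_extension_def by metis
  also have "\<dots> = extension u"
    using G u unfolding positive_linear_extension_def extension_def by simp
  finally show ?thesis .
qed

lemma extension_bounded:
  assumes p1: "1 \<le> p"
  shows "\<exists>K\<ge>0. \<forall>u\<in>Lp p. norm (extension u) \<le> K * Lp_norm p u"
proof -
  obtain K where K: "0 \<le> K" "\<And>u. u \<in> Lp_plus p \<Longrightarrow> norm (F u) \<le> K * Lp_norm p u"
    using bounded_on_cone[OF p1] by blast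
  have "norm (extension u) \<le> (2 * K) * Lp_norm p u" if u: "u \<in> Lp p" for u
  proof -
    have "Lp_norm p (pos_part u) \<le> Lp_norm p u" "Lp_norm p (neg_part u) \<le> Lp_norm p u"
      using u p by (auto intro!: Lp_norm_mono Lp_pos_part Lp_neg_part norm_pos_part_le norm_neg_part_le)
    from mult_left_mono[OF this(1) K(1)] mult_left_mono[OF this(2) K(1)]
    have "norm (F (pos_part u)) \<le> K * Lp_norm p u" "norm (F (neg_part u)) \<le> K * Lp_norm p u"
      using K(2)[of "pos_part u"] K(2)[of "neg_part u"] u by auto
    then show ?thesis
      unfolding extension_def using norm_triangle_ineq4[of "F (pos_part u)" "F (neg_part u)"] by linarith
  qed
  with K(1) show ?thesis by (intro exI[of _ "2 * K"]) auto
qed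

end

section \<open>Positive semigroups and the extrapolation space\<close>

lemma positive_blinfun_abs_le:
  fixes S :: "'x::banach_lattice \<Rightarrow>\<^sub>L 'y::banach_lattice"
  assumes "\<And>x. 0 \<le> x \<Longrightarrow> 0 \<le> blinfun_apply S x"
  shows "norm (S x) \<le> norm (S \<bar>x\<bar>)"
proof -
  have "0 \<le> S (\<bar>x\<bar> - x)" "0 \<le> S (\<bar>x\<bar> - (- x))"
    by (intro assms; simp only: diff_ge_0_iff_ge abs_ge_self abs_ge_minus_self)+
  then have "\<bar>S x\<bar> \<le> S \<bar>x\<bar>"
    by (intro abs_leI) (simp_all only: blinfun.diff_right blinfun.minus_right diff_ge_0_iff_ge)
  then have "\<bar>S x\<bar> \<le> \<bar>S \<bar>x\<bar>\<bar>" using abs_ge_self order_trans by blast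
  then show ?thesis by (rule norm_mono_abs)
qed

locale positive_C0_semigroup =
  fixes T :: "real \<Rightarrow> 'x::banach_lattice \<Rightarrow>\<^sub>L 'x"
  assumes semigroup: "C0_semigroup T" and positive: "positive_semigroup T"
begin

lemma T_0 [simp]: "T 0 x = x"
  using semigroup by (simp add: C0_semigroup_def)

lemma T_add: "0 \<le> s \<Longrightarrow> 0 \<le> t \<Longrightarrow> T (s + t) x = T s (T t x)"
  using semigroup by (simp add: C0_semigroup_def)

lemma T_nonneg: "0 \<le> t \<Longrightarrow> 0 \<le> x \<Longrightarrow> 0 \<le> T t x"
  using positive by (simp add: positive_semigroup_def)

lemma T_tendsto_0: "((\<lambda>t. T t x) \<longlongrightarrow> x) (at_right 0)"
  using semigroup by (simp add: C0_semigroup_def)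

text \<open>Positivity replaces the uniform boundedness principle: if \<open>\<parallel>T (t n)\<parallel> \<ge> 4\<^sup>n\<close> along a
  sequence \<open>t n \<rightarrow> 0\<close>, then the orbit of a suitable sum of positive vectors is unbounded near 0.\<close>

lemma bounded_near_0: "\<exists>\<delta>>0. \<exists>M. \<forall>t\<in>{0..\<delta>}. \<forall>x. norm (T t x) \<le> M * norm x"
proof (rule ccontr)
  assume *: "\<not> ?thesis"
  have "\<exists>t x. 0 \<le> t \<and> t \<le> 1 / real (Suc n) \<and> 4^n * norm x < norm (T t x)" for n :: nat
  proof (rule ccontr)
    assume "\<not> ?thesis"
    then have "\<forall>t\<in>{0..1 / real (Suc n)}. \<forall>x. norm (T t x) \<le> 4^n * norm x"
      by (auto simp: not_less)
    with * show False by (metis of_nat_0_less_iff zero_less_Suc zero_less_divide_1_iff)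
  qed
  then obtain t x where tx: "\<And>n::nat. 0 \<le> t n" "\<And>n. t n \<le> 1 / real (Suc n)"
    "\<And>n. 4^n * norm (x n) < norm (T (t n) (x n))" by metis
  have x_pos: "0 < norm (x n)" for n using tx(3)[of n] by auto
  have t_pos: "0 < t n" for n
  proof (rule ccontr)
    assume "\<not> 0 < t n"
    with tx(1)[of n] have "t n = 0" by simp
    then have "4^n * norm (x n) < 1 * norm (x n)" using tx(3)[of n] by simp
    moreover have "1 * norm (x n) \<le> 4^n * norm (x n)" by (intro mult_right_mono) auto
    ultimately show False by simp
  qed
  define y where "y n = (1 / norm (x n)) *\<^sub>R \<bar>x n\<bar>" for n
  have y: "0 \<le> y n" "norm (y n) = 1" for n
    using x_pos[of n] by (auto simp: y_def intro!: scaleR_nonneg_nonneg)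
  have Ty: "4^n \<le> norm (T (t n) (y n))" for n
  proof -
    have "4^n * norm (x n) \<le> norm (T (t n) \<bar>x n\<bar>)"
      using tx(3)[of n] positive_blinfun_abs_le[of "T (t n)" "x n", OF T_nonneg[OF tx(1)]] by simp
    then show ?thesis using x_pos[of n] by (simp add: y_def blinfun.scaleR_right field_simps)
  qed
  define z where "z = (\<Sum>n. (1/2)^n *\<^sub>R y n)"
  have sum: "summable (\<lambda>n. (1/2)^n *\<^sub>R y n)"
    by (rule summable_norm_cancel) (simp add: y summable_geometric)
  have yz: "(1/2)^n *\<^sub>R y n \<le> z" for n
    unfolding z_def by (rule suminf_ge_term[OF sum]) (simp add: y scaleR_nonneg_nonneg)
  have "filterlim t (at_right 0) sequentially"
  proof (rule tendsto_imp_filterlim_at_right)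
    show "t \<longlonglongrightarrow> 0"
      by (rule tendsto_sandwich[OF _ _ tendsto_const LIMSEQ_Suc[OF lim_1_over_n]])
         (use tx in auto)
  qed (use t_pos in auto)
  with T_tendsto_0[of z] have "(\<lambda>n. T (t n) z) \<longlonglongrightarrow> z"
    by (rule filterlim_compose)
  then have "Bseq (\<lambda>n. T (t n) z)" by (intro convergent_imp_Bseq convergentI)
  then obtain K where K: "\<And>n. norm (T (t n) z) \<le> K" by (auto simp: Bseq_def)
  have "2^n \<le> K" for n :: nat
  proof -
    have "0 \<le> T (t n) (z - (1/2)^n *\<^sub>R y n)" using yz[of n] by (intro T_nonneg tx(1)) simp
    then have le: "(1/2)^n *\<^sub>R T (t n) (y n) \<le> T (t n) z"
      by (simp add: blinfun.diff_right blinfun.scaleR_right)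
    have "2^n = (1/2)^n * (4^n :: real)" by (simp flip: power_mult_distrib)
    also have "\<dots> \<le> (1/2)^n * norm (T (t n) (y n))" using Ty by (intro mult_left_mono) auto
    also have "\<dots> = norm ((1/2)^n *\<^sub>R T (t n) (y n))" by simp
    also have "\<dots> \<le> norm (T (t n) z)"
      by (rule norm_mono_nonneg[OF _ le]) (intro scaleR_nonneg_nonneg T_nonneg tx y; simp)
    finally show ?thesis using K[of n] by simp
  qed
  moreover obtain n where "K < 2^n" using real_arch_pow[of 2 K] by auto
  ultimately show False by (meson not_le)
qed

lemma locally_bounded: "\<exists>M\<ge>1. \<forall>t\<in>{0..N}. \<forall>x. norm (T t x) \<le> M * norm x"
proof -
  obtain \<delta> M0 where \<delta>: "0 < \<delta>" and M0: "\<And>t x. t \<in> {0..\<delta>} \<Longrightarrow> norm (T t x) \<le> M0 * norm x"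
    using bounded_near_0 by blast
  define M where "M = max 1 M0"
  have M: "norm (T t x) \<le> M * norm x" if "t \<in> {0..\<delta>}" for t x
    by (rule order_trans[OF M0[OF that]]) (simp add: M_def mult_right_mono)
  have *: "\<forall>t\<in>{0..real n * \<delta>}. \<forall>x. norm (T t x) \<le> M ^ n * norm x" for n
  proof (induction n)
    case (Suc n)
    show ?case
    proof (intro ballI allI)
      fix t x assume t: "t \<in> {0..real (Suc n) * \<delta>}"
      define s where "s = min t \<delta>"
      have s: "0 \<le> s" "s \<in> {0..\<delta>}" "t - s \<in> {0..real n * \<delta>}" "0 \<le> t - s"
        using t \<delta> by (auto simp: s_def min_def algebra_simps)
      have "norm (T t x) = norm (T s (T (t - s) x))"
        using T_add[OF s(1,4), of x] by simp
      also have "\<dots> \<le> M * norm (T (t - s) x)" by (rule M[OF s(2)])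
      also have "\<dots> \<le> M * (M ^ n * norm x)"
        using Suc s(3) by (intro mult_left_mono) (auto simp: M_def)
      finally show "norm (T t x) \<le> M ^ Suc n * norm x" by simp
    qed
  qed simp
  obtain n where "N \<le> real n * \<delta>"
    using reals_Archimedean3[OF \<delta>] less_imp_le by blast
  then have "\<forall>t\<in>{0..N}. \<forall>x. norm (T t x) \<le> M ^ n * norm x" using *[of n] by auto
  moreover have "1 \<le> M ^ n" by (simp add: M_def)
  ultimately show ?thesis by blast
qed

text \<open>The increment of \<open>x\<close> over \<open>[u,v]\<close> is \<open>T u (x (v - u))\<close>.  Both the orbits of the semigroup, up to a
  constant, and the responses of a control system to constant inputs are of this form.\<close>

lemma cocycle_continuous:
  fixes x :: "real \<Rightarrow> 'x"
  assumes cocycle: "\<And>s t. 0 \<le> s \<Longrightarrow> 0 \<le> t \<Longrightarrow> x (t + s) = T t (x s) + x t"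
    and lim: "(x \<longlongrightarrow> 0) (at_right 0)"
  shows "continuous_on {0..} x"
  unfolding continuous_on_iff
proof (intro ballI allI impI)
  fix t e :: real assume t: "t \<in> {0..}" and e: "0 < e"
  obtain M where M: "1 \<le> M" "\<And>s y. s \<in> {0..t + 1} \<Longrightarrow> norm (T s y) \<le> M * norm y"
    using locally_bounded[of "t + 1"] by blast
  have "0 < e / M" using e M(1) by simp
  with lim have "\<forall>\<^sub>F h in at_right 0. dist (x h) 0 < e / M" by (rule tendstoD)
  then obtain d where d: "0 < d" "\<And>h. 0 < h \<Longrightarrow> h < d \<Longrightarrow> norm (x h) < e / M"
    unfolding eventually_at_right_field by auto
  have incr: "norm (x v - x u) < e" if "0 \<le> u" "u < v" "v \<le> t + 1" "v - u < d" for u v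
  proof -
    have "norm (x v - x u) \<le> M * norm (x (v - u))"
      using cocycle[of "v - u" u] M(2)[of u "x (v - u)"] that by simp
    also have "\<dots> < M * (e / M)"
      using d(2)[of "v - u"] that M(1) by (intro mult_strict_left_mono) auto
    finally show ?thesis using M(1) by simp
  qed
  have "dist (x s) (x t) < e" if s: "s \<in> {0..}" "dist s t < min d 1" for s
    using incr[of t s] incr[of s t] s t e
    by (cases s t rule: linorder_cases) (auto simp: dist_norm norm_minus_commute)
  then show "\<exists>d>0. \<forall>s\<in>{0..}. dist s t < d \<longrightarrow> dist (x s) (x t) < e"
    using d(1) by (intro exI[of _ "min d 1"]) auto
qed

lemma T_continuous: "continuous_on {0..} (\<lambda>t. T t x)"
proof -
  have "continuous_on {0..} (\<lambda>t. T t x - x)"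
  proof (rule cocycle_continuous)
    show "T (t + s) x - x = T t (T s x - x) + (T t x - x)" if "0 \<le> s" "0 \<le> t" for s t
      using that by (simp add: T_add blinfun.diff_right)
    show "((\<lambda>t. T t x - x) \<longlongrightarrow> 0) (at_right 0)"
      using T_tendsto_0 by (simp add: LIM_zero_iff)
  qed
  from continuous_on_add[OF this continuous_on_const[of _ x]] show ?thesis by simp
qed

lemma generator_tendsto:
  assumes "y \<in> generator_dom T"
  shows "((\<lambda>h. (T h y - y) /\<^sub>R h) \<longlongrightarrow> generator T y) (at_right 0)"
  using assms unfolding generator_dom_def generator_def
  by (auto simp: tendsto_Lim trivial_limit_at_right_real)

lemma generator_eqI:
  assumes "((\<lambda>h. (T h y - y) /\<^sub>R h) \<longlongrightarrow> z) (at_right 0)"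
  shows "y \<in> generator_dom T" "generator T y = z"
  using assms unfolding generator_dom_def generator_def
  by (auto intro: tendsto_Lim simp: trivial_limit_at_right_real)

lemma generator_T:
  assumes y: "y \<in> generator_dom T" and t: "0 \<le> t"
  shows "T t y \<in> generator_dom T" "generator T (T t y) = T t (generator T y)"
proof -
  have "((\<lambda>h. T t ((T h y - y) /\<^sub>R h)) \<longlongrightarrow> T t (generator T y)) (at_right 0)"
    by (intro tendsto_intros generator_tendsto y)
  moreover have "\<forall>\<^sub>F h in at_right 0. T t ((T h y - y) /\<^sub>R h) = (T h (T t y) - T t y) /\<^sub>R h"
    using eventually_at_right_less[of 0]
  proof eventually_elim
    case (elim h)
    then have "T t (T h y) = T h (T t y)"
      using T_add[of t h y] T_add[of h t y] t by (simp add: add.commute)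
    then show ?case by (simp add: blinfun.diff_right blinfun.scaleR_right)
  qed
  ultimately have "((\<lambda>h. (T h (T t y) - T t y) /\<^sub>R h) \<longlongrightarrow> T t (generator T y)) (at_right 0)"
    by (rule Lim_transform_eventually)
  from generator_eqI[OF this] show "T t y \<in> generator_dom T" "generator T (T t y) = T t (generator T y)"
    by auto
qed

text \<open>The derivative is two-sided in the interior of the interval.  The difference quotient over
  \<open>[u,v]\<close> is \<open>T u\<close> applied to one at 0, so it is close to \<open>T u (generator T y)\<close> uniformly in \<open>u\<close>; for the
  derivative from the left, strong continuity replaces \<open>T u\<close> by \<open>T t\<close>.\<close>

lemma orbit_derivative:
  assumes y: "y \<in> generator_dom T" and t: "t \<in> {0..N}"
  shows "((\<lambda>t. T t y) has_vector_derivative T t (generator T y)) (at t within {0..N})"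
  unfolding has_vector_derivative_def has_derivative_within_alt
proof (intro conjI allI impI bounded_linear_scaleR_left)
  let ?a = "generator T y"
  fix e :: real assume e: "0 < e"
  obtain M where M: "1 \<le> M" "\<And>s z. s \<in> {0..N} \<Longrightarrow> norm (T s z) \<le> M * norm z"
    using locally_bounded[of N] by blast
  have eM: "0 < e / (2 * M)" using e M(1) by simp
  have "\<forall>\<^sub>F h in at_right 0. dist ((T h y - y) /\<^sub>R h) ?a < e / (2 * M)"
    using generator_tendsto[OF y] eM by (rule tendstoD)
  then obtain d1 where d1: "0 < d1" "\<And>h. 0 < h \<Longrightarrow> h < d1 \<Longrightarrow> dist ((T h y - y) /\<^sub>R h) ?a < e / (2 * M)"
    unfolding eventually_at_right_field by auto
  have "continuous_on {0..N} (\<lambda>s. T s ?a)"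
    using T_continuous by (rule continuous_on_subset) auto
  then obtain d2 where d2: "0 < d2" "\<And>s. s \<in> {0..N} \<Longrightarrow> dist s t < d2 \<Longrightarrow> dist (T s ?a) (T t ?a) < e / 2"
    using t e unfolding continuous_on_iff by (metis half_gt_zero)
  have incr: "norm (T v y - T u y - (v - u) *\<^sub>R T u ?a) \<le> e / 2 * (v - u)"
    if uv: "0 \<le> u" "u \<le> v" "v \<le> N" "v - u < d1" for u v
  proof (cases "u = v")
    case False
    define h where "h = v - u"
    have h: "0 < h" "h < d1" using False uv by (auto simp: h_def)
    have "T v y - T u y - (v - u) *\<^sub>R T u ?a = T u (T h y - y - h *\<^sub>R ?a)"
      using T_add[of u h y] uv h by (simp add: h_def blinfun.diff_right blinfun.scaleR_right)
    also have "norm \<dots> \<le> M * norm (T h y - y - h *\<^sub>R ?a)" using M(2)[of u] uv by simp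
    also have "T h y - y - h *\<^sub>R ?a = h *\<^sub>R ((T h y - y) /\<^sub>R h - ?a)"
      using h by (simp add: scaleR_right_diff_distrib)
    also have "M * norm \<dots> = M * (h * norm ((T h y - y) /\<^sub>R h - ?a))" using h by simp
    also have "\<dots> \<le> M * (h * (e / (2 * M)))"
      using d1(2)[OF h] h M(1) by (intro mult_left_mono) (auto simp: dist_norm less_imp_le)
    also have "\<dots> = e / 2 * (v - u)" using M(1) by (simp add: h_def field_simps)
    finally show ?thesis .
  qed simp
  have "norm (T s y - T t y - (s - t) *\<^sub>R T t ?a) \<le> e * norm (s - t)"
    if s: "s \<in> {0..N}" "norm (s - t) < min d1 d2" for s
  proof (cases "t \<le> s")
    case True
    have "norm (T s y - T t y - (s - t) *\<^sub>R T t ?a) \<le> e / 2 * (s - t)"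
      using incr[of t s] True s t by simp
    also have "\<dots> \<le> e * norm (s - t)" using True e by (intro mult_mono) auto
    finally show ?thesis .
  next
    case False
    have eq: "T s y - T t y - (s - t) *\<^sub>R T t ?a =
      - (T t y - T s y - (t - s) *\<^sub>R T s ?a) - (t - s) *\<^sub>R (T s ?a - T t ?a)"
      by (simp add: algebra_simps)
    have "norm (T t y - T s y - (t - s) *\<^sub>R T s ?a) \<le> e / 2 * (t - s)"
      using incr[of s t] False s t by simp
    moreover have "norm ((t - s) *\<^sub>R (T s ?a - T t ?a)) \<le> (t - s) * (e / 2)"
      using d2(2)[of s] False s by (auto simp: dist_norm intro!: mult_left_mono)
    ultimately have "norm (T s y - T t y - (s - t) *\<^sub>R T t ?a) \<le> e / 2 * (t - s) + (t - s) * (e / 2)"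
      unfolding eq by (intro order_trans[OF norm_triangle_ineq4] add_mono) (simp_all only: norm_minus_cancel)
    also have "\<dots> = e * norm (s - t)" using False by (simp add: field_simps)
    finally show ?thesis .
  qed
  then show "\<exists>d>0. \<forall>s\<in>{0..N}. norm (s - t) < d \<longrightarrow>
     norm (T s y - T t y - (s - t) *\<^sub>R T t ?a) \<le> e * norm (s - t)"
    using d1(1) d2(1) by (intro exI[of _ "min d1 d2"]) auto
qed

end

text \<open>Since the space \<open>'z\<close> is only known through the dense map \<open>J\<close>, every operator on it has to be
  obtained by continuous extension from the range of \<open>J\<close>.\<close>

lemma bounded_linear_extension_of_dense:
  fixes J :: "'x::real_vector \<Rightarrow> 'z::real_normed_vector" and L :: "'x \<Rightarrow> 'y::banach"
  assumes J: "linear J" "closure (range J) = UNIV" and L: "linear L"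
    and bound: "\<And>x. norm (L x) \<le> C * norm (J x)"
  shows "\<exists>E :: 'z \<Rightarrow>\<^sub>L 'y. \<forall>x. E (J x) = L x"
proof -
  interpret J: linear J by fact
  interpret L: linear L by fact
  have "\<exists>X. (\<lambda>n. J (X n)) \<longlonglongrightarrow> z" for z
  proof -
    have "z \<in> closure (range J)" using J(2) by simp
    then obtain Z where Z: "\<forall>n. Z n \<in> range J" "Z \<longlonglongrightarrow> z" unfolding closure_sequential by blast
    have "\<forall>n. \<exists>x. Z n = J x" using Z(1) by blast
    then obtain X where "\<And>n. Z n = J (X n)" by metis
    then have "Z = (\<lambda>n. J (X n))" by blast
    with Z(2) show ?thesis by blast
  qed
  then obtain X where X: "\<And>z. (\<lambda>n. J (X z n)) \<longlonglongrightarrow> z" by metis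
  define e where "e z = lim (\<lambda>n. L (X z n))" for z
  have C_le: "norm (L x) \<le> \<bar>C\<bar> * norm (J x)" for x
    by (rule order_trans[OF bound]) (simp add: mult_right_mono)
  have e: "(\<lambda>n. L (X z n)) \<longlonglongrightarrow> e z" for z
  proof -
    have "Cauchy (\<lambda>n. L (X z n))"
    proof (rule CauchyI)
      fix r :: real assume r: "0 < r"
      have "Cauchy (\<lambda>n. J (X z n))" using X LIMSEQ_imp_Cauchy by blast
      moreover have "0 < r / (\<bar>C\<bar> + 1)" using r by (simp add: add_nonneg_pos)
      ultimately obtain N where N: "\<And>m n. m \<ge> N \<Longrightarrow> n \<ge> N \<Longrightarrow> norm (J (X z m) - J (X z n)) < r / (\<bar>C\<bar> + 1)"
        by (meson CauchyD)
      have "norm (L (X z m) - L (X z n)) < r" if "m \<ge> N" "n \<ge> N" for m n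
      proof -
        have "norm (L (X z m) - L (X z n)) \<le> \<bar>C\<bar> * norm (J (X z m) - J (X z n))"
          using C_le[of "X z m - X z n"] by (simp add: J.diff L.diff)
        also have "\<dots> \<le> \<bar>C\<bar> * (r / (\<bar>C\<bar> + 1))" using N[OF that] by (intro mult_left_mono) auto
        also have "\<dots> < r" using r by (simp add: field_simps add_nonneg_pos)
        finally show ?thesis .
      qed
      then show "\<exists>N. \<forall>m\<ge>N. \<forall>n\<ge>N. norm (L (X z m) - L (X z n)) < r" by blast
    qed
    then show ?thesis unfolding e_def by (simp only: Cauchy_convergent_iff convergent_LIMSEQ_iff)
  qed
  have any: "(\<lambda>n. L (x n)) \<longlonglongrightarrow> e z" if x: "(\<lambda>n. J (x n)) \<longlonglongrightarrow> z" for x z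
  proof -
    have "(\<lambda>n. \<bar>C\<bar> * norm (J (x n) - J (X z n))) \<longlonglongrightarrow> \<bar>C\<bar> * norm (z - z)"
      by (intro tendsto_intros x X)
    then have "(\<lambda>n. \<bar>C\<bar> * norm (J (x n) - J (X z n))) \<longlonglongrightarrow> 0" by simp
    then have "(\<lambda>n. L (x n) - L (X z n)) \<longlonglongrightarrow> 0"
      by (rule tendsto_0_le[where K=1])
         (use C_le[of "x n - X z n" for n] in \<open>simp add: J.diff L.diff\<close>)
    from tendsto_add[OF this e[of z]] show ?thesis by simp
  qed
  have "bounded_linear e"
  proof (rule bounded_linear_intro)
    fix a b :: 'z and r :: real
    have "(\<lambda>n. J (X a n + X b n)) \<longlonglongrightarrow> a + b"
      unfolding J.add by (intro tendsto_intros X)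
    from any[OF this] have "(\<lambda>n. L (X a n) + L (X b n)) \<longlonglongrightarrow> e (a + b)" by (simp add: L.add)
    from LIMSEQ_unique[OF this tendsto_add[OF e e]] show "e (a + b) = e a + e b" .
    have "(\<lambda>n. J (r *\<^sub>R X a n)) \<longlonglongrightarrow> r *\<^sub>R a"
      unfolding J.scale by (intro tendsto_intros X)
    from any[OF this] have "(\<lambda>n. r *\<^sub>R L (X a n)) \<longlonglongrightarrow> e (r *\<^sub>R a)" by (simp add: L.scale)
    from LIMSEQ_unique[OF this tendsto_scaleR[OF tendsto_const e]] show "e (r *\<^sub>R a) = r *\<^sub>R e a" .
    have "(\<lambda>n. \<bar>C\<bar> * norm (J (X a n))) \<longlonglongrightarrow> \<bar>C\<bar> * norm a"
      by (intro tendsto_intros X)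
    from LIMSEQ_le[OF tendsto_norm[OF e] this] C_le show "norm (e a) \<le> norm a * \<bar>C\<bar>"
      by (auto simp: mult.commute)
  qed
  moreover have "e (J x) = L x" for x
    using any[of "\<lambda>_. x"] LIMSEQ_unique by (metis tendsto_const)
  ultimately show ?thesis
    by (intro exI[of _ "Blinfun e"]) (simp add: bounded_linear_Blinfun_apply)
qed


locale extrapolation = positive_C0_semigroup T
  for T :: "real \<Rightarrow> 'x::banach_lattice \<Rightarrow>\<^sub>L 'x" +
  fixes \<mu> :: real and J :: "'x \<Rightarrow> 'z::banach"
  assumes resolvent_set: "\<mu> \<in> resolvent_set T"
    and extrapolation_space: "extrapolation_space T \<mu> J"
begin

abbreviation "R \<equiv> resolvent T \<mu>"

lemma bij_resolvent: "bij_betw (\<lambda>x. \<mu> *\<^sub>R x - generator T x) (generator_dom T) UNIV"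
  and bounded_linear_R: "bounded_linear R"
  using resolvent_set by (auto simp: resolvent_set_def)

lemma R_dom: "R x \<in> generator_dom T" and generator_R: "generator T (R x) = \<mu> *\<^sub>R R x - x"
proof -
  have x: "x \<in> (\<lambda>x. \<mu> *\<^sub>R x - generator T x) ` generator_dom T"
    using bij_resolvent by (simp add: bij_betw_def)
  show "R x \<in> generator_dom T" unfolding resolvent_def by (rule inv_into_into[OF x])
  have "\<mu> *\<^sub>R R x - generator T (R x) = x" unfolding resolvent_def by (rule f_inv_into_f[OF x])
  then show "generator T (R x) = \<mu> *\<^sub>R R x - x" by (simp add: algebra_simps)
qed

lemma R_eqI:
  assumes "y \<in> generator_dom T" "\<mu> *\<^sub>R y - generator T y = x"
  shows "R x = y"
  using inv_into_f_f[OF bij_betw_imp_inj_on[OF bij_resolvent] assms(1)] assms(2)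
  by (simp add: resolvent_def)

lemma R_T:
  assumes t: "0 \<le> t"
  shows "R (T t x) = T t (R x)"
  by (rule R_eqI)
     (simp_all add: generator_T R_dom t generator_R blinfun.diff_right blinfun.scaleR_right)

lemma linear_J: "linear J" and norm_J: "norm (J x) = norm (R x)" and J_dense: "closure (range J) = UNIV"
  using extrapolation_space by (simp_all add: extrapolation_space_def)

lemma bounded_linear_J: "bounded_linear J"
proof -
  interpret R: bounded_linear R by (rule bounded_linear_R)
  obtain K where "\<And>x. norm (R x) \<le> norm x * K" using R.bounded by blast
  then show ?thesis using linear_J norm_J
    by (auto simp: bounded_linear_def bounded_linear_axioms_def)
qed

lemma J_dense_induct:
  assumes "closed {z. P z}" "\<And>x. P (J x)"
  shows "P z"
proof -
  have "closure (range J) \<subseteq> {z. P z}" using assms by (intro closure_minimal) auto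
  then show ?thesis using J_dense by auto
qed

text \<open>The continuous extension of the resolvent to the extrapolation space.  It is an isometry
  that intertwines the extrapolated semigroup with the original one.\<close>

definition Q :: "'z \<Rightarrow>\<^sub>L 'x" where
  "Q = (SOME E. \<forall>x. blinfun_apply E (J x) = R x)"

lemma Q_J [simp]: "Q (J x) = R x"
proof -
  have "\<exists>E. \<forall>x. blinfun_apply E (J x) = R x"
    by (rule bounded_linear_extension_of_dense[OF linear_J J_dense, of _ 1])
       (use bounded_linear_R norm_J in \<open>auto simp: bounded_linear.linear\<close>)
  from someI_ex[OF this] show ?thesis unfolding Q_def by blast
qed

lemma norm_Q [simp]: "norm (Q z) = norm z"
proof (rule J_dense_induct)
  show "closed {z. norm (Q z) = norm z}" by (intro closed_Collect_eq continuous_intros)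
qed (simp add: norm_J)

lemma Q_inject: "Q z = Q z' \<longleftrightarrow> z = z'"
  using norm_Q[of "z - z'"] by (auto simp: blinfun.diff_right)

lemma closed_range_Q: "closed (range Q)"
proof (rule complete_imp_closed)
  show "complete (range Q)"
    by (rule complete_isometric_image[of 1])
       (auto simp: complete_UNIV blinfun.bounded_linear_right)
qed

abbreviation "TZ t \<equiv> extrapolated J (T t)"

text \<open>The map \<open>J x \<mapsto> J (T t x)\<close> is bounded on the range of \<open>J\<close> because \<open>T t\<close> commutes with the
  resolvent, and density makes its extension unique.\<close>

lemma TZ_J:
  assumes t: "0 \<le> t"
  shows "TZ t (J x) = J (T t x)"
proof -
  have "norm (J (T t x)) \<le> norm (T t) * norm (J x)" for x
    using norm_blinfun[of "T t" "R x"] by (simp add: norm_J R_T t)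
  moreover have "linear (\<lambda>x. J (T t x))"
    using linear_compose[OF bounded_linear.linear[OF blinfun.bounded_linear_right[of "T t"]] linear_J]
    by (simp add: o_def)
  ultimately obtain S where S: "\<forall>x. blinfun_apply S (J x) = J (T t x)"
    using bounded_linear_extension_of_dense[OF linear_J J_dense, of "\<lambda>x. J (T t x)" "norm (T t)"] by blast
  have "TZ t = S"
    unfolding extrapolated_def
  proof (rule the_equality)
    fix S' assume S': "\<forall>x. blinfun_apply S' (J x) = J (T t x)"
    have "blinfun_apply S' z = blinfun_apply S z" for z
      by (rule J_dense_induct) (use S S' in \<open>auto intro!: closed_Collect_eq continuous_intros\<close>)
    then show "S' = S" by (simp add: blinfun_eqI)
  qed (rule S)
  with S show ?thesis by simp
qed

lemma Q_TZ:
  assumes "0 \<le> t"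
  shows "Q (TZ t z) = T t (Q z)"
proof (rule J_dense_induct)
  show "closed {z. Q (TZ t z) = T t (Q z)}" by (intro closed_Collect_eq continuous_intros)
qed (simp add: assms TZ_J R_T)

lemma TZ_continuous: "continuous_on {0..} (\<lambda>t. TZ t z)"
  unfolding continuous_on_iff
proof (intro ballI allI impI)
  fix t e :: real assume "t \<in> {0..}" "0 < e"
  then obtain d where d: "0 < d" "\<And>s. s \<in> {0..} \<Longrightarrow> dist s t < d \<Longrightarrow> dist (T s (Q z)) (T t (Q z)) < e"
    using T_continuous[of "Q z"] unfolding continuous_on_iff by blast
  have "dist (TZ s z) (TZ t z) = dist (T s (Q z)) (T t (Q z))" if "s \<in> {0..}" for s
    using norm_Q[of "TZ s z - TZ t z"] that \<open>t \<in> {0..}\<close>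
    by (simp add: dist_norm blinfun.diff_right Q_TZ)
  with d show "\<exists>d>0. \<forall>s\<in>{0..}. dist s t < d \<longrightarrow> dist (TZ s z) (TZ t z) < e" by auto
qed

lemma TZ_0 [simp]: "TZ 0 z = z"
  using Q_TZ[of 0 z] by (simp add: Q_inject)

text \<open>A continuous solution of the equation \<open>x (t + s) = T t (x s) + x t\<close> becomes differentiable
  in the extrapolation space.  With \<open>w = (\<integral>s\<in>{0..1}. x s)\<close>, integrating the equation over \<open>s\<close>
  gives \<open>x t = (\<integral>s\<in>{t..t+1}. x s) - T t w\<close>.  The first term is differentiable in \<open>X\<close>, the second
  one after an application of the resolvent.\<close>

lemma cocycle_resolvent_derivative:
  fixes x :: "real \<Rightarrow> 'x"
  assumes cocycle: "\<And>s t. 0 \<le> s \<Longrightarrow> 0 \<le> t \<Longrightarrow> x (t + s) = T t (x s) + x t"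
    and cont: "continuous_on {0..} x" and t: "t \<in> {0..N}"
  defines "w \<equiv> integral {0..1} x"
  shows "((\<lambda>t. R (x t)) has_vector_derivative T t (R (x 1) - \<mu> *\<^sub>R R w + w)) (at t within {0..N})"
proof -
  interpret R: bounded_linear R by (rule bounded_linear_R)
  have cont_Icc: "continuous_on {a..b} x" if "0 \<le> a" for a b
    using cont by (rule continuous_on_subset) (use that in auto)
  have cont_shift: "continuous_on {0..b} (\<lambda>s. x (s + 1))" for b
    by (rule continuous_on_compose2[OF cont]) (auto intro!: continuous_intros)
  have x_int: "(x has_integral integral {a..b} x) {a..b}" if "0 \<le> a" for a b
    by (intro integrable_integral integrable_continuous_real cont_Icc that)
  define X where "X t = integral {0..t} x" for t
  define Y where "Y t = integral {0..t} (\<lambda>s. x (s + 1))" for t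
  have x_eq: "x s = w + Y s - X s - T s w" if s: "0 \<le> s" for s
  proof -
    have "((\<lambda>r. T s (x r)) has_integral T s w) {0..1}"
      unfolding w_def using has_integral_linear[OF x_int blinfun.bounded_linear_right[of "T s"], of 0 1]
      by (simp add: o_def)
    moreover have "((\<lambda>r. x s) has_integral x s) {0..1::real}"
      using has_integral_const_real[of "x s" 0 1] by simp
    ultimately have "((\<lambda>r. T s (x r) + x s) has_integral T s w + x s) {0..1}"
      by (rule has_integral_add)
    then have "((\<lambda>r. x (s + r)) has_integral T s w + x s) {0..1}"
      by (rule has_integral_eq[rotated]) (use cocycle s in auto)
    then have 1: "(x has_integral T s w + x s) {s..s + 1}"
      using has_integral_shift_Icc_real[of x s "T s w + x s" 0 1] by (simp add: o_def add.commute)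
    have "((\<lambda>r. x (r + 1)) has_integral Y s) {0..s}"
      unfolding Y_def by (intro integrable_integral integrable_continuous_real cont_shift)
    then have 2: "(x has_integral Y s) {1..s + 1}"
      using has_integral_shift_Icc_real[of x 1 "Y s" 0 s] by (simp add: o_def add.commute)
    have "(x has_integral X s + (T s w + x s)) {0..s + 1}"
      unfolding X_def by (rule has_integral_combine[OF _ _ x_int 1]) (use s in auto)
    moreover have "(x has_integral w + Y s) {0..s + 1}"
      unfolding w_def by (rule has_integral_combine[OF _ _ x_int 2]) (use s in auto)
    ultimately have "X s + (T s w + x s) = w + Y s" by (rule has_integral_unique)
    then show ?thesis by (simp add: algebra_simps)
  qed
  have dX: "(X has_vector_derivative x t) (at t within {0..N})"
    unfolding X_def[abs_def] by (rule integral_has_vector_derivative[OF cont_Icc t]) simp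
  have dY: "(Y has_vector_derivative x (t + 1)) (at t within {0..N})"
    unfolding Y_def[abs_def] by (rule integral_has_vector_derivative[OF cont_shift t])
  have "((\<lambda>s. R w + R (Y s) - R (X s) - T s (R w)) has_vector_derivative
      0 + R (x (t + 1)) - R (x t) - T t (generator T (R w))) (at t within {0..N})"
    by (intro derivative_intros R.has_vector_derivative dX dY orbit_derivative R_dom t)
  also have "0 + R (x (t + 1)) - R (x t) - T t (generator T (R w)) = T t (R (x 1) - \<mu> *\<^sub>R R w + w)"
    using cocycle[of 1 t] t
    by (simp add: R.add R_T generator_R blinfun.diff_right blinfun.add_right algebra_simps)
  finally show ?thesis
  proof (rule has_vector_derivative_transform[rotated 2])
    fix s assume "s \<in> {0..N}"
    then have "R (x s) = R (w + Y s - X s - T s w)" using x_eq[of s] by simp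
    also have "\<dots> = R w + R (Y s) - R (X s) - T s (R w)"
      using \<open>s \<in> {0..N}\<close> by (simp add: R.add R.diff R_T)
    finally show "R (x s) = R w + R (Y s) - R (X s) - T s (R w)" .
  qed (rule t)
qed

text \<open>The derivative of \<open>R (x t)\<close> at 0 is a limit of values of the resolvent, hence it lies in the
  closed range of the isometry \<open>Q\<close>, and \<open>Q\<close> carries the whole statement over to the extrapolation space.
  The last part, a limit of images of multiples of \<open>x\<close>, makes the derivative positive when \<open>x\<close> is.\<close>

lemma cocycle_derivative:
  fixes x :: "real \<Rightarrow> 'x"
  assumes cocycle: "\<And>s t. 0 \<le> s \<Longrightarrow> 0 \<le> t \<Longrightarrow> x (t + s) = T t (x s) + x t"
    and cont: "continuous_on {0..} x"
  defines "w \<equiv> integral {0..1} x"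
  shows "\<exists>c. Q c = R (x 1) - \<mu> *\<^sub>R R w + w \<and>
     (\<forall>N. \<forall>t\<in>{0..N}. ((\<lambda>t. J (x t)) has_vector_derivative TZ t c) (at t within {0..N})) \<and>
     (\<lambda>n. J (real (Suc n) *\<^sub>R x (1 / real (Suc n)))) \<longlonglongrightarrow> c"
proof -
  interpret R: bounded_linear R by (rule bounded_linear_R)
  interpret J: bounded_linear J by (rule bounded_linear_J)
  define b where "b = R (x 1) - \<mu> *\<^sub>R R w + w"
  have deriv: "((\<lambda>t. R (x t)) has_vector_derivative T t b) (at t within {0..N})" if "t \<in> {0..N}" for t N
    unfolding b_def w_def by (rule cocycle_resolvent_derivative[OF cocycle cont that])
  have x0: "x 0 = 0" using cocycle[of 0 0] by simp
  have lim: "(\<lambda>n. R (real (Suc n) *\<^sub>R x (1 / real (Suc n)))) \<longlonglongrightarrow> b"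
  proof -
    have "((\<lambda>y. (1 / norm (y - 0)) *\<^sub>R (R (x y) - (R (x 0) + (y - 0) *\<^sub>R b))) \<longlongrightarrow> 0) (at 0 within {0..1})"
      using deriv[of 0 1] by (simp add: has_vector_derivative_def has_derivative_within)
    moreover have "filterlim (\<lambda>n. 1 / real (Suc n)) (at 0 within {0..1}) sequentially"
      unfolding filterlim_at using LIMSEQ_Suc[OF lim_1_over_n] by auto
    ultimately have "(\<lambda>n. (1 / norm (1 / real (Suc n) - 0)) *\<^sub>R
        (R (x (1 / real (Suc n))) - (R (x 0) + (1 / real (Suc n) - 0) *\<^sub>R b))) \<longlonglongrightarrow> 0"
      by (rule filterlim_compose)
    then have "(\<lambda>n. R (real (Suc n) *\<^sub>R x (1 / real (Suc n))) - b) \<longlonglongrightarrow> 0"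
      by (simp add: x0 R.zero R.scaleR scaleR_right_diff_distrib del: of_nat_Suc)
    then show ?thesis by (simp add: LIM_zero_iff)
  qed
  have "b \<in> range Q"
  proof (rule closed_sequentially[OF closed_range_Q _ lim])
    show "R (real (Suc n) *\<^sub>R x (1 / real (Suc n))) \<in> range Q" for n
      by (metis Q_J rangeI)
  qed
  then obtain c where c: "Q c = b" by auto
  have "((\<lambda>t. J (x t)) has_vector_derivative TZ t c) (at t within {0..N})" if t: "t \<in> {0..N}" for t N
    unfolding has_vector_derivative_def has_derivative_within_alt
  proof (intro conjI allI impI bounded_linear_scaleR_left)
    fix e :: real assume "0 < e"
    with deriv[OF t] obtain d where d: "0 < d" "\<And>s. s \<in> {0..N} \<Longrightarrow> norm (s - t) < d \<Longrightarrow>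
        norm (R (x s) - R (x t) - (s - t) *\<^sub>R T t b) \<le> e * norm (s - t)"
      unfolding has_vector_derivative_def has_derivative_within_alt by blast
    have "norm (J (x s) - J (x t) - (s - t) *\<^sub>R TZ t c) = norm (R (x s) - R (x t) - (s - t) *\<^sub>R T t b)" for s
      using norm_Q[of "J (x s) - J (x t) - (s - t) *\<^sub>R TZ t c"] t
      by (simp add: blinfun.diff_right blinfun.scaleR_right Q_TZ c)
    with d show "\<exists>d>0. \<forall>s\<in>{0..N}. norm (s - t) < d \<longrightarrow>
        norm (J (x s) - J (x t) - (s - t) *\<^sub>R TZ t c) \<le> e * norm (s - t)" by auto
  qed
  moreover have "(\<lambda>n. J (real (Suc n) *\<^sub>R x (1 / real (Suc n)))) \<longlonglongrightarrow> c"
  proof -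
    have "norm (J (real (Suc n) *\<^sub>R x (1 / real (Suc n))) - c) =
        norm (R (real (Suc n) *\<^sub>R x (1 / real (Suc n))) - b)" for n
      using norm_Q[of "J (real (Suc n) *\<^sub>R x (1 / real (Suc n))) - c"]
      by (simp only: blinfun.diff_right Q_J c)
    moreover have "(\<lambda>n. norm (R (real (Suc n) *\<^sub>R x (1 / real (Suc n))) - b)) \<longlonglongrightarrow> 0"
      using lim by (intro tendsto_norm_zero LIM_zero)
    ultimately have "(\<lambda>n. norm (J (real (Suc n) *\<^sub>R x (1 / real (Suc n))) - c)) \<longlonglongrightarrow> 0"
      by simp
    then show ?thesis by (rule LIM_zero_cancel[OF tendsto_norm_zero_cancel])
  qed
  ultimately show ?thesis using c unfolding b_def by blast
qed

end

section \<open>Shifts, restrictions and approximation in \<open>L\<^sup>p\<close>\<close>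

lemma simple_function_restrict_mono:
  assumes s: "simple_function (lebesgue_on S) f" and AS: "A \<subseteq> S" "A \<in> sets lebesgue" "S \<in> sets lebesgue"
  shows "simple_function (lebesgue_on A) f"
proof -
  have "f -` {f x} \<inter> A \<in> sets (lebesgue_on A)" if "x \<in> A" for x
  proof -
    have "f -` {f x} \<inter> S \<in> sets lebesgue"
      using s AS that unfolding simple_function_def by (auto simp: sets_restrict_space_iff)
    then have "(f -` {f x} \<inter> S) \<inter> A \<in> sets lebesgue" using AS by blast
    moreover have "(f -` {f x} \<inter> S) \<inter> A = f -` {f x} \<inter> A" using AS by auto
    ultimately show ?thesis using AS by (simp add: sets_restrict_space_iff)
  qed
  moreover have "finite (f ` A)"
    using s AS by (auto simp: simple_function_def intro: finite_subset[OF image_mono])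
  ultimately show ?thesis by (auto simp: simple_function_def)
qed

lemma AE_lebesgue_on_mono:
  assumes "AE x in lebesgue_on S. P x" "A \<subseteq> S" "A \<in> sets lebesgue" "S \<in> sets lebesgue"
  shows "AE x in lebesgue_on A. P x"
  using assms by (auto simp: AE_restrict_space_iff)

lemma strongly_measurable_restrict_mono:
  assumes f: "strongly_measurable (lebesgue_on S) f" and AS: "A \<subseteq> S" "A \<in> sets lebesgue" "S \<in> sets lebesgue"
  shows "strongly_measurable (lebesgue_on A) f"
proof -
  obtain s where s: "\<And>n::nat. simple_function (lebesgue_on S) (s n)"
    "AE x in lebesgue_on S. (\<lambda>n. s n x) \<longlonglongrightarrow> f x"
    using f unfolding strongly_measurable_def by blast
  show ?thesis unfolding strongly_measurable_def
    using simple_function_restrict_mono[OF s(1) AS] AE_lebesgue_on_mono[OF s(2) AS] by blast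
qed

lemma Lp_locally_integrable:
  assumes u: "u \<in> Lp p" and p: "1 \<le> p"
  shows "integrable (lebesgue_on {0..t}) (\<lambda>s. norm (u s))"
proof -
  interpret I: complete_measure "lebesgue_on {0..t}" by (rule complete_measure_lebesgue_on) simp
  have "integrable (lebesgue_on {0..}) (\<lambda>s. norm (u s) powr p)"
    using u by (simp add: Lp_def)
  then have "integrable lebesgue (\<lambda>s. indicator {0..} s *\<^sub>R (norm (u s) powr p))"
    by (subst (asm) integrable_restrict_space) auto
  then have "integrable lebesgue (\<lambda>s. indicator {0..t} s *\<^sub>R (indicator {0..} s *\<^sub>R (norm (u s) powr p)))"
    by (rule integrable_mult_indicator[rotated]) simp
  then have "integrable lebesgue (\<lambda>s. indicator {0..t} s *\<^sub>R (norm (u s) powr p))"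
    by (rule Bochner_Integration.integrable_cong[THEN iffD1, rotated 2]) (auto split: split_indicator)
  then have "integrable (lebesgue_on {0..t}) (\<lambda>s. norm (u s) powr p)"
    by (subst integrable_restrict_space) auto
  moreover have "integrable (lebesgue_on {0..t}) (\<lambda>s. 1::real)"
    by (subst integrable_restrict_space)
      (auto intro!: integrable_real_indicator simp: emeasure_lborel_Icc_eq)
  ultimately have int: "integrable (lebesgue_on {0..t}) (\<lambda>s. 1 + norm (u s) powr p)" by simp
  show ?thesis
  proof (rule Bochner_Integration.integrable_bound[OF int])
    show "(\<lambda>s. norm (u s)) \<in> borel_measurable (lebesgue_on {0..t})"
      by (intro I.borel_measurable_norm_strongly_measurable
          strongly_measurable_restrict_mono[OF Lp_strongly_measurable[OF u]]) auto
    have "norm (u s) \<le> 1 + norm (u s) powr p" for s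
    proof (cases "norm (u s) \<le> 1")
      case False
      then have "norm (u s) powr 1 \<le> norm (u s) powr p" using p by (intro powr_mono) auto
      then show ?thesis using False by simp
    qed (simp add: add_increasing2)
    then show "AE s in lebesgue_on {0..t}. norm (norm (u s)) \<le> norm (1 + norm (u s) powr p)"
      by (intro AE_I2) (simp add: order_trans[OF _ abs_ge_self])
  qed
qed

lemma distr_lebesgue_plus: "distr lebesgue lebesgue ((+) t) = lebesgue"
  and measurable_lebesgue_plus: "(+) (t::real) \<in> lebesgue \<rightarrow>\<^sub>M lebesgue"
  using lebesgue_real_affine[of 1 t] lebesgue_affine_measurable[of "\<lambda>_. 1" t]
  by (simp_all add: density_1 one_ennreal_def[symmetric])

text \<open>On \<open>[0,\<infinity>)\<close> the shifted function takes the values of \<open>u\<close> on \<open>[t,\<infinity>)\<close>.  Measurability, null sets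
  and integrals are carried over by the translation invariance of Lebesgue measure on the whole line.\<close>

lemma Lp_left_shift:
  assumes u: "u \<in> Lp p" and t: "0 \<le> t"
  shows "left_shift t u \<in> Lp p"
proof -
  have AE_shift: "AE r in halfline. P (r + t)" if "AE r in halfline. P r" for P
  proof -
    have "AE r in distr lebesgue lebesgue ((+) t). 0 \<le> r \<longrightarrow> P r"
      unfolding distr_lebesgue_plus using that by (simp add: AE_restrict_space_iff)
    from AE_distrD[OF measurable_lebesgue_plus this]
    have "AE r in lebesgue. r \<in> {0..} \<longrightarrow> P (r + t)"
      by eventually_elim (use t in \<open>auto simp: add.commute\<close>)
    then show ?thesis by (simp add: AE_restrict_space_iff)
  qed
  have simple_shift: "simple_function halfline (\<lambda>r. f (r + t))" if f: "simple_function halfline f" for f :: "real \<Rightarrow> 'c"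
  proof -
    have "(\<lambda>r. f (r + t)) -` {f (x + t)} \<inter> {0..} \<in> sets halfline" if x: "x \<in> {0..}" for x
    proof -
      have "f -` {f (x + t)} \<inter> {0..} \<in> sets lebesgue"
        using f x t unfolding simple_function_def by (auto simp: sets_restrict_space_iff)
      then have "(+) t -` (f -` {f (x + t)} \<inter> {0..}) \<inter> space lebesgue \<in> sets lebesgue"
        by (rule measurable_sets[OF measurable_lebesgue_plus])
      then have "((+) t -` (f -` {f (x + t)} \<inter> {0..}) \<inter> space lebesgue) \<inter> {0..} \<in> sets lebesgue"
        by (rule sets.Int) simp
      moreover have "((+) t -` (f -` {f (x + t)} \<inter> {0..}) \<inter> space lebesgue) \<inter> {0..} =
          (\<lambda>r. f (r + t)) -` {f (x + t)} \<inter> {0..}"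
        using t by (auto simp: add.commute)
      ultimately show ?thesis by (simp add: sets_restrict_space_iff)
    qed
    moreover have "finite ((\<lambda>r. f (r + t)) ` {0..})"
      by (rule finite_subset[of _ "f ` {0..}"]) (use f t in \<open>auto simp: simple_function_def\<close>)
    ultimately show ?thesis by (auto simp: simple_function_def)
  qed
  obtain s where s: "\<And>n::nat. simple_function halfline (s n)" "AE r in halfline. (\<lambda>n. s n r) \<longlonglongrightarrow> u r"
    using Lp_strongly_measurable[OF u] unfolding strongly_measurable_def by blast
  have sm: "strongly_measurable halfline (left_shift t u)"
    unfolding strongly_measurable_def left_shift_def
    using simple_shift[OF s(1)] AE_shift[OF s(2)]
    by (intro exI[of _ "\<lambda>n r. s n (r + t)"]) blast
  have "integrable lebesgue (\<lambda>r. indicator {0..} r *\<^sub>R (norm (u r) powr p))"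
    using u by (simp add: Lp_def integrable_restrict_space)
  then have "integrable (distr lebesgue lebesgue ((+) t)) (\<lambda>r. indicator {0..} r *\<^sub>R (norm (u r) powr p))"
    unfolding distr_lebesgue_plus .
  from integrable_distr[OF measurable_lebesgue_plus this]
  have "integrable lebesgue (\<lambda>r. indicator {0..} r *\<^sub>R
      (indicator {0..} (t + r) *\<^sub>R (norm (u (t + r)) powr p)))"
    by (rule integrable_mult_indicator[rotated]) simp
  then have "integrable halfline (\<lambda>r. indicator {0..} (t + r) *\<^sub>R (norm (u (t + r)) powr p))"
    by (simp add: integrable_restrict_space)
  then show ?thesis
    by (rule Lp_dominated[OF sm]) (use t in \<open>auto simp: left_shift_def add.commute intro!: AE_I2\<close>)
qed

lemma halfline_interval:
  assumes "0 \<le> a" "a \<le> b"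
  shows "{a..<b} \<in> sets halfline" "emeasure halfline {a..<b} < \<infinity>" "measure halfline {a..<b} = b - a"
proof -
  show "{a..<b} \<in> sets halfline" using assms by (auto simp: sets_restrict_space_iff)
  have "emeasure halfline {a..<b} = ennreal (b - a)"
    using assms by (subst emeasure_restrict_space) auto
  then show "emeasure halfline {a..<b} < \<infinity>" "measure halfline {a..<b} = b - a"
    using assms by (simp_all add: measure_def)
qed

text \<open>A class of inputs that contains the step functions on \<open>[0,t)\<close> and is closed under sums,
  differences and dominated limits contains every \<open>L\<^sup>p\<close> function on \<open>[0,t)\<close>: the
  measurable sets whose indicators are in the class form a Dynkin system that contains the
  intersection stable generator \<open>{[0,a)}\<close> of the Borel sets.\<close>

lemma Lp_truncation_induct:
  fixes P :: "(real \<Rightarrow> 'u::real_normed_vector) \<Rightarrow> bool"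
  assumes p: "0 < p" and t: "0 \<le> t" and u: "u \<in> Lp p"
    and cong: "\<And>u v. P u \<Longrightarrow> ae_eq u v \<Longrightarrow> P v"
    and step: "\<And>v a. 0 \<le> a \<Longrightarrow> a \<le> t \<Longrightarrow> P (\<lambda>r. indicator {0..<a} r *\<^sub>R v)"
    and add: "\<And>u v. P u \<Longrightarrow> P v \<Longrightarrow> P (\<lambda>r. u r + v r)"
    and diff: "\<And>u v. P u \<Longrightarrow> P v \<Longrightarrow> P (\<lambda>r. u r - v r)"
    and lim: "\<And>u v (g :: real \<Rightarrow> 'u). (\<And>n. P (u n)) \<Longrightarrow> AE r in halfline. (\<lambda>n. u n r) \<longlonglongrightarrow> v r \<Longrightarrow> g \<in> Lp p \<Longrightarrow>
      (\<And>n::nat. AE r in halfline. norm (u n r) \<le> norm (g r)) \<Longrightarrow> P v"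
  shows "P (truncation t u)"
proof -
  have zero: "P (\<lambda>r. 0)" using step[of 0 0] t by simp
  have sum: "P (\<lambda>r. \<Sum>i\<in>I. w i r)" if "finite I" "\<And>i. i \<in> I \<Longrightarrow> P (w i)"
    for I :: "'i set" and w :: "'i \<Rightarrow> real \<Rightarrow> 'u"
    using that by (induction I rule: finite_induct) (auto intro: zero add)
  have step_Lp: "(\<lambda>r. indicator {0..<t} r *\<^sub>R v) \<in> Lp p" for v :: 'u
    using Lp_indicator[OF halfline_interval(1,2)[OF order_refl t] p] .
  have borel: "P (\<lambda>r. indicator (E \<inter> {0..<t}) r *\<^sub>R v)" if "E \<in> sets borel" for E :: "real set" and v
  proof -
    have "Int_stable (range (lessThan :: real \<Rightarrow> _))"
      by (auto simp: Int_stable_def greaterThan_Int_greaterThan)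
    moreover have "range (lessThan :: real \<Rightarrow> _) \<subseteq> Pow UNIV" by simp
    moreover have "E \<in> sigma_sets UNIV (range lessThan)" using that by (simp add: borel_Iio)
    ultimately show ?thesis
    proof (induction E rule: sigma_sets_induct_disjoint)
      case (basic E)
      then obtain a where E: "E = {..<a}" by auto
      have "E \<inter> {0..<t} = {0..<max 0 (min a t)}" by (auto simp: E)
      then show ?case using step[of "max 0 (min a t)" v] t by simp
    next
      case empty
      then show ?case using zero by simp
    next
      case (compl E)
      have "(\<lambda>r. indicator ((UNIV - E) \<inter> {0..<t}) r *\<^sub>R v) =
          (\<lambda>r. indicator {0..<t} r *\<^sub>R v - indicator (E \<inter> {0..<t}) r *\<^sub>R v)"
        by (auto split: split_indicator)
      then show ?case using diff[OF step[of t v] compl.IH] t by simp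
    next
      case (union E)
      have eq: "(\<Sum>i<n. indicator (E i \<inter> {0..<t}) r *\<^sub>R v) = indicator ((\<Union>i<n. E i) \<inter> {0..<t}) r *\<^sub>R v" for n r
      proof -
        have "indicator ((\<Union>i<n. E i) \<inter> {0..<t}) r = (\<Sum>i<n. indicator (E i \<inter> {0..<t}) r :: real)"
          using union.hyps(1)
          by (subst indicator_UN_disjoint[symmetric])
             (auto simp: disjoint_family_on_def intro!: arg_cong2[where f=indicator])
        then show ?thesis by (simp add: scaleR_sum_left)
      qed
      show ?case
      proof (rule lim)
        show "(\<lambda>r. indicator {0..<t} r *\<^sub>R v) \<in> Lp p" by (rule step_Lp)
        show "P (\<lambda>r. \<Sum>i<n. indicator (E i \<inter> {0..<t}) r *\<^sub>R v)" for n
          by (intro sum) (auto intro: union.IH)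
        show "AE r in halfline. norm (\<Sum>i<n. indicator (E i \<inter> {0..<t}) r *\<^sub>R v) \<le>
            norm (indicator {0..<t} r *\<^sub>R v)" for n
          unfolding eq by (auto split: split_indicator)
        show "AE r in halfline. (\<lambda>n. \<Sum>i<n. indicator (E i \<inter> {0..<t}) r *\<^sub>R v) \<longlonglongrightarrow>
            indicator (\<Union> (range E) \<inter> {0..<t}) r *\<^sub>R v"
          unfolding eq
        proof (intro AE_I2 tendsto_scaleR tendsto_const)
          fix r :: real
          have "(\<lambda>n. indicator (\<Union>i<n. E i \<inter> {0..<t}) r :: real) \<longlonglongrightarrow> indicator (\<Union>i. E i \<inter> {0..<t}) r"
            by (rule LIMSEQ_indicator_UN)
          then show "(\<lambda>n. indicator ((\<Union>i<n. E i) \<inter> {0..<t}) r :: real) \<longlonglongrightarrow> indicator (\<Union> (range E) \<inter> {0..<t}) r"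
            by (simp only: Int_UN_distrib2[symmetric] UN_extend_simps)
        qed
      qed
    qed
  qed
  have lebesgue: "P (\<lambda>r. indicator (E \<inter> {0..<t}) r *\<^sub>R v)" if "E \<in> sets lebesgue" for E v
  proof (rule cong[OF borel])
    show "main_part lborel E \<in> sets borel" using main_part_sets[OF that] by simp
    have "AE r in lebesgue. r \<in> main_part lborel E \<longleftrightarrow> r \<in> E"
      using AE_completion[OF AE_in_main_part[OF that]] .
    then have "AE r in halfline. r \<in> main_part lborel E \<longleftrightarrow> r \<in> E"
      by (auto simp: AE_restrict_space_iff)
    then show "ae_eq (\<lambda>r. indicator (main_part lborel E \<inter> {0..<t}) r *\<^sub>R v) (\<lambda>r. indicator (E \<inter> {0..<t}) r *\<^sub>R v)"
      unfolding ae_eq_def by eventually_elim (auto split: split_indicator)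
  qed
  have simple: "P (truncation t s)" if s: "simple_function halfline s" for s :: "real \<Rightarrow> 'u"
  proof (rule cong)
    have fin: "finite (s ` {0..})" using s by (simp add: simple_function_def)
    show "P (\<lambda>r. \<Sum>y\<in>s ` {0..}. indicator ((s -` {y} \<inter> {0..}) \<inter> {0..<t}) r *\<^sub>R y)"
    proof (intro sum fin)
      fix y assume "y \<in> s ` {0..}"
      then have "s -` {y} \<inter> {0..} \<in> sets lebesgue"
        using s by (auto simp: simple_function_def sets_restrict_space_iff)
      then show "P (\<lambda>r. indicator ((s -` {y} \<inter> {0..}) \<inter> {0..<t}) r *\<^sub>R y)" by (rule lebesgue)
    qed
    show "ae_eq (\<lambda>r. \<Sum>y\<in>s ` {0..}. indicator ((s -` {y} \<inter> {0..}) \<inter> {0..<t}) r *\<^sub>R y) (truncation t s)"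
      unfolding ae_eq_def
    proof (rule AE_I2)
      fix r assume "r \<in> space halfline"
      then have r: "0 \<le> r" by simp
      have "(\<Sum>y\<in>s ` {0..}. indicator ((s -` {y} \<inter> {0..}) \<inter> {0..<t}) r *\<^sub>R y) =
          (\<Sum>y\<in>s ` {0..}. if y = s r then truncation t s r else 0)"
        using r by (intro sum.cong) (auto simp: truncation_def split: split_indicator)
      also have "\<dots> = truncation t s r" using fin r by simp
      finally show "(\<Sum>y\<in>s ` {0..}. indicator ((s -` {y} \<inter> {0..}) \<inter> {0..<t}) r *\<^sub>R y) = truncation t s r" .
    qed
  qed
  obtain s where s: "\<And>n::nat. simple_function halfline (s n)" "AE r in halfline. (\<lambda>n. s n r) \<longlonglongrightarrow> u r"
    "\<And>n r. norm (s n r) \<le> 2 * norm (u r)"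
    using halfline.strongly_measurable_obtains_dominated[OF Lp_strongly_measurable[OF u]] by blast
  show ?thesis
  proof (rule lim)
    show "P (truncation t (s n))" for n by (rule simple[OF s(1)])
    show "AE r in halfline. (\<lambda>n. truncation t (s n) r) \<longlonglongrightarrow> truncation t u r"
      using s(2) by eventually_elim (auto simp: truncation_def)
    show "(\<lambda>r. 2 *\<^sub>R u r) \<in> Lp p" using u p by (simp add: Lp_scaleR)
    show "AE r in halfline. norm (truncation t (s n) r) \<le> norm (2 *\<^sub>R u r)" for n
      using s(3) by (simp add: truncation_def)
  qed
qed

section \<open>Abstract positive control systems\<close>

locale control_system = positive_C0_semigroup T
  for T :: "real \<Rightarrow> 'x::banach_lattice \<Rightarrow>\<^sub>L 'x" +
  fixes \<Phi> :: "real \<Rightarrow> (real \<Rightarrow> 'u::banach_lattice) \<Rightarrow> 'x" and p :: real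
  assumes p: "1 \<le> p"
    and well_defined: "\<And>\<tau> u v. 0 \<le> \<tau> \<Longrightarrow> u \<in> Lp_plus p \<Longrightarrow> v \<in> Lp_plus p \<Longrightarrow> ae_eq u v \<Longrightarrow>
           \<Phi> \<tau> u = \<Phi> \<tau> v"
    and cone: "\<And>\<tau> u. 0 \<le> \<tau> \<Longrightarrow> u \<in> Lp_plus p \<Longrightarrow> 0 \<le> \<Phi> \<tau> u"
    and additive: "\<And>\<tau> u v. 0 \<le> \<tau> \<Longrightarrow> u \<in> Lp_plus p \<Longrightarrow> v \<in> Lp_plus p \<Longrightarrow>
           \<Phi> \<tau> (\<lambda>t. u t + v t) = \<Phi> \<tau> u + \<Phi> \<tau> v"
    and composition: "\<And>\<tau> t u. 0 \<le> \<tau> \<Longrightarrow> 0 \<le> t \<Longrightarrow> u \<in> Lp_plus p \<Longrightarrow>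
           \<Phi> (\<tau> + t) u = T \<tau> (\<Phi> t (truncation t u)) + \<Phi> \<tau> (left_shift t u)"
begin

lemma p_pos: "0 < p" and p_nonneg: "0 \<le> p"
  using p by auto

lemma positive_additive: "0 \<le> \<tau> \<Longrightarrow> positive_additive p (\<Phi> \<tau>)"
  by unfold_locales (auto simp: p_pos well_defined cone additive)

definition \<Psi> :: "real \<Rightarrow> (real \<Rightarrow> 'u) \<Rightarrow> 'x" where
  "\<Psi> \<tau> = positive_additive.extension (\<Phi> \<tau>)"

lemma \<Psi>_eq_diff: "0 \<le> \<tau> \<Longrightarrow> \<Psi> \<tau> u = \<Phi> \<tau> (pos_part u) - \<Phi> \<tau> (neg_part u)"
  unfolding \<Psi>_def by (rule positive_additive.extension_def[OF positive_additive])

lemmas \<Psi>_add = positive_additive.extension_add[OF positive_additive, folded \<Psi>_def]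
  and \<Psi>_diff = positive_additive.extension_diff[OF positive_additive, folded \<Psi>_def]
  and \<Psi>_scaleR = positive_additive.extension_scaleR[OF positive_additive, folded \<Psi>_def]
  and \<Psi>_cong = positive_additive.extension_cong[OF positive_additive, folded \<Psi>_def]
  and \<Psi>_eq = positive_additive.extension_eq[OF positive_additive, folded \<Psi>_def]
  and \<Psi>_bounded = positive_additive.extension_bounded[OF positive_additive p, folded \<Psi>_def]

lemma \<Psi>_zero: "0 \<le> \<tau> \<Longrightarrow> \<Psi> \<tau> (\<lambda>t. 0) = 0"
  using \<Psi>_scaleR[of \<tau> "\<lambda>t. 0" 0] Lp_zero[OF p_nonneg] by simp

lemma \<Psi>_composition:
  assumes "0 \<le> \<tau>" "0 \<le> t" "u \<in> Lp p"
  shows "\<Psi> (\<tau> + t) u = T \<tau> (\<Psi> t (truncation t u)) + \<Psi> \<tau> (left_shift t u)"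
proof -
  have parts: "pos_part u \<in> Lp_plus p" "neg_part u \<in> Lp_plus p"
    using assms p_nonneg by (auto intro!: Lp_plus_I Lp_pos_part Lp_neg_part)
  have "pos_part (truncation t u) = truncation t (pos_part u)"
    "neg_part (truncation t u) = truncation t (neg_part u)"
    "pos_part (left_shift t u) = left_shift t (pos_part u)"
    "neg_part (left_shift t u) = left_shift t (neg_part u)"
    by (auto simp: fun_eq_iff pos_part_def neg_part_def truncation_def left_shift_def)
  then show ?thesis
    using assms composition[OF assms(1,2) parts(1)] composition[OF assms(1,2) parts(2)]
    by (simp add: \<Psi>_eq_diff blinfun.diff_right)
qed

lemma abstract_positive_control_system: "abstract_positive_control_system p T \<Phi> \<Psi>"
  unfolding abstract_positive_control_system_def
proof (intro conjI allI impI ballI)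
  fix \<tau> :: real assume \<tau>: "0 \<le> \<tau>"
  interpret F: positive_additive p "\<Phi> \<tau>" using \<tau> by (rule positive_additive)
  show "positive_linear_extension p (\<Phi> \<tau>) (\<Psi> \<tau>)"
    unfolding \<Psi>_def by (rule F.positive_linear_extension)
  show "G u = \<Psi> \<tau> u" if "positive_linear_extension p (\<Phi> \<tau>) G" "u \<in> Lp p" for G u
    unfolding \<Psi>_def using that by (rule F.extension_unique)
  show "\<exists>K. \<forall>u\<in>Lp p. norm (\<Psi> \<tau> u) \<le> K * Lp_norm p u" using \<Psi>_bounded[OF \<tau>] by blast
qed (rule \<Psi>_composition)

definition step :: "'u \<Rightarrow> real \<Rightarrow> real \<Rightarrow> 'u" where
  "step v a r = indicator {0..<a} r *\<^sub>R v"

lemma step_Lp: "0 \<le> a \<Longrightarrow> step v a \<in> Lp p"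
  unfolding step_def[abs_def] using p_pos by (intro Lp_indicator halfline_interval) auto

lemma step_Lp_plus: "0 \<le> a \<Longrightarrow> 0 \<le> v \<Longrightarrow> step v a \<in> Lp_plus p"
  by (intro Lp_plus_I step_Lp) (auto simp: step_def scaleR_nonneg_nonneg)

text \<open>The state that is reached from 0 after time \<open>t\<close> under the constant input \<open>v\<close>.\<close>

definition response :: "'u \<Rightarrow> real \<Rightarrow> 'x" where
  "response v t = \<Psi> t (step v t)"

lemma response_cocycle:
  assumes "0 \<le> s" "0 \<le> t"
  shows "response v (t + s) = T t (response v s) + response v t"
proof -
  have shift: "left_shift s (step v (t + s)) \<in> Lp p" "ae_eq (left_shift s (step v (t + s))) (step v t)"
    using assms by (auto intro!: Lp_left_shift step_Lp AE_I2
        simp: ae_eq_def left_shift_def step_def split: split_indicator)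
  have "truncation s (step v (t + s)) = step v s"
    using assms by (auto simp: fun_eq_iff truncation_def step_def split: split_indicator)
  moreover have "\<Psi> t (left_shift s (step v (t + s))) = \<Psi> t (step v t)"
    using shift assms by (intro \<Psi>_cong step_Lp) auto
  ultimately show ?thesis
    using \<Psi>_composition[of t s "step v (t + s)"] assms by (simp add: response_def step_Lp)
qed

text \<open>Delaying a short input to the end of the interval \<open>[0,1]\<close> shows that the norm of \<open>\<Psi> 1\<close>
  also controls the responses after times \<open>t \<le> 1\<close>.\<close>

lemma response_bound:
  obtains K where "0 \<le> K" "\<And>v t. 0 \<le> t \<Longrightarrow> t \<le> 1 \<Longrightarrow> norm (response v t) \<le> K * t powr (1 / p) * norm v"
proof -
  obtain K where K: "0 \<le> K" "\<And>u. u \<in> Lp p \<Longrightarrow> norm (\<Psi> 1 u) \<le> K * Lp_norm p u"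
    using \<Psi>_bounded[of 1] by auto
  have "norm (response v t) \<le> K * t powr (1 / p) * norm v" if t: "0 \<le> t" "t \<le> 1" for v t
  proof -
    define d where "d r = indicator {1 - t..<1} r *\<^sub>R v" for r :: real
    have I: "{1 - t..<1} \<in> sets halfline" "emeasure halfline {1 - t..<1} < \<infinity>" "measure halfline {1 - t..<1} = t"
      using halfline_interval[of "1 - t" 1] t by auto
    have d: "d \<in> Lp p" unfolding d_def[abs_def] by (rule Lp_indicator[OF I(1,2) p_pos])
    have "truncation (1 - t) d = (\<lambda>r. 0)" "left_shift (1 - t) d = step v t"
      by (auto simp: fun_eq_iff truncation_def left_shift_def d_def step_def split: split_indicator)
    then have "\<Psi> 1 d = response v t"
      using \<Psi>_composition[of t "1 - t" d] t d by (simp add: response_def \<Psi>_zero)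
    moreover have "Lp_norm p d = t powr (1 / p) * norm v"
      unfolding d_def[abs_def] using Lp_norm_indicator[OF I(1,2) p_pos] I(3) by simp
    ultimately show ?thesis using K(2)[OF d] by simp
  qed
  with K(1) show ?thesis using that by blast
qed

lemma response_continuous: "continuous_on {0..} (response v)"
proof (rule cocycle_continuous[OF response_cocycle])
  obtain K where K: "\<And>t. 0 \<le> t \<Longrightarrow> t \<le> 1 \<Longrightarrow> norm (response v t) \<le> K * t powr (1 / p) * norm v"
    using response_bound by metis
  show "(response v \<longlongrightarrow> 0) (at_right 0)"
  proof (rule Lim_null_comparison)
    show "\<forall>\<^sub>F t in at_right 0. norm (response v t) \<le> K * t powr (1 / p) * norm v"
      unfolding eventually_at_right_field by (intro exI[of _ 1]) (auto intro: K)
    have "((\<lambda>t. t powr (1 / p)) \<longlongrightarrow> 0) (at_right (0::real))"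
      using p_pos by (intro tendsto_zero_powrI[OF _ tendsto_const])
        (auto simp: eventually_at_right_field intro: tendsto_eq_intros)
    from tendsto_mult_left_zero[OF tendsto_mult_right_zero[OF this]]
    show "((\<lambda>t. K * t powr (1 / p) * norm v) \<longlongrightarrow> 0) (at_right 0)" .
  qed
qed

lemma step_add: "step (v + w) a = (\<lambda>r. step v a r + step w a r)"
  and step_scaleR: "step (c *\<^sub>R v) a = (\<lambda>r. c *\<^sub>R step v a r)"
  by (auto simp: fun_eq_iff step_def scaleR_right_distrib)

lemma response_add: "0 \<le> t \<Longrightarrow> response (v + w) t = response v t + response w t"
  and response_scaleR: "0 \<le> t \<Longrightarrow> response (c *\<^sub>R v) t = c *\<^sub>R response v t"
  by (simp_all add: response_def step_add step_scaleR \<Psi>_add \<Psi>_scaleR step_Lp)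

lemma bounded_linear_response: "bounded_linear (\<lambda>v. response v 1)"
proof -
  obtain K where "\<And>v. norm (response v 1) \<le> norm v * K"
    using response_bound by (metis mult.commute mult.right_neutral order_refl powr_one_eq_one zero_le_one)
  then show ?thesis
    by (intro bounded_linear_intro) (auto simp: response_add response_scaleR)
qed

lemma bounded_linear_integral_response: "bounded_linear (\<lambda>v. integral {0..1} (response v))"
proof -
  have int: "(response v has_integral integral {0..1} (response v)) {0..1}" for v
    by (intro integrable_integral integrable_continuous_real continuous_on_subset[OF response_continuous]) auto
  obtain K where K: "0 \<le> K" "\<And>v t. 0 \<le> t \<Longrightarrow> t \<le> 1 \<Longrightarrow> norm (response v t) \<le> K * t powr (1 / p) * norm v"
    using response_bound by metis
  show ?thesis
  proof (rule bounded_linear_intro)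
    fix v w :: 'u and c :: real
    have "(response (v + w) has_integral integral {0..1} (response v) + integral {0..1} (response w)) {0..1}"
      by (rule has_integral_eq[OF _ has_integral_add[OF int int]]) (simp add: response_add)
    then show "integral {0..1} (response (v + w)) = integral {0..1} (response v) + integral {0..1} (response w)"
      by (rule integral_unique)
    have "(response (c *\<^sub>R v) has_integral c *\<^sub>R integral {0..1} (response v)) {0..1}"
      by (rule has_integral_eq[OF _ has_integral_cmul[OF int]]) (simp add: response_scaleR)
    then show "integral {0..1} (response (c *\<^sub>R v)) = c *\<^sub>R integral {0..1} (response v)"
      by (rule integral_unique)
    have le: "norm (response v t) \<le> K * norm v" if "t \<in> {0..1}" for t
    proof -
      have "t powr (1 / p) \<le> 1 powr (1 / p)" using that p_pos by (intro powr_mono2) auto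
      then have "K * t powr (1 / p) * norm v \<le> K * 1 * norm v"
        using K(1) by (intro mult_right_mono mult_left_mono) auto
      then show ?thesis using K(2)[of t v] that by simp
    qed
    have "norm (integral {0..1} (response v)) \<le> K * norm v * measure lborel {0..1::real}"
      by (rule has_integral_bound_real[OF _ finite.emptyI int]) (use le K(1) in auto)
    then show "norm (integral {0..1} (response v)) \<le> norm v * K" by (simp add: mult.commute)
  qed
qed

end

section \<open>The control operator\<close>

locale extrapolated_control_system = extrapolation T \<mu> J + control_system T \<Phi> p
  for T :: "real \<Rightarrow> 'x::banach_lattice \<Rightarrow>\<^sub>L 'x" and \<mu> :: real and J :: "'x \<Rightarrow> 'z::banach"
    and \<Phi> :: "real \<Rightarrow> (real \<Rightarrow> 'u::banach_lattice) \<Rightarrow> 'x" and p :: real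
begin

text \<open>The control operator assigns to \<open>v\<close> the derivative at 0 of the response to the constant
  input \<open>v\<close>, taken in the extrapolation space.\<close>

lemma control_operator_exists:
  "\<exists>B :: 'u \<Rightarrow>\<^sub>L 'z. positive_control_operator J B \<and>
     (\<forall>v N. \<forall>t\<in>{0..N}. ((\<lambda>t. J (response v t)) has_vector_derivative TZ t (B v)) (at t within {0..N}))"
proof -
  interpret R: bounded_linear R by (rule bounded_linear_R)
  define b where "b v = R (response v 1) - \<mu> *\<^sub>R R (integral {0..1} (response v)) + integral {0..1} (response v)" for v
  have "\<forall>v. \<exists>c. Q c = b v \<and>
      (\<forall>N. \<forall>t\<in>{0..N}. ((\<lambda>t. J (response v t)) has_vector_derivative TZ t c) (at t within {0..N})) \<and>
      (\<lambda>n. J (real (Suc n) *\<^sub>R response v (1 / real (Suc n)))) \<longlonglongrightarrow> c"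
    unfolding b_def by (intro allI cocycle_derivative[OF response_cocycle response_continuous])
  from choice[OF this] obtain B where B: "\<And>v. Q (B v) = b v"
    "\<And>v N t. t \<in> {0..N} \<Longrightarrow> ((\<lambda>t. J (response v t)) has_vector_derivative TZ t (B v)) (at t within {0..N})"
    "\<And>v. (\<lambda>n. J (real (Suc n) *\<^sub>R response v (1 / real (Suc n)))) \<longlonglongrightarrow> B v" by blast
  have "bounded_linear b"
    unfolding b_def
    by (intro bounded_linear_add bounded_linear_sub bounded_linear_compose[OF bounded_linear_scaleR_right]
        bounded_linear_compose[OF bounded_linear_R] bounded_linear_response bounded_linear_integral_response)
  then interpret b: bounded_linear b .
  obtain K where K: "\<And>v. norm (b v) \<le> norm v * K" using b.bounded by blast
  have "bounded_linear B"
  proof (rule bounded_linear_intro)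
    show "B (v + w) = B v + B w" for v w
      by (simp add: Q_inject[symmetric] blinfun.add_right B(1) b.add)
    show "B (c *\<^sub>R v) = c *\<^sub>R B v" for c v
      by (simp add: Q_inject[symmetric] blinfun.scaleR_right B(1) b.scaleR)
    show "norm (B v) \<le> norm v * K" for v
      using norm_Q[of "B v"] K[of v] by (simp add: B(1))
  qed
  then have apply_B: "blinfun_apply (Blinfun B) = B" by (rule bounded_linear_Blinfun_apply)
  have "positive_control_operator J (Blinfun B)"
    unfolding positive_control_operator_def extrapolated_cone_def apply_B
  proof (intro allI impI)
    fix v :: 'u assume v: "0 \<le> v"
    have "0 \<le> real (Suc n) *\<^sub>R response v (1 / real (Suc n))" for n
      using v by (intro scaleR_nonneg_nonneg)
        (auto simp: response_def \<Psi>_eq step_Lp_plus intro!: cone)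
    then have "J (real (Suc n) *\<^sub>R response v (1 / real (Suc n))) \<in> J ` {x. 0 \<le> x}" for n by blast
    with B(3)[of v] show "B v \<in> closure (J ` {x. 0 \<le> x})"
      unfolding closure_sequential by (intro exI[of _ "\<lambda>n. J (real (Suc n) *\<^sub>R response v (1 / real (Suc n)))"]) blast
  qed
  with B(2) show ?thesis by (intro exI[of _ "Blinfun B"]) (simp add: apply_B)
qed

abbreviation "integrand \<equiv> convolution_integrand T J"

lemma TZ_bound: "\<exists>M\<ge>1. \<forall>t\<in>{0..N}. \<forall>z. norm (TZ t z) \<le> M * norm z"
proof -
  obtain M where M: "1 \<le> M" "\<And>t x. t \<in> {0..N} \<Longrightarrow> norm (T t x) \<le> M * norm x"
    using locally_bounded[of N] by blast
  have "norm (TZ t z) \<le> M * norm z" if "t \<in> {0..N}" for t z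
  proof -
    have "norm (TZ t z) = norm (T t (Q z))"
      using that by (subst norm_Q[symmetric], subst Q_TZ) auto
    then show ?thesis using M(2)[OF that, of "Q z"] by simp
  qed
  with M(1) show ?thesis by blast
qed

lemma TZ_reverse_continuous: "continuous_on {0..t} (\<lambda>s. TZ (t - s) z)"
proof (rule continuous_on_compose2[OF TZ_continuous[of z], of "{0..t}" "\<lambda>s. t - s"])
  show "continuous_on {0..t} (\<lambda>s. t - s)" by (intro continuous_intros)
qed auto

lemma integrand_step:
  "integrand B t (\<lambda>r. indicator E r *\<^sub>R v) s = indicator E s *\<^sub>R TZ (t - s) (B v)"
  by (simp add: convolution_integrand_def blinfun.scaleR_right)

lemma AE_halfline_Icc: "AE s in halfline. P s \<Longrightarrow> AE s in lebesgue_on {0..t}. P s"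
  by (rule AE_lebesgue_on_mono) auto

text \<open>The representation at time \<open>t\<close> for one input; it is extended from step functions to
  all of \<open>L\<^sup>p\<close>.\<close>

definition represented :: "('u \<Rightarrow>\<^sub>L 'z) \<Rightarrow> real \<Rightarrow> (real \<Rightarrow> 'u) \<Rightarrow> bool" where
  "represented B t u \<longleftrightarrow> u \<in> Lp p \<and> has_strong_integral (lebesgue_on {0..t}) (integrand B t u) (J (\<Psi> t u))"

lemma represented_cong:
  assumes "0 \<le> t" "represented B t u" "ae_eq u v"
  shows "represented B t v"
proof -
  interpret I: complete_measure "lebesgue_on {0..t}" by (rule complete_measure_lebesgue_on) simp
  have v: "v \<in> Lp p"
    using assms(2,3) Lp_cong_AE[of u p v] p_nonneg unfolding represented_def ae_eq_def by blast
  have "AE s in lebesgue_on {0..t}. u s = v s"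
    using assms(3) unfolding ae_eq_def by (rule AE_halfline_Icc)
  then have "AE s in lebesgue_on {0..t}. integrand B t u s = integrand B t v s"
    by eventually_elim (simp add: convolution_integrand_def)
  moreover have "\<Psi> t u = \<Psi> t v"
    using assms v by (intro \<Psi>_cong) (simp_all add: represented_def)
  ultimately show ?thesis
    using assms(2) v I.has_strong_integral_cong_AE[of "integrand B t u" "J (\<Psi> t u)" "integrand B t v"]
    unfolding represented_def by simp
qed

text \<open>The input \<open>v\<close> on \<open>[0,a)\<close> produces the state \<open>response v a\<close>, which then evolves freely for the time
  \<open>t - a\<close>; on the other side, \<open>- J (response v (t - s))\<close> is an antiderivative of the integrand.\<close>

lemma represented_step:
  fixes B :: "'u \<Rightarrow>\<^sub>L 'z"
  assumes B: "\<And>s. s \<in> {0..t} \<Longrightarrow> ((\<lambda>s. J (response v s)) has_vector_derivative TZ s (B v)) (at s within {0..t})"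
    and a: "0 \<le> a" "a \<le> t"
  shows "represented B t (\<lambda>r. indicator {0..<a} r *\<^sub>R v)"
proof -
  interpret J: bounded_linear J by (rule bounded_linear_J)
  have "has_strong_integral (lebesgue_on {0..t}) (\<lambda>s. indicator {0..<a} s *\<^sub>R TZ (t - s) (B v))
      (- J (response v (t - a)) - - J (response v (t - 0)))"
  proof (rule has_strong_integral_derivative[OF TZ_reverse_continuous])
    fix s assume s: "s \<in> {0..t}"
    have img: "(\<lambda>s. t - s) ` {0..t} = {0..t}" by force
    have "((\<lambda>s. t - s) has_vector_derivative -1) (at s within {0..t})"
      by (auto intro!: derivative_eq_intros)
    moreover have "((\<lambda>s. J (response v s)) has_vector_derivative TZ (t - s) (B v)) (at (t - s) within (\<lambda>s. t - s) ` {0..t})"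
      unfolding img using s by (intro B) auto
    ultimately have "((\<lambda>s. J (response v s)) \<circ> (\<lambda>s. t - s) has_vector_derivative (-1) *\<^sub>R TZ (t - s) (B v)) (at s within {0..t})"
      by (rule vector_diff_chain_within)
    from has_vector_derivative_minus[OF this]
    show "((\<lambda>s. - J (response v (t - s))) has_vector_derivative TZ (t - s) (B v)) (at s within {0..t})"
      by (simp add: o_def)
  qed (use a in auto)
  moreover have "- J (response v (t - a)) - - J (response v (t - 0)) = J (T (t - a) (response v a))"
    using response_cocycle[of a "t - a" v] a by (simp add: J.add)
  moreover have "\<Psi> t (step v a) = T (t - a) (response v a)"
  proof -
    have "\<Psi> (t - a) (left_shift a (step v a)) = \<Psi> (t - a) (\<lambda>r. 0)"
      using a by (intro \<Psi>_cong Lp_left_shift step_Lp Lp_zero p_nonneg)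
        (auto simp: ae_eq_def left_shift_def step_def)
    moreover have "truncation a (step v a) = step v a"
      by (auto simp: fun_eq_iff truncation_def step_def)
    ultimately show ?thesis
      using \<Psi>_composition[of "t - a" a "step v a"] a by (simp add: step_Lp response_def \<Psi>_zero)
  qed
  ultimately show ?thesis
    unfolding represented_def integrand_step[abs_def] using step_Lp[OF a(1), of v]
    by (simp add: step_def[abs_def] integrand_step)
qed

lemma represented_add:
  assumes "0 \<le> t" "represented B t u" "represented B t v"
  shows "represented B t (\<lambda>r. u r + v r)"
proof -
  interpret J: bounded_linear J by (rule bounded_linear_J)
  interpret I: complete_measure "lebesgue_on {0..t}" by (rule complete_measure_lebesgue_on) simp
  show ?thesis
    using assms I.has_strong_integral_add[of "integrand B t u" "J (\<Psi> t u)" "integrand B t v" "J (\<Psi> t v)"]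
    unfolding represented_def
    by (simp add: Lp_add p_nonneg \<Psi>_add J.add convolution_integrand_def[abs_def] blinfun.add_right)
qed

lemma represented_diff:
  assumes "0 \<le> t" "represented B t u" "represented B t v"
  shows "represented B t (\<lambda>r. u r - v r)"
proof -
  interpret J: bounded_linear J by (rule bounded_linear_J)
  interpret I: complete_measure "lebesgue_on {0..t}" by (rule complete_measure_lebesgue_on) simp
  show ?thesis
    using assms I.has_strong_integral_diff[of "integrand B t u" "J (\<Psi> t u)" "integrand B t v" "J (\<Psi> t v)"]
    unfolding represented_def
    by (simp add: Lp_diff p_nonneg \<Psi>_diff J.diff convolution_integrand_def[abs_def] blinfun.diff_right)
qed

text \<open>Both sides are continuous under dominated convergence: the left one because \<open>\<Psi> t\<close> is bounded on
  \<open>L\<^sup>p\<close>, the right one because \<open>L\<^sup>p\<close> functions are integrable over \<open>[0,t]\<close>.  In particular the integrand of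
  the limit is integrable.\<close>

lemma represented_limit:
  assumes t: "0 \<le> t" and u: "\<And>n::nat. represented B t (u n)"
    and lim: "AE r in halfline. (\<lambda>n. u n r) \<longlonglongrightarrow> v r"
    and g: "g \<in> Lp p" and bound: "\<And>n. AE r in halfline. norm (u n r) \<le> norm (g r)"
  shows "represented B t v"
proof -
  interpret J: bounded_linear J by (rule bounded_linear_J)
  interpret I: complete_measure "lebesgue_on {0..t}" by (rule complete_measure_lebesgue_on) simp
  have uL: "u n \<in> Lp p" for n using u by (simp add: represented_def)
  note v = Lp_dominated_convergence[OF p_pos uL lim g bound]
  obtain K where K: "0 \<le> K" "\<And>w. w \<in> Lp p \<Longrightarrow> norm (\<Psi> t w) \<le> K * Lp_norm p w"
    using \<Psi>_bounded[OF t] by blast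
  have "(\<lambda>n. \<Psi> t (u n) - \<Psi> t v) \<longlonglongrightarrow> 0"
  proof (rule Lim_null_comparison)
    show "\<forall>\<^sub>F n in sequentially. norm (\<Psi> t (u n) - \<Psi> t v) \<le> K * Lp_norm p (\<lambda>r. u n r - v r)"
      using K(2)[OF Lp_diff[OF uL v(1) p_nonneg]] by (simp add: \<Psi>_diff t uL v(1))
    show "(\<lambda>n. K * Lp_norm p (\<lambda>r. u n r - v r)) \<longlonglongrightarrow> 0"
      using tendsto_mult_left[OF v(2), of K] by simp
  qed
  then have J_lim: "(\<lambda>n. J (\<Psi> t (u n))) \<longlonglongrightarrow> J (\<Psi> t v)"
    by (rule J.tendsto[OF LIM_zero_cancel])
  obtain M where M: "1 \<le> M" "\<And>s z. s \<in> {0..t} \<Longrightarrow> norm (TZ s z) \<le> M * norm z"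
    using TZ_bound[of t] by blast
  define h where "h s = M * norm B * norm (g s)" for s
  have h_int: "integrable (lebesgue_on {0..t}) h"
    unfolding h_def[abs_def] by (intro integrable_mult_right Lp_locally_integrable[OF g p])
  have h_nonneg: "0 \<le> h s" for s using M(1) by (simp add: h_def)
  have "\<exists>L. has_strong_integral (lebesgue_on {0..t}) (integrand B t v) L \<and> (\<lambda>n. J (\<Psi> t (u n))) \<longlonglongrightarrow> L"
  proof (rule I.has_strong_integral_dominated_convergence)
    show "has_strong_integral (lebesgue_on {0..t}) (integrand B t (u n)) (J (\<Psi> t (u n)))" for n
      using u by (simp add: represented_def)
    show "AE s in lebesgue_on {0..t}. (\<lambda>n. integrand B t (u n) s) \<longlonglongrightarrow> integrand B t v s"
      using AE_halfline_Icc[OF lim]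
      by eventually_elim (auto simp: convolution_integrand_def intro!: tendsto_intros)
    show "h \<in> borel_measurable (lebesgue_on {0..t})" using h_int by auto
    show "(\<integral>\<^sup>+s. ennreal (h s) \<partial>lebesgue_on {0..t}) < \<infinity>"
      using h_int h_nonneg by (simp add: nn_integral_eq_integral)
    show "AE s in lebesgue_on {0..t}. norm (integrand B t (u n) s) \<le> h s" for n
      using AE_halfline_Icc[OF bound[of n]] AE_space
    proof eventually_elim
      case (elim s)
      have "norm (integrand B t (u n) s) \<le> M * norm (B (u n s))"
        unfolding convolution_integrand_def using elim(2) by (intro M(2)) auto
      also have "\<dots> \<le> M * (norm B * norm (g s))"
        using M(1) elim(1) by (intro mult_left_mono order_trans[OF norm_blinfun]) auto
      finally show ?case by (simp add: h_def)
    qed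
  qed
  then obtain L where L: "has_strong_integral (lebesgue_on {0..t}) (integrand B t v) L"
    "(\<lambda>n. J (\<Psi> t (u n))) \<longlonglongrightarrow> L" by blast
  with J_lim v(1) show ?thesis unfolding represented_def using LIMSEQ_unique by blast
qed

text \<open>With \<open>\<Phi> 0 = 0\<close>, the functional equation at \<open>\<tau> = 0\<close> says that \<open>\<Psi> t u\<close> depends
  only on the restriction of \<open>u\<close> to \<open>[0,t)\<close>.\<close>

lemma represented_all:
  fixes B :: "'u \<Rightarrow>\<^sub>L 'z"
  assumes zero: "\<And>u. u \<in> Lp_plus p \<Longrightarrow> \<Phi> 0 u = 0"
    and B: "\<And>v N t. t \<in> {0..N} \<Longrightarrow> ((\<lambda>t. J (response v t)) has_vector_derivative TZ t (B v)) (at t within {0..N})"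
    and t: "0 \<le> t" and u: "u \<in> Lp p"
  shows "represented B t u"
proof -
  interpret I: complete_measure "lebesgue_on {0..t}" by (rule complete_measure_lebesgue_on) simp
  have "represented B t (truncation t u)"
  proof (rule Lp_truncation_induct[OF p_pos t u])
    show "represented B t (\<lambda>r. indicator {0..<a} r *\<^sub>R v)" if "0 \<le> a" "a \<le> t" for v a
      using B that by (rule represented_step)
  qed (use t in \<open>blast intro: represented_cong represented_add represented_diff represented_limit\<close>)+
  moreover have "\<Psi> t (truncation t u) = \<Psi> t u"
  proof -
    have "\<Psi> 0 (left_shift t u) = 0"
      using Lp_left_shift[OF u t] zero p_nonneg
      by (simp add: \<Psi>_eq_diff Lp_plus_I Lp_pos_part Lp_neg_part)
    then show ?thesis using \<Psi>_composition[of 0 t u] t u by simp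
  qed
  moreover have "AE s in lebesgue_on {0..t}. integrand B t (truncation t u) s = integrand B t u s"
  proof -
    have "{t} \<in> null_sets (lebesgue_on {0..t})"
      using t by (auto simp: null_sets_restrict_space)
    then have "AE s in lebesgue_on {0..t}. s \<notin> {t}" by (rule AE_not_in)
    with AE_space show ?thesis
      by eventually_elim (auto simp: convolution_integrand_def truncation_def)
  qed
  ultimately show ?thesis
    unfolding represented_def using u
      I.has_strong_integral_cong_AE[of "integrand B t (truncation t u)" "J (\<Psi> t u)" "integrand B t u"]
    by simp
qed

lemma represents_if_represented:
  assumes "\<And>t u. 0 \<le> t \<Longrightarrow> u \<in> Lp p \<Longrightarrow> represented B t u"
  shows "represents p T J B \<Psi>"
  unfolding represents_def
proof (intro ballI allI impI)
  fix u :: "real \<Rightarrow> 'u" and t :: real assume u: "u \<in> Lp p" and t: "0 \<le> t"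
  interpret J: bounded_linear J by (rule bounded_linear_J)
  interpret I: complete_measure "lebesgue_on {0..t}" by (rule complete_measure_lebesgue_on) simp
  have parts: "pos_part u \<in> Lp_plus p" "neg_part u \<in> Lp_plus p"
    using u p_nonneg by (auto intro!: Lp_plus_I Lp_pos_part Lp_neg_part)
  have *: "has_strong_integral (lebesgue_on {0..t}) (integrand B t w) (J (\<Phi> t w))" if "w \<in> Lp_plus p" for w
    using assms[OF t, of w] that t by (simp add: represented_def \<Psi>_eq Lp_plus_def)
  show "strongly_integrable (lebesgue_on {0..t}) (integrand B t (pos_part u)) \<and>
      strongly_integrable (lebesgue_on {0..t}) (integrand B t (neg_part u)) \<and>
      J (\<Psi> t u) = strong_integral (lebesgue_on {0..t}) (integrand B t (pos_part u)) -
        strong_integral (lebesgue_on {0..t}) (integrand B t (neg_part u))"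
    using *[OF parts(1)] *[OF parts(2)] t
    by (auto simp: strongly_integrable_def I.strong_integral_eq \<Psi>_eq_diff J.diff)
qed

text \<open>A constant input \<open>v \<ge> 0\<close> on the interval \<open>[0,t]\<close> recovers \<open>B v\<close>: the average of
  \<open>TZ (t - s) (B v)\<close> over this interval tends to \<open>B v\<close> as \<open>t \<rightarrow> 0\<close>.\<close>

lemma represents_unique:
  assumes B: "represents p T J B \<Psi>" and B': "represents p T J B' \<Psi>"
  shows "B = B'"
proof -
  have step_int: "has_strong_integral (lebesgue_on {0..t}) (\<lambda>s. indicator {0..<t} s *\<^sub>R TZ (t - s) (C v)) (J (\<Psi> t (step v t)))"
    if C: "represents p T J C \<Psi>" and v: "0 \<le> v" and t: "0 \<le> t" for C v t
  proof -
    interpret I: complete_measure "lebesgue_on {0..t}" by (rule complete_measure_lebesgue_on) simp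
    have parts: "pos_part (step v t) = step v t" "neg_part (step v t) = (\<lambda>s. 0)"
      using v by (intro ext pos_part_eq neg_part_eq; simp add: step_def scaleR_nonneg_nonneg)+
    have C': "strongly_integrable (lebesgue_on {0..t}) (integrand C t (step v t))"
      "strongly_integrable (lebesgue_on {0..t}) (integrand C t (\<lambda>s. 0))"
      "J (\<Psi> t (step v t)) = strong_integral (lebesgue_on {0..t}) (integrand C t (step v t)) -
        strong_integral (lebesgue_on {0..t}) (integrand C t (\<lambda>s. 0))"
      using C[unfolded represents_def, rule_format, OF step_Lp[OF t, of v] t] unfolding parts by blast+
    obtain I0 where I0: "has_strong_integral (lebesgue_on {0..t}) (integrand C t (\<lambda>s. 0)) I0"
      using C'(2) by (auto simp: strongly_integrable_def)
    have "I0 = 0"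
      using I.has_strong_integral_norm_le[OF I0] by (simp add: convolution_integrand_def)
    with I0 C'(1,3) have "has_strong_integral (lebesgue_on {0..t}) (integrand C t (step v t)) (J (\<Psi> t (step v t)))"
      by (auto simp: strongly_integrable_def I.strong_integral_eq)
    then show ?thesis unfolding step_def[abs_def] integrand_step[abs_def] .
  qed
  have nonneg: "B v = B' v" if v: "0 \<le> v" for v
  proof -
    define d where "d = B v - B' v"
    have "norm d \<le> e" if e: "0 < e" for e
    proof -
      obtain r where r: "0 < r" "\<And>s. s \<in> {0..} \<Longrightarrow> dist s 0 < r \<Longrightarrow> dist (TZ s d) (TZ 0 d) < e"
        using TZ_continuous[of d] e unfolding continuous_on_iff by (metis atLeast_iff order_refl)
      define t where "t = r / 2"
      have t: "0 < t" "t < r" using r(1) by (auto simp: t_def)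
      interpret I: complete_measure "lebesgue_on {0..t}" by (rule complete_measure_lebesgue_on) simp
      have E: "{0..<t} \<in> sets (lebesgue_on {0..t})" "emeasure (lebesgue_on {0..t}) {0..<t} = ennreal t"
        using t by (auto simp: sets_restrict_space_iff) (subst emeasure_restrict_space; auto)
      have "has_strong_integral (lebesgue_on {0..t}) (\<lambda>s. indicator {0..<t} s *\<^sub>R d) (t *\<^sub>R d)"
        using I.has_strong_integral_indicator[OF E(1), of d] E(2) t by (simp add: measure_def)
      from I.has_strong_integral_diff[OF this
          I.has_strong_integral_diff[OF step_int[OF B v] step_int[OF B' v]]] t
      have "has_strong_integral (lebesgue_on {0..t}) (\<lambda>s. indicator {0..<t} s *\<^sub>R d -
          (indicator {0..<t} s *\<^sub>R TZ (t - s) (B v) - indicator {0..<t} s *\<^sub>R TZ (t - s) (B' v))) (t *\<^sub>R d)"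
        by simp
      then have "ennreal (norm (t *\<^sub>R d)) \<le> (\<integral>\<^sup>+s. norm (indicator {0..<t} s *\<^sub>R d -
          (indicator {0..<t} s *\<^sub>R TZ (t - s) (B v) - indicator {0..<t} s *\<^sub>R TZ (t - s) (B' v))) \<partial>lebesgue_on {0..t})"
        by (rule I.has_strong_integral_norm_le)
      also have "\<dots> \<le> (\<integral>\<^sup>+s. ennreal e * indicator {0..<t} s \<partial>lebesgue_on {0..t})"
      proof (intro nn_integral_mono)
        fix s
        have "norm (d - (TZ (t - s) (B v) - TZ (t - s) (B' v))) \<le> e" if "s \<in> {0..<t}"
          using r(2)[of "t - s"] that t
          by (simp add: dist_norm norm_minus_commute d_def blinfun.diff_right)
        then show "ennreal (norm (indicator {0..<t} s *\<^sub>R d - (indicator {0..<t} s *\<^sub>R TZ (t - s) (B v) -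
            indicator {0..<t} s *\<^sub>R TZ (t - s) (B' v)))) \<le> ennreal e * indicator {0..<t} s"
          by (auto split: split_indicator intro!: ennreal_leI)
      qed
      also have "\<dots> = ennreal e * ennreal t" using E by (simp add: nn_integral_cmult_indicator)
      also have "\<dots> = ennreal (e * t)" using e t by (simp add: ennreal_mult)
      finally have "t * norm d \<le> e * t" using e t by (simp add: ennreal_le_iff)
      then show ?thesis using t by (simp add: mult.commute)
    qed
    then have "norm d \<le> 0" by (rule field_le_epsilon) simp
    then show ?thesis by (simp add: d_def)
  qed
  have "B v = B' v" for v
  proof -
    have "B (sup v 0 - sup (- v) 0) = B' (sup v 0 - sup (- v) 0)"
      unfolding blinfun.diff_right by (simp add: nonneg)
    then show ?thesis by (simp only: sup_zero_minus_sup_zero)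
  qed
  then show ?thesis by (rule blinfun_eqI)
qed

end

theorem proposition2p2:
  fixes T :: "real \<Rightarrow> 'x::banach_lattice \<Rightarrow>\<^sub>L 'x"
    and \<Phi> :: "real \<Rightarrow> (real \<Rightarrow> 'u::banach_lattice) \<Rightarrow> 'x"
    and p \<mu> :: real
    and J :: "'x \<Rightarrow> 'z::banach"
  assumes semigroup: "C0_semigroup T"
    and positive: "positive_semigroup T"
    and p: "1 \<le> p"
    and resolvent: "\<mu> \<in> resolvent_set T"
    and extrapolation: "extrapolation_space T \<mu> J"
    and well_defined: "\<And>\<tau> u v. 0 \<le> \<tau> \<Longrightarrow> u \<in> Lp_plus p \<Longrightarrow> v \<in> Lp_plus p \<Longrightarrow> ae_eq u v \<Longrightarrow>
           \<Phi> \<tau> u = \<Phi> \<tau> v"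
    and cone: "\<And>\<tau> u. 0 \<le> \<tau> \<Longrightarrow> u \<in> Lp_plus p \<Longrightarrow> 0 \<le> \<Phi> \<tau> u"
    and additive: "\<And>\<tau> u v. 0 \<le> \<tau> \<Longrightarrow> u \<in> Lp_plus p \<Longrightarrow> v \<in> Lp_plus p \<Longrightarrow>
           \<Phi> \<tau> (\<lambda>t. u t + v t) = \<Phi> \<tau> u + \<Phi> \<tau> v"
    and composition: "\<And>\<tau> t u. 0 \<le> \<tau> \<Longrightarrow> 0 \<le> t \<Longrightarrow> u \<in> Lp_plus p \<Longrightarrow>
           \<Phi> (\<tau> + t) u = blinfun_apply (T \<tau>) (\<Phi> t (truncation t u)) + \<Phi> \<tau> (left_shift t u)"
  shows "\<exists>\<Psi>. abstract_positive_control_system p T \<Phi> \<Psi> \<and>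
           ((\<forall>u\<in>Lp_plus p. \<Phi> 0 u = 0) \<longrightarrow>
             (\<exists>!B :: 'u \<Rightarrow>\<^sub>L 'z. positive_control_operator J B \<and> represents p T J B \<Psi>))"
proof -
  interpret extrapolated_control_system T \<mu> J \<Phi> p
    by unfold_locales (fact semigroup positive resolvent extrapolation p well_defined cone additive composition)+
  show ?thesis
  proof (intro exI[of _ \<Psi>] conjI impI)
    show "abstract_positive_control_system p T \<Phi> \<Psi>" by (rule abstract_positive_control_system)
  next
    assume zero: "\<forall>u\<in>Lp_plus p. \<Phi> 0 u = 0"
    obtain B :: "'u \<Rightarrow>\<^sub>L 'z" where B: "positive_control_operator J B"
      "\<And>v N t. t \<in> {0..N} \<Longrightarrow> ((\<lambda>t. J (response v t)) has_vector_derivative TZ t (B v)) (at t within {0..N})"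
      using control_operator_exists by blast
    have "represents p T J B \<Psi>"
      by (intro represents_if_represented represented_all[OF _ B(2)]) (use zero in auto)
    with B(1) show "\<exists>!B :: 'u \<Rightarrow>\<^sub>L 'z. positive_control_operator J B \<and> represents p T J B \<Psi>"
      using represents_unique by blast
  qed
qed

end
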